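(* Let $\Omega$ be a domain in $\mathbb C$, let $M$ be a complete hermitian complex space with hermitian metric $E$, and let $\mathcal F\subset\mathrm{Hol}(\Omega,M)$. Then $\mathcal F$ is not normal if and only if there exist sequences $\{p_j\}\subset\Omega$ with $p_j\to p_0\in\Omega$ as $j\to\infty$, $\{f_j\}\subset\mathcal F$, and $\{\rho_j\}\subset\mathbb R$ with $\rho_j>0$ and $\rho_j\to0^+$ as $j\to\infty$, such that the sequence $$g_j(\xi):=f_j(p_j+\rho_j\xi),\quad \xi\in\mathbb C,$$ satisfies one of the following two assertions: (i) the sequence $\{g_j\}$ is compactly divergent on $\mathbb C$; (ii) the sequence $\{g_j\}$ converges uniformly on compact subsets of $\mathbb C$ to a non-constant $E$-Brody curve $g:\mathbb C\to M$.
   Context: $\mathrm{Hol}(X,Y)$ is the set of holomorphic maps $X\to Y$. Complete means that the distance on $M$ induced by the hermitian metric $E$ is complete. A holomorphic curve $g:\mathbb C\to M$ is an $E$-Brody curve if the $E$-length $|g'(z)|_E$ of its derivative is bounded on $\mathbb C$. A family $\mathcal F\subset\mathrm{Hol}(X,Y)$ is normal if it is relatively compact in $\mathrm{Hol}(X,Y)$ in the compact-open topology (so limits must have values in $Y$). A sequence $\{f_j\}$ of holomorphic maps from $X$ to $Y$ is compactly divergent if for all compact sets $K\subset X$ and $L\subset Y$ there is $j_0$ with $f_j(K)\cap L=\emptyset$ for all $j\ge j_0$. Each $g_j$ is defined only where $p_j+\rho_j\xi\in\Omega$; any given compact subset of $\mathbb C$ lies in its domain for all large $j$, and compact divergence and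 uniform convergence on compact subsets of $\mathbb C$ are understood accordingly. *)

theory Defs
  imports "HOL-Analysis.Analysis"
begin

text \<open>
  Complex spaces are reduced (over a domain of the plane, every holomorphic map into a
  non-reduced space factors through the reduction), Hausdorff and second countable; they need
  not be connected or pure dimensional, and the embedding dimension may vary from point to
  point without a bound. For this reason \<open>C^n\<close> is not a type indexed by \<open>n\<close>
  but the subspace \<open>cvec n\<close> of the functions \<open>nat \<Rightarrow> complex\<close>.
\<close>

subsection \<open>Calculus on \<open>C^n\<close>\<close>

text \<open>The product topology on \<open>nat \<Rightarrow> complex\<close> induces the Euclidean topology on \<open>cvec n\<close>.\<close>

definition cvec :: "nat \<Rightarrow> (nat \<Rightarrow> complex) set" where
  "cvec n = {z. \<forall>i\<ge>n. z i = 0}"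

definition copen :: "nat \<Rightarrow> (nat \<Rightarrow> complex) set \<Rightarrow> bool" where
  "copen n W \<longleftrightarrow> openin (top_of_set (cvec n)) W"

definition cnorm :: "nat \<Rightarrow> (nat \<Rightarrow> complex) \<Rightarrow> real" where
  "cnorm n v = L2_set (\<lambda>i. cmod (v i)) {..<n}"

text \<open>Complex Frechet differentiability at \<open>z\<close>, the differential being \<open>v \<mapsto> \<Sum>i<n. a i * v i\<close>.\<close>

definition has_cgrad ::
  "nat \<Rightarrow> ((nat \<Rightarrow> complex) \<Rightarrow> complex) \<Rightarrow> (nat \<Rightarrow> complex) \<Rightarrow> (nat \<Rightarrow> complex) \<Rightarrow> bool" where
  "has_cgrad n f z a \<longleftrightarrow>
     (\<forall>\<epsilon>>0. \<exists>\<delta>>0. \<forall>w\<in>cvec n. cnorm n (\<lambda>i. w i - z i) < \<delta> \<longrightarrow>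
        cmod (f w - f z - (\<Sum>i<n. a i * (w i - z i))) \<le> \<epsilon> * cnorm n (\<lambda>i. w i - z i))"

definition holo :: "nat \<Rightarrow> (nat \<Rightarrow> complex) set \<Rightarrow> ((nat \<Rightarrow> complex) \<Rightarrow> complex) \<Rightarrow> bool" where
  "holo n W f \<longleftrightarrow> copen n W \<and> (\<forall>z\<in>W. \<exists>a. has_cgrad n f z a)"

definition shift :: "(nat \<Rightarrow> complex) \<Rightarrow> nat \<Rightarrow> complex \<Rightarrow> real \<Rightarrow> nat \<Rightarrow> complex" where
  "shift z j u t = z(j := z j + of_real t * u)"

text \<open>
  \<open>k\<close> times continuously differentiable in the real sense: the \<open>2n\<close> real coordinate
  directions are \<open>u\<close> times the \<open>j\<close>-th unit vector, with \<open>u = 1\<close> or \<open>u = \<i>\<close>.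
\<close>

fun Ck_on :: "nat \<Rightarrow> nat \<Rightarrow> (nat \<Rightarrow> complex) set \<Rightarrow> ((nat \<Rightarrow> complex) \<Rightarrow> complex) \<Rightarrow> bool" where
  "Ck_on n 0 W f \<longleftrightarrow> continuous_on W f"
| "Ck_on n (Suc k) W f \<longleftrightarrow> continuous_on W f \<and>
     (\<forall>j<n. \<forall>u\<in>{1, \<i>}.
        (\<forall>z\<in>W. (\<lambda>t. f (shift z j u t)) differentiable (at 0)) \<and>
        Ck_on n k W (\<lambda>z. vector_derivative (\<lambda>t. f (shift z j u t)) (at 0)))"

definition smooth :: "nat \<Rightarrow> (nat \<Rightarrow> complex) set \<Rightarrow> ((nat \<Rightarrow> complex) \<Rightarrow> complex) \<Rightarrow> bool" where
  "smooth n W f \<longleftrightarrow> (\<forall>k. Ck_on n k W f)"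

subsection \<open>Complex spaces\<close>

definition analytic_subset :: "nat \<Rightarrow> (nat \<Rightarrow> complex) set \<Rightarrow> (nat \<Rightarrow> complex) set \<Rightarrow> bool" where
  "analytic_subset n D Z \<longleftrightarrow> copen n D \<and> Z \<subseteq> D \<and>
     (\<forall>z\<in>D. \<exists>V G. copen n V \<and> z \<in> V \<and> V \<subseteq> D \<and> finite G \<and> (\<forall>g\<in>G. holo n V g) \<and>
        Z \<inter> V = {w\<in>V. \<forall>g\<in>G. g w = 0})"

text \<open>The Zariski tangent space of the reduced analytic set \<open>Z\<close> at \<open>z\<close>.\<close>

definition ztangent :: "nat \<Rightarrow> (nat \<Rightarrow> complex) set \<Rightarrow> (nat \<Rightarrow> complex) \<Rightarrow> (nat \<Rightarrow> complex) set" where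
  "ztangent n Z z = {v\<in>cvec n. \<forall>V g a. z \<in> V \<and> holo n V g \<and> (\<forall>w\<in>Z \<inter> V. g w = 0) \<and> has_cgrad n g z a
      \<longrightarrow> (\<Sum>i<n. a i * v i) = 0}"

record 'm chart =
  cdim :: nat
  cdom :: "'m set"
  cmap :: "'m \<Rightarrow> nat \<Rightarrow> complex"

abbreviation cimg :: "'m chart \<Rightarrow> (nat \<Rightarrow> complex) set" where
  "cimg c \<equiv> cmap c ` cdom c"

definition local_model :: "'m topology \<Rightarrow> 'm chart \<Rightarrow> bool" where
  "local_model M c \<longleftrightarrow> openin M (cdom c) \<and> (\<exists>D. analytic_subset (cdim c) D (cimg c)) \<and>
     homeomorphic_map (subtopology M (cdom c)) (top_of_set (cimg c)) (cmap c)"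

text \<open>\<open>F\<close> is a holomorphic extension, to the ambient neighbourhood \<open>W\<close> of \<open>x\<close>, of the change from chart \<open>c\<close> to \<open>d\<close>.\<close>

definition transition ::
  "'m chart \<Rightarrow> 'm chart \<Rightarrow> 'm \<Rightarrow> (nat \<Rightarrow> complex) set \<Rightarrow> ((nat \<Rightarrow> complex) \<Rightarrow> nat \<Rightarrow> complex) \<Rightarrow> bool" where
  "transition c d x W F \<longleftrightarrow> cmap c x \<in> W \<and> copen (cdim c) W \<and>
     (\<forall>k<cdim d. holo (cdim c) W (\<lambda>w. F w k)) \<and>
     (\<forall>y\<in>cdom c \<inter> cdom d. cmap c y \<in> W \<longrightarrow> (\<forall>k<cdim d. F (cmap c y) k = cmap d y k))"

definition complex_space :: "'m topology \<Rightarrow> 'm chart set \<Rightarrow> bool" where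
  "complex_space M A \<longleftrightarrow> Hausdorff_space M \<and> second_countable M \<and>
     (\<forall>c\<in>A. local_model M c) \<and> topspace M = (\<Union>c\<in>A. cdom c) \<and>
     (\<forall>c\<in>A. \<forall>d\<in>A. \<forall>x\<in>cdom c \<inter> cdom d. \<exists>W F. transition c d x W F)"

subsection \<open>Hermitian metrics\<close>

definition hform :: "nat \<Rightarrow> (nat \<Rightarrow> nat \<Rightarrow> complex) \<Rightarrow> (nat \<Rightarrow> complex) \<Rightarrow> (nat \<Rightarrow> complex) \<Rightarrow> complex" where
  "hform n H v w = (\<Sum>i<n. \<Sum>j<n. H i j * v i * cnj (w j))"

definition posdef_hermitian :: "nat \<Rightarrow> (nat \<Rightarrow> nat \<Rightarrow> complex) \<Rightarrow> bool" where
  "posdef_hermitian n H \<longleftrightarrow> (\<forall>i<n. \<forall>j<n. H j i = cnj (H i j)) \<and>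
     (\<forall>v. (\<exists>i<n. v i \<noteq> 0) \<longrightarrow> Re (hform n H v v) > 0)"

text \<open>
  \<open>E c x\<close> is the inner product on the tangent space of \<open>M\<close> at \<open>x\<close>, written in the chart
  \<open>c\<close>. Near every point it is the restriction of a smooth hermitian metric of the ambient
  \<open>C^n\<close>, and the changes of charts are isometric on tangent vectors.
\<close>

type_synonym 'm metric_data = "'m chart \<Rightarrow> 'm \<Rightarrow> (nat \<Rightarrow> complex) \<Rightarrow> (nat \<Rightarrow> complex) \<Rightarrow> complex"

definition hermitian_metric :: "'m chart set \<Rightarrow> 'm metric_data \<Rightarrow> bool" where
  "hermitian_metric A E \<longleftrightarrow>
     (\<forall>c\<in>A. \<forall>x\<in>cdom c. \<exists>W H. copen (cdim c) W \<and> cmap c x \<in> W \<and>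
        (\<forall>i<cdim c. \<forall>j<cdim c. smooth (cdim c) W (\<lambda>z. H z i j)) \<and>
        (\<forall>z\<in>W. posdef_hermitian (cdim c) (H z)) \<and>
        (\<forall>y\<in>cdom c. cmap c y \<in> W \<longrightarrow>
           (\<forall>v\<in>ztangent (cdim c) (cimg c) (cmap c y). \<forall>w\<in>ztangent (cdim c) (cimg c) (cmap c y).
              E c y v w = hform (cdim c) (H (cmap c y)) v w))) \<and>
     (\<forall>c\<in>A. \<forall>d\<in>A. \<forall>x\<in>cdom c \<inter> cdom d. \<forall>W F J.
        transition c d x W F \<and> (\<forall>k<cdim d. has_cgrad (cdim c) (\<lambda>w. F w k) (cmap c x) (J k)) \<longrightarrow>
        (\<forall>v\<in>ztangent (cdim c) (cimg c) (cmap c x). \<forall>w\<in>ztangent (cdim c) (cimg c) (cmap c x).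
           E c x v w = E d x (\<lambda>k. if k < cdim d then \<Sum>i<cdim c. J k i * v i else 0)
                             (\<lambda>k. if k < cdim d then \<Sum>i<cdim c. J k i * w i else 0)))"

definition tangent_length :: "'m metric_data \<Rightarrow> 'm chart \<Rightarrow> 'm \<Rightarrow> (nat \<Rightarrow> complex) \<Rightarrow> real" where
  "tangent_length E c x v = sqrt (Re (E c x v v))"

text \<open>
  The lengths of derivatives below are computed in a chosen chart; by the isometry clause
  above they do not depend on the choice.
\<close>

definition chart_at :: "'m chart set \<Rightarrow> 'm \<Rightarrow> 'm chart" where
  "chart_at A x = (SOME c. c \<in> A \<and> x \<in> cdom c)"

definition curve_speed :: "'m chart set \<Rightarrow> 'm metric_data \<Rightarrow> (real \<Rightarrow> 'm) \<Rightarrow> real \<Rightarrow> real" where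
  "curve_speed A E \<gamma> t = (let c = chart_at A (\<gamma> t) in
     tangent_length E c (\<gamma> t)
       (\<lambda>i. if i < cdim c then vector_derivative (\<lambda>s. cmap c (\<gamma> s) i) (at t) else 0))"

text \<open>Derivatives at the end points of \<open>[a, b]\<close> are one-sided.\<close>

definition C1_curve_on :: "'m chart set \<Rightarrow> (real \<Rightarrow> 'm) \<Rightarrow> real \<Rightarrow> real \<Rightarrow> bool" where
  "C1_curve_on A \<gamma> a b \<longleftrightarrow>
     (\<forall>c\<in>A. \<forall>i<cdim c. \<exists>D. continuous_on {t\<in>{a..b}. \<gamma> t \<in> cdom c} D \<and>
        (\<forall>t\<in>{t\<in>{a..b}. \<gamma> t \<in> cdom c}.
           ((\<lambda>s. cmap c (\<gamma> s) i) has_vector_derivative D t) (at t within {t\<in>{a..b}. \<gamma> t \<in> cdom c})))"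

definition piecewise_C1_curve :: "'m topology \<Rightarrow> 'm chart set \<Rightarrow> (real \<Rightarrow> 'm) \<Rightarrow> bool" where
  "piecewise_C1_curve M A \<gamma> \<longleftrightarrow> pathin M \<gamma> \<and>
     (\<exists>S. finite S \<and> (\<forall>a b. 0 \<le> a \<and> a < b \<and> b \<le> 1 \<and> {a<..<b} \<inter> S = {} \<longrightarrow> C1_curve_on A \<gamma> a b))"

text \<open>The distance is infinite between points of different connected components.\<close>

definition herm_dist :: "'m topology \<Rightarrow> 'm chart set \<Rightarrow> 'm metric_data \<Rightarrow> 'm \<Rightarrow> 'm \<Rightarrow> ennreal" where
  "herm_dist M A E x y =
     (INF \<gamma> \<in> {\<gamma>. piecewise_C1_curve M A \<gamma> \<and> \<gamma> 0 = x \<and> \<gamma> 1 = y}.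
        ennreal (integral {0..1} (curve_speed A E \<gamma>)))"

definition complete_metric :: "'m topology \<Rightarrow> 'm chart set \<Rightarrow> 'm metric_data \<Rightarrow> bool" where
  "complete_metric M A E \<longleftrightarrow>
     (\<forall>s::nat \<Rightarrow> 'm. range s \<subseteq> topspace M \<and>
        (\<forall>\<epsilon>>0. \<exists>N. \<forall>m\<ge>N. \<forall>n\<ge>N. herm_dist M A E (s m) (s n) < \<epsilon>) \<longrightarrow>
        (\<exists>y\<in>topspace M. (\<lambda>n. herm_dist M A E (s n) y) \<longlonglongrightarrow> 0))"

definition complete_hermitian_space :: "'m topology \<Rightarrow> 'm chart set \<Rightarrow> 'm metric_data \<Rightarrow> bool" where
  "complete_hermitian_space M A E \<longleftrightarrow>
     complex_space M A \<and> hermitian_metric A E \<and> complete_metric M A E"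

subsection \<open>Holomorphic maps from plane open sets, normality\<close>

text \<open>Maps are \<open>undefined\<close> outside of \<open>\<Omega>\<close>, so that equal maps are equal functions.\<close>

definition Hol :: "complex set \<Rightarrow> 'm topology \<Rightarrow> 'm chart set \<Rightarrow> (complex \<Rightarrow> 'm) set" where
  "Hol \<Omega> M A = {f \<in> extensional \<Omega>. continuous_map (top_of_set \<Omega>) M f \<and>
     (\<forall>c\<in>A. \<forall>i<cdim c. (\<lambda>z. cmap c (f z) i) holomorphic_on {z\<in>\<Omega>. f z \<in> cdom c})}"

definition compact_open_topology ::
  "complex set \<Rightarrow> 'm topology \<Rightarrow> 'm chart set \<Rightarrow> (complex \<Rightarrow> 'm) topology" where
  "compact_open_topology \<Omega> M A =
     topology_generated_by {{f \<in> Hol \<Omega> M A. f ` K \<subseteq> U} | K U. compact K \<and> K \<subseteq> \<Omega> \<and> openin M U}"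

definition normal_family ::
  "complex set \<Rightarrow> 'm topology \<Rightarrow> 'm chart set \<Rightarrow> (complex \<Rightarrow> 'm) set \<Rightarrow> bool" where
  "normal_family \<Omega> M A \<F> \<longleftrightarrow>
     compactin (compact_open_topology \<Omega> M A) (compact_open_topology \<Omega> M A closure_of \<F>)"

definition brody_curve :: "'m topology \<Rightarrow> 'm chart set \<Rightarrow> 'm metric_data \<Rightarrow> (complex \<Rightarrow> 'm) \<Rightarrow> bool" where
  "brody_curve M A E g \<longleftrightarrow> g \<in> Hol UNIV M A \<and>
     (\<exists>B. \<forall>z. (let c = chart_at A (g z) in
        tangent_length E c (g z)
          (\<lambda>i. if i < cdim c then deriv (\<lambda>w. cmap c (g w) i) z else 0)) \<le> B)"

text \<open>The two modes of behaviour of a sequence of maps \<open>g j\<close> defined on \<open>D j \<subseteq> C\<close> only.\<close>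

definition compactly_divergent ::
  "'m topology \<Rightarrow> (nat \<Rightarrow> complex set) \<Rightarrow> (nat \<Rightarrow> complex \<Rightarrow> 'm) \<Rightarrow> bool" where
  "compactly_divergent M D g \<longleftrightarrow>
     (\<forall>K L. compact K \<and> compactin M L \<longrightarrow> (\<exists>j0. \<forall>j\<ge>j0. K \<subseteq> D j \<and> g j ` K \<inter> L = {}))"

text \<open>
  Uniformity is measured by the metrics inducing the topology of \<open>M\<close>. There are such metrics, as
  a complex space is second countable and locally compact, and all of them give the same
  notion for a continuous limit \<open>h\<close>; it is convergence in the compact-open topology.
\<close>

definition converges_uniformly_on_compacts ::
  "'m topology \<Rightarrow> (nat \<Rightarrow> complex set) \<Rightarrow> (nat \<Rightarrow> complex \<Rightarrow> 'm) \<Rightarrow> (complex \<Rightarrow> 'm) \<Rightarrow> bool" where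
  "converges_uniformly_on_compacts M D g h \<longleftrightarrow>
     (\<forall>d. Metric_space (topspace M) d \<and> Metric_space.mtopology (topspace M) d = M \<longrightarrow>
        (\<forall>K \<epsilon>. compact K \<and> \<epsilon> > 0 \<longrightarrow>
           (\<exists>j0. \<forall>j\<ge>j0. K \<subseteq> D j \<and> (\<forall>z\<in>K. d (g j z) (h z) < \<epsilon>))))"

end

theory Submission
  imports Defs "HOL-Complex_Analysis.Complex_Analysis"
begin

text \<open>
  Zalcman's rescaling at the maximum of \<open>(r - |z - q|) |f'(z)|\<close> produces maps \<open>g j\<close> of speed at
  most \<open>2\<close> on growing discs, with speed \<open>1\<close> at the origin. Along an ultrafilter every sequence of
  points of \<open>M\<close> either converges or leaves every compact set, and a bound on the speed makes the set
  where \<open>g j\<close> converges open. It is also closed: along a segment that leaves it the limit map is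
  Lipschitz for the distance of \<open>E\<close>, so by completeness it has a limit at the exit point. Hence \<open>g j\<close>
  converges everywhere or diverges compactly. This replaces the
  Hopf-Rinow theorem, and of the comparison of the two topologies of \<open>M\<close> it needs only the easy half:
  points close for the distance of \<open>E\<close> are close in \<open>M\<close>. If no rescaling is possible, the speeds are locally bounded and \<open>\<F>\<close> is
  either pointwise relatively compact, hence normal, or diverges at a point.
\<close>

subsection \<open>Ultrafilters and topology\<close>

text \<open>Ultrafilters replace repeated extraction of subsequences: for one fixed ultrafilter the
  set of points where the maps converge is well defined, so one can ask whether it is open and
  closed. A true subsequence is extracted only at the end, from closeness on the discs of radius
  \<open>n\<close>. Normality asks for limits with values in \<open>M\<close>, so a family of
  locally bounded speed may still fail to be normal by escaping at a point \<open>z\<close>. Bounded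
  speed then makes all nearby points escape too, and any rescaling at \<open>z\<close> with
  \<open>\<rho> j\<close> tending to \<open>0\<close> diverges compactly. For the converse, a normal
  family has a limit \<open>h\<close> along an ultrafilter; since
  \<open>p j + \<rho> j * \<xi>\<close> tends to \<open>p0\<close>, the rescaled maps tend to the
  constant \<open>h p0\<close>, which excludes both alternatives. As \<open>M\<close> may be
  singular, estimates are made in one chart at a time, from a positive lower bound for an ambient
  hermitian form on a compact polydisc, and transferred to velocities, which are Zariski tangent
  vectors.\<close>

definition ultrafilter :: "'a filter \<Rightarrow> bool" where
  "ultrafilter U \<longleftrightarrow> U \<noteq> bot \<and> (\<forall>P. eventually P U \<or> eventually (\<lambda>x. \<not> P x) U)"

text \<open>Zorn's lemma applies to the proper filters below \<open>F\<close>, later in the order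
  meaning finer: the infimum of a chain stays proper because each of its events comes from one
  member. A finest filter decides \<open>P\<close>, since cutting it down to a compatible
  \<open>P\<close> changes nothing.\<close>

lemma ultrafilter_below:
  assumes "F \<noteq> bot"
  obtains U where "ultrafilter U" "U \<le> F"
proof -
  define \<A> where "\<A> = {G. G \<noteq> bot \<and> G \<le> F}"
  have "\<exists>m\<in>\<A>. \<forall>a\<in>\<A>. m \<ge> a \<longrightarrow> a = m"
  proof (rule predicate_Zorn)
    show "partial_order_on \<A> (relation_of (\<ge>) \<A>)"
      by (rule partial_order_on_relation_ofI) auto
  next
    fix C assume C: "C \<in> Chains (relation_of (\<ge>) \<A>)"
    then have sub: "C \<subseteq> \<A>" and tot: "\<And>a b. a \<in> C \<Longrightarrow> b \<in> C \<Longrightarrow> a \<le> b \<or> b \<le> a"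
      by (auto simp: Chains_def relation_of_def)
    show "\<exists>u\<in>\<A>. \<forall>a\<in>C. a \<ge> u"
    proof (cases "C = {}")
      case True
      then show ?thesis using assms by (auto simp: \<A>_def)
    next
      case False
      have ev: "eventually P (Inf C) \<longleftrightarrow> (\<exists>b\<in>C. eventually P b)" for P
        by (rule eventually_Inf_base[OF False]) (metis inf.absorb1 inf.absorb2 order_refl tot)
      have "Inf C \<noteq> bot"
        unfolding trivial_limit_def ev using sub by (auto simp: \<A>_def trivial_limit_def)
      moreover have "Inf C \<le> F"
        using False sub by (auto simp: \<A>_def intro: Inf_lower2)
      ultimately show ?thesis by (intro bexI[of _ "Inf C"]) (auto simp: \<A>_def intro: Inf_lower)
    qed
  qed
  then obtain U where U: "U \<in> \<A>" "\<And>a. a \<in> \<A> \<Longrightarrow> a \<le> U \<Longrightarrow> a = U" by blast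
  have "eventually P U \<or> eventually (\<lambda>x. \<not> P x) U" for P
  proof (cases "inf U (principal {x. P x}) = bot")
    case True
    then have "eventually (\<lambda>x. \<not> P x) U"
      by (simp add: trivial_limit_def eventually_inf_principal)
    then show ?thesis ..
  next
    case False
    then have "inf U (principal {x. P x}) = U"
      using U(1) by (intro U(2)) (auto simp: \<A>_def intro: le_infI1)
    moreover have "eventually P (inf U (principal {x. P x}))"
      by (simp add: eventually_inf_principal)
    ultimately show ?thesis by simp
  qed
  then show thesis using U(1) that by (auto simp: \<A>_def ultrafilter_def)
qed

text \<open>If no point of \<open>L\<close> were a limit, each would have a neighbourhood that
  \<open>U\<close>, deciding every predicate, eventually avoids. Finitely many of these cover
  \<open>L\<close>, and \<open>g j\<close> would have to avoid them all.\<close>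

lemma ultrafilter_limitin_compactin:
  assumes U: "ultrafilter U" and L: "compactin X L" and ev: "eventually (\<lambda>j. g j \<in> L) U"
  obtains y where "y \<in> L" "limitin X g y U"
proof -
  have "\<exists>y\<in>L. limitin X g y U"
  proof (rule ccontr)
    assume "\<not> ?thesis"
    moreover have "L \<subseteq> topspace X" using L by (rule compactin_subset_topspace)
    ultimately have "\<forall>y\<in>L. \<exists>V. openin X V \<and> y \<in> V \<and> \<not> eventually (\<lambda>j. g j \<in> V) U"
      unfolding limitin_def by blast
    then obtain V where V: "\<And>y. y \<in> L \<Longrightarrow> openin X (V y) \<and> y \<in> V y \<and> \<not> eventually (\<lambda>j. g j \<in> V y) U"
      by metis
    then obtain L0 where L0: "finite L0" "L0 \<subseteq> L" "L \<subseteq> (\<Union>y\<in>L0. V y)"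
      using L unfolding compactin_def
      by (smt (verit, ccfv_threshold) UN_iff finite_subset_image imageE subsetI)
    have "eventually (\<lambda>j. g j \<notin> V y) U" if "y \<in> L0" for y
      using V[of y] that L0 U by (auto simp: ultrafilter_def)
    then have "eventually (\<lambda>j. \<forall>y\<in>L0. g j \<notin> V y) U"
      using L0(1) by (simp add: eventually_ball_finite)
    with ev have "eventually (\<lambda>j. False) U"
      by eventually_elim (use L0(3) in blast)
    then show False using U by (auto simp: ultrafilter_def trivial_limit_def)
  qed
  then show thesis using that by blast
qed

text \<open>Testing ultrafilters on \<open>S\<close> alone suffices in a regular space: members of a
  cover shrink to sets \<open>V f\<close> whose closures still fit inside, and once finitely many
  \<open>V f\<close> cover \<open>S\<close>, their closures cover the closure of
  \<open>S\<close>.\<close>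

lemma compactin_closure_of_ultrafilter:
  assumes sub: "S \<subseteq> topspace X"
    and reg: "\<And>W f. openin X W \<Longrightarrow> f \<in> W \<Longrightarrow> \<exists>V. openin X V \<and> f \<in> V \<and> X closure_of V \<subseteq> W"
    and ult: "\<And>U. ultrafilter U \<Longrightarrow> eventually (\<lambda>f. f \<in> S) U \<Longrightarrow> \<exists>f. limitin X (\<lambda>x. x) f U"
  shows "compactin X (X closure_of S)"
  unfolding compactin_def
proof (intro conjI allI impI)
  show "X closure_of S \<subseteq> topspace X" by (rule closure_of_subset_topspace)
  fix \<O> assume \<O>: "Ball \<O> (openin X) \<and> X closure_of S \<subseteq> \<Union>\<O>"
  then have "\<forall>f\<in>X closure_of S. \<exists>V. openin X V \<and> f \<in> V \<and> (\<exists>W\<in>\<O>. X closure_of V \<subseteq> W)"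
    using reg by (metis UnionE subsetD)
  then obtain V where V: "\<And>f. f \<in> X closure_of S \<Longrightarrow>
      openin X (V f) \<and> f \<in> V f \<and> (\<exists>W\<in>\<O>. X closure_of (V f) \<subseteq> W)"
    by metis
  have "\<exists>C. finite C \<and> C \<subseteq> X closure_of S \<and> S \<subseteq> (\<Union>f\<in>C. V f)"
  proof (rule ccontr)
    assume neg: "\<nexists>C. finite C \<and> C \<subseteq> X closure_of S \<and> S \<subseteq> (\<Union>f\<in>C. V f)"
    \<comment> \<open>\<open>F\<close> is generated by what finitely many \<open>V f\<close> leave
      of \<open>S\<close>, and is proper because they never cover it. An ultrafilter below it
      converges to some \<open>f\<close> in the closure while avoiding that point's own
      \<open>V f\<close>.\<close>
    define F where "F = (INF C\<in>{C. finite C \<and> C \<subseteq> X closure_of S}. principal (S - (\<Union>f\<in>C. V f)))"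
    have evF: "eventually P F \<longleftrightarrow> (\<exists>C. finite C \<and> C \<subseteq> X closure_of S \<and> (\<forall>f\<in>S - (\<Union>f\<in>C. V f). P f))" for P
      unfolding F_def
    proof (subst eventually_INF_base)
      show "{C. finite C \<and> C \<subseteq> X closure_of S} \<noteq> {}" by auto
      fix B C assume "B \<in> {C. finite C \<and> C \<subseteq> X closure_of S}" "C \<in> {C. finite C \<and> C \<subseteq> X closure_of S}"
      then show "\<exists>D\<in>{C. finite C \<and> C \<subseteq> X closure_of S}. principal (S - (\<Union>f\<in>D. V f))
          \<le> inf (principal (S - (\<Union>f\<in>B. V f))) (principal (S - (\<Union>f\<in>C. V f)))"
        by (intro bexI[of _ "B \<union> C"]) auto
    qed (auto simp: eventually_principal)
    have "F \<noteq> bot"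
      unfolding trivial_limit_def evF using neg by (auto simp: subset_iff)
    then obtain U where U: "ultrafilter U" "U \<le> F" by (rule ultrafilter_below)
    have "eventually (\<lambda>f. f \<in> S) F" unfolding evF by (intro exI[of _ "{}"]) auto
    then have S: "eventually (\<lambda>f. f \<in> S) U" using U(2) by (simp add: filter_leD)
    with ult U(1) obtain f where f: "limitin X (\<lambda>x. x) f U" by blast
    have "f \<in> X closure_of S"
    proof (rule limitin_closedin[OF f closedin_closure_of])
      show "eventually (\<lambda>g. g \<in> X closure_of S) U"
        using S by eventually_elim (use closure_of_subset[OF sub] in blast)
    qed (use U in \<open>auto simp: ultrafilter_def\<close>)
    then have "eventually (\<lambda>g. g \<in> V f) U" using V f by (auto simp: limitin_def)
    moreover have "eventually (\<lambda>g. g \<notin> V f) F"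
      unfolding evF using \<open>f \<in> X closure_of S\<close> by (intro exI[of _ "{f}"]) auto
    then have "eventually (\<lambda>g. g \<notin> V f) U" using U(2) by (simp add: filter_leD)
    ultimately have "eventually (\<lambda>_. False) U" by eventually_elim blast
    then show False using U by (auto simp: ultrafilter_def trivial_limit_def)
  qed
  then obtain C where C: "finite C" "C \<subseteq> X closure_of S" "S \<subseteq> (\<Union>f\<in>C. V f)" by blast
  from V C(2) obtain W where W: "\<And>f. f \<in> C \<Longrightarrow> W f \<in> \<O> \<and> X closure_of (V f) \<subseteq> W f"
    by (metis subsetD)
  have "X closure_of S \<subseteq> X closure_of (\<Union>f\<in>C. V f)" using C(3) by (rule closure_of_mono)
  also have "\<dots> = (\<Union>f\<in>C. X closure_of (V f))"
    using C(1) by (simp add: closure_of_Union image_image)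
  finally have "X closure_of S \<subseteq> \<Union>(W ` C)" using W by blast
  then show "\<exists>\<G>. finite \<G> \<and> \<G> \<subseteq> \<O> \<and> X closure_of S \<subseteq> \<Union>\<G>"
    using C(1) W by (intro exI[of _ "W ` C"]) auto
qed

text \<open>Urysohn's embedding into a countable product of lines, one function for each pair of
  basic sets with the closure of the first inside the second. Without a metric on \<open>M\<close>,
  uniform convergence as defined would hold vacuously; both directions of the theorem draw a metric
  from here.\<close>

lemma regular_second_countable_imp_metrizable_space:
  assumes reg: "regular_space X" and t1: "Hausdorff_space X" and sc: "second_countable X"
  shows "metrizable_space X"
proof -
  have nor: "normal_space X"
    using reg sc by (simp add: regular_Lindelof_imp_normal_space second_countable_imp_Lindelof_space)
  obtain \<B> where \<B>: "countable \<B>" "\<And>V. V \<in> \<B> \<Longrightarrow> openin X V"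
      "\<And>U x. openin X U \<Longrightarrow> x \<in> U \<Longrightarrow> \<exists>V\<in>\<B>. x \<in> V \<and> V \<subseteq> U"
    using sc unfolding second_countable_def by metis
  define I where "I = {(V, W). V \<in> \<B> \<and> W \<in> \<B> \<and> X closure_of V \<subseteq> W}"
  have "countable I"
    by (rule countable_subset[of _ "\<B> \<times> \<B>"]) (auto simp: I_def \<B>)
  have "\<exists>f. continuous_map X euclideanreal f \<and> f ` (X closure_of V) \<subseteq> {0} \<and> f ` (topspace X - W) \<subseteq> {1}"
    if "(V, W) \<in> I" for V W
  proof -
    have "closedin X (topspace X - W)" "disjnt (X closure_of V) (topspace X - W)"
      using that \<B> by (auto simp: I_def disjnt_def)
    then show ?thesis
      using Urysohn_lemma_alt[OF nor closedin_closure_of] by metis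
  qed
  then have "\<forall>i\<in>I. \<exists>f. continuous_map X euclideanreal f \<and> f ` (X closure_of (fst i)) \<subseteq> {0}
      \<and> f ` (topspace X - snd i) \<subseteq> {1}" by auto
  then obtain f where f: "\<And>i. i \<in> I \<Longrightarrow> continuous_map X euclideanreal (f i)
      \<and> f i ` (X closure_of (fst i)) \<subseteq> {0} \<and> f i ` (topspace X - snd i) \<subseteq> {1}"
    by metis
  define F where "F = (\<lambda>x. \<lambda>i\<in>I. f i x)"
  \<comment> \<open>Regularity puts basic sets \<open>V\<close> and \<open>W\<close> between
    \<open>x\<close> and \<open>U\<close>, with the closure of \<open>V\<close> inside
    \<open>W\<close>. The function of this pair both separates points and shows that the embedding
    is open.\<close>
  have ex: "\<exists>i\<in>I. f i x = 0 \<and> (\<forall>y\<in>topspace X - U. f i y = 1)" if U: "openin X U" "x \<in> U" for x U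
  proof -
    obtain W where W: "W \<in> \<B>" "x \<in> W" "W \<subseteq> U" using \<B>(3)[OF U] by blast
    then have "neighbourhood_base_of (closedin X) X" "openin X W"
      using reg \<B>(2) by (simp_all add: neighbourhood_base_of_closedin)
    then obtain V0 K where "openin X V0" "closedin X K" "x \<in> V0" "V0 \<subseteq> K" "K \<subseteq> W"
      using W(2) unfolding neighbourhood_base_of by metis
    then have V0: "openin X V0" "x \<in> V0" "X closure_of V0 \<subseteq> W"
      using closure_of_minimal[of V0 K X] by auto
    then obtain V where V: "V \<in> \<B>" "x \<in> V" "V \<subseteq> V0" using \<B>(3)[OF V0(1,2)] by blast
    have "X closure_of V \<subseteq> W" using closure_of_mono[OF V(3)] V0 by blast
    then have i: "(V, W) \<in> I" using V W by (auto simp: I_def)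
    have "x \<in> X closure_of V" using V \<B>(2) by (meson closure_of_subset openin_subset subsetD)
    then show ?thesis using f[OF i] W by (intro bexI[OF _ i]) auto
  qed
  define Y where "Y = subtopology (powertop_real I) (F ` topspace X)"
  have cont: "continuous_map X (powertop_real I) F"
    unfolding continuous_map_componentwise by (auto simp: F_def f)
  have "F x \<noteq> F y" if xy: "x \<in> topspace X" "y \<in> topspace X" "x \<noteq> y" for x y
  proof -
    obtain U where "openin X U" "x \<in> U" "y \<notin> U"
      using t1 xy unfolding Hausdorff_space_def disjnt_iff by metis
    then obtain i where "i \<in> I" "f i x = 0" "f i y = 1" using ex[of U x] xy(2) by blast
    then have "F x i \<noteq> F y i" by (simp add: F_def)
    then show ?thesis by metis
  qed
  then have inj: "inj_on F (topspace X)" by (auto simp: inj_on_def)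
  have "openin Y (F ` U)" if U: "openin X U" for U
  proof (subst openin_subopen, intro ballI)
    fix w assume "w \<in> F ` U"
    then obtain x where x: "x \<in> U" "w = F x" by blast
    have xt: "x \<in> topspace X" using U x openin_subset by blast
    obtain i where i: "i \<in> I" "f i x = 0" "\<And>y. y \<in> topspace X - U \<Longrightarrow> f i y = 1"
      using ex[OF U x(1)] by blast
    have "openin (powertop_real I) {w \<in> topspace (powertop_real I). w i \<in> {..<1}}"
      by (rule openin_continuous_map_preimage[OF continuous_map_product_projection[OF i(1)]]) auto
    then have "openin Y ({w \<in> topspace (powertop_real I). w i \<in> {..<1}} \<inter> F ` topspace X)"
      unfolding Y_def by (rule openin_subtopology_Int)
    moreover have "{w \<in> topspace (powertop_real I). w i \<in> {..<1}} \<inter> F ` topspace X \<subseteq> F ` U"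
    proof
      fix v assume "v \<in> {w \<in> topspace (powertop_real I). w i \<in> {..<1}} \<inter> F ` topspace X"
      then obtain y where y: "v = F y" "y \<in> topspace X" "F y i \<in> {..<1}" by blast
      then have "f i y < 1" using i(1) by (simp add: F_def)
      then have "y \<in> U" using i(3)[of y] y by auto
      then show "v \<in> F ` U" using y by blast
    qed
    moreover have "w \<in> {w \<in> topspace (powertop_real I). w i \<in> {..<1}} \<inter> F ` topspace X"
      using x i xt by (auto simp: F_def)
    ultimately show "\<exists>T. openin Y T \<and> w \<in> T \<and> T \<subseteq> F ` U" by blast
  qed
  then have "open_map X Y F" by (simp add: open_map_def)
  moreover have "continuous_map X Y F"
    unfolding Y_def using cont by (auto simp: continuous_map_in_subtopology)
  ultimately have "embedding_map X Y F"
    using inj injective_open_imp_embedding_map by blast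
  then have "X homeomorphic_space subtopology Y (F ` topspace X)"
    by (rule embedding_map_imp_homeomorphic_space)
  moreover have "metrizable_space (powertop_real I)"
    unfolding metrizable_space_product_topology
    using \<open>countable I\<close> by (auto simp: metrizable_space_euclidean intro: countable_subset[of _ I])
  ultimately show ?thesis
    using homeomorphic_metrizable_space by (metis Y_def metrizable_space_subtopology)
qed

text \<open>Continuous induction: a path that has stayed in \<open>V\<close> so far is known to lie
  in the smaller closed \<open>K\<close>, hence has room to go on. Estimates in a chart are
  available only while the path remains there, and this is how curves and images of segments are
  confined.\<close>

lemma path_stays_in_openin:
  fixes \<gamma> :: "real \<Rightarrow> 'a"
  assumes path: "continuous_map (top_of_set {0..1}) X \<gamma>"
    and V: "openin X V" and K: "closedin X K" "K \<subseteq> V"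
    and step: "\<And>t. \<lbrakk>0 \<le> t; t \<le> 1; \<gamma> ` {0..t} \<subseteq> V\<rbrakk> \<Longrightarrow> \<gamma> t \<in> K"
    and 0: "\<gamma> 0 \<in> V"
  shows "\<gamma> ` {0..1} \<subseteq> K"
proof -
  define T where "T = {t\<in>{0..1}. \<gamma> ` {0..t} \<subseteq> V}"
  have opV: "openin (top_of_set {0..1}) {t\<in>{0..1}. \<gamma> t \<in> V}"
    using openin_continuous_map_preimage[OF path V] by simp
  have clK: "closedin (top_of_set {0..1}) {t\<in>{0..1}. \<gamma> t \<in> K}"
    using closedin_continuous_map_preimage[OF path K(1)] by simp
  have TK: "\<gamma> ` {0..t} \<subseteq> K" if "t \<in> T" for t
  proof clarify
    fix s assume "s \<in> {0..t}"
    then have "\<gamma> ` {0..s} \<subseteq> \<gamma> ` {0..t}" by auto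
    then show "\<gamma> s \<in> K" using step[of s] that \<open>s \<in> {0..t}\<close> by (auto simp: T_def)
  qed
  have "0 \<in> T" using 0 by (auto simp: T_def)
  define s where "s = Sup T"
  have bdd: "bdd_above T" by (auto simp: T_def intro!: bdd_aboveI[of _ 1])
  have s01: "0 \<le> s" "s \<le> 1"
    unfolding s_def using \<open>0 \<in> T\<close> bdd
    by (auto intro: cSup_upper) (rule cSup_least[of T 1], blast, simp add: T_def)
  have below: "\<gamma> t \<in> K" if t: "0 \<le> t" "t < s" for t
  proof -
    obtain t' where "t' \<in> T" "t < t'" using t \<open>0 \<in> T\<close> less_cSupD[of T t] unfolding s_def by blast
    then show ?thesis using TK t by (auto simp: subset_iff)
  qed
  \<comment> \<open>Times before \<open>s\<close> give values in \<open>K\<close>, and its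
    closedness carries them to \<open>s\<close>; openness of \<open>V\<close> alone would
    not.\<close>
  have "\<gamma> s \<in> V"
  proof (cases "s = 0")
    case False
    obtain C where C: "closed C" "{t\<in>{0..1}. \<gamma> t \<in> K} = {0..1} \<inter> C"
      using clK unfolding closedin_closed by blast
    have "{0..<s} \<subseteq> {0..1} \<inter> C" unfolding C(2)[symmetric] using below s01 by auto
    then have "closure {0..<s} \<subseteq> C" using C(1) by (simp add: closure_minimal)
    moreover have "s \<in> closure {0..<s}" using False s01 by simp
    ultimately have "s \<in> {t\<in>{0..1}. \<gamma> t \<in> K}" unfolding C(2) using s01 by auto
    then show ?thesis using K by auto
  qed (use 0 in simp)
  then have sT: "s \<in> T" using s01 below K(2) by (auto simp: T_def) (metis less_eq_real_def subsetD)
  have "s = 1"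
  proof (rule ccontr)
    assume "s \<noteq> 1"
    obtain e where e: "e > 0" "\<And>t. t \<in> {0..1} \<Longrightarrow> dist t s < e \<Longrightarrow> \<gamma> t \<in> V"
      using opV s01 \<open>\<gamma> s \<in> V\<close> unfolding openin_euclidean_subtopology_iff by force
    define t where "t = min 1 (s + e / 2)"
    have t: "s < t" "t \<le> 1" "t < s + e" using s01 \<open>s \<noteq> 1\<close> e by (auto simp: t_def)
    have "\<gamma> u \<in> V" if "u \<in> {0..t}" for u
    proof (cases "u \<le> s")
      case True
      then show ?thesis using sT that by (auto simp: T_def)
    next
      case False
      then show ?thesis using e(2)[of u] that t s01 by (auto simp: dist_real_def)
    qed
    then have "t \<in> T" using t s01 by (auto simp: T_def)
    then show False using t bdd cSup_upper[of t T] by (auto simp: s_def)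
  qed
  then show ?thesis using TK sT by blast
qed

lemma ultrafilter_nontrivial: "ultrafilter U \<Longrightarrow> U \<noteq> bot"
  by (simp add: ultrafilter_def)

lemma ennreal_pos_realE:
  assumes "(\<epsilon>::ennreal) > 0" obtains e where "e > 0" "ennreal e < \<epsilon>"
proof -
  obtain x where x: "0 < x" "x < \<epsilon>" using dense[OF assms] by blast
  then obtain e where "x = ennreal e" "0 \<le> e" by (cases x) auto
  then show thesis using x that[of e] by (auto simp: ennreal_zero_less_mult_iff)
qed

section \<open>Uniform convergence on compact sets\<close>

lemma eventually_ball_compact:
  fixes K :: "'b::metric_space set"
  assumes K: "compact K"
    and ev: "\<And>z. z \<in> K \<Longrightarrow> \<exists>\<delta>>0. eventually (\<lambda>j. \<forall>w\<in>ball z \<delta> \<inter> K. P j w) F"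
  shows "eventually (\<lambda>j. \<forall>w\<in>K. P j w) F"
proof -
  have "\<forall>z\<in>K. \<exists>\<delta>. \<delta> > 0 \<and> eventually (\<lambda>j. \<forall>w\<in>ball z \<delta> \<inter> K. P j w) F"
    using ev by blast
  from bchoice[OF this] obtain \<delta> where \<delta>: "\<And>z. z \<in> K \<Longrightarrow> \<delta> z > 0"
    "\<And>z. z \<in> K \<Longrightarrow> eventually (\<lambda>j. \<forall>w\<in>ball z (\<delta> z) \<inter> K. P j w) F" by blast
  have "K \<subseteq> (\<Union>z\<in>K. ball z (\<delta> z))" using \<delta>(1) by force
  then obtain K0 where K0: "K0 \<subseteq> K" "finite K0" "K \<subseteq> (\<Union>z\<in>K0. ball z (\<delta> z))"
    using compactE_image[OF K, of K "\<lambda>z. ball z (\<delta> z)"] by auto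
  have "eventually (\<lambda>j. \<forall>z\<in>K0. \<forall>w\<in>ball z (\<delta> z) \<inter> K. P j w) F"
    using K0(1,2) \<delta>(2) by (intro eventually_ball_finite) auto
  then show ?thesis by eventually_elim (use K0(3) in blast)
qed

text \<open>The hypothesis mentions open sets only, so it serves all metrics of the topology at
  once. Near \<open>z\<close> both \<open>g j w\<close> and \<open>h w\<close> lie in the ball of
  radius \<open>\<epsilon> / 2\<close> about \<open>h z\<close>, which bounds their
  distance.\<close>

lemma (in Metric_space) uniform_on_compact:
  fixes g :: "'i \<Rightarrow> 'b::metric_space \<Rightarrow> 'a"
  assumes h: "continuous_map (top_of_set S) mtopology h"
    and g: "\<And>z V. z \<in> S \<Longrightarrow> openin mtopology V \<Longrightarrow> h z \<in> V \<Longrightarrow>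
      \<exists>\<delta>>0. eventually (\<lambda>j. \<forall>w\<in>ball z \<delta>. g j w \<in> V) F"
    and K: "compact K" "K \<subseteq> S" and \<epsilon>: "\<epsilon> > 0"
  shows "eventually (\<lambda>j. \<forall>z\<in>K. g j z \<in> M \<and> d (g j z) (h z) < \<epsilon>) F"
proof (rule eventually_ball_compact[OF K(1)])
  fix z assume "z \<in> K"
  then have z: "z \<in> S" using K by blast
  have hM: "h w \<in> M" if "w \<in> S" for w
    using h that by (auto simp: continuous_map_def)
  define V where "V = mball (h z) (\<epsilon> / 2)"
  have V: "openin mtopology V" "h z \<in> V" using hM[OF z] \<epsilon> by (auto simp: V_def)
  obtain \<delta>1 where \<delta>1: "\<delta>1 > 0" "eventually (\<lambda>j. \<forall>w\<in>ball z \<delta>1. g j w \<in> V) F"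
    using g[OF z V] by blast
  have "openin (top_of_set S) {w \<in> topspace (top_of_set S). h w \<in> V}"
    by (rule openin_continuous_map_preimage[OF h V(1)])
  then obtain \<delta>2 where \<delta>2: "\<delta>2 > 0" "\<And>w. w \<in> S \<Longrightarrow> dist w z < \<delta>2 \<Longrightarrow> h w \<in> V"
    using z V(2) unfolding openin_euclidean_subtopology_iff by force
  have "eventually (\<lambda>j. \<forall>w\<in>ball z (min \<delta>1 \<delta>2) \<inter> K. g j w \<in> M \<and> d (g j w) (h w) < \<epsilon>) F"
    using \<delta>1(2)
  proof eventually_elim
    case (elim j)
    show ?case
    proof
      fix w assume w: "w \<in> ball z (min \<delta>1 \<delta>2) \<inter> K"
      then have "g j w \<in> V" "h w \<in> V" using elim \<delta>2(2)[of w] K(2) by (auto simp: dist_commute)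
      then have "g j w \<in> M" "h w \<in> M" "d (h z) (g j w) < \<epsilon> / 2" "d (h z) (h w) < \<epsilon> / 2" "h z \<in> M"
        by (auto simp: V_def)
      then show "g j w \<in> M \<and> d (g j w) (h w) < \<epsilon>"
        using triangle[of "g j w" "h z" "h w"] commute[of "h z" "g j w"] by auto
    qed
  qed
  then show "\<exists>\<delta>>0. eventually (\<lambda>j. \<forall>w\<in>ball z \<delta> \<inter> K. g j w \<in> M \<and> d (g j w) (h w) < \<epsilon>) F"
    using \<delta>1 \<delta>2 by (intro exI[of _ "min \<delta>1 \<delta>2"]) auto
qed

text \<open>The way back from closeness in one metric to the formulation by open sets. Together with
  \<open>uniform_on_compact\<close> it turns convergence in one metric of the topology into
  convergence in all of them.\<close>

lemma (in Metric_space) nbhd_of_uniform: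
  fixes g :: "'i \<Rightarrow> 'b::metric_space \<Rightarrow> 'a"
  assumes h: "continuous_map euclidean mtopology h"
    and g: "\<And>\<epsilon>. \<epsilon> > 0 \<Longrightarrow> eventually (\<lambda>j. \<forall>w\<in>ball z 1. g j w \<in> M \<and> d (g j w) (h w) < \<epsilon>) F"
    and V: "openin mtopology V" "h z \<in> V"
  shows "\<exists>\<delta>>0. eventually (\<lambda>j. \<forall>w\<in>ball z \<delta>. g j w \<in> V) F"
proof -
  obtain r where r: "r > 0" "mball (h z) r \<subseteq> V" using V by (auto simp: openin_mtopology)
  have hM: "h w \<in> M" for w using h by (auto simp: continuous_map_def)
  have "openin mtopology (mball (h z) (r / 2))" by simp
  then have "openin euclidean {w \<in> topspace euclidean. h w \<in> mball (h z) (r / 2)}"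
    by (rule openin_continuous_map_preimage[OF h])
  then have "open {w. h w \<in> mball (h z) (r / 2)}" by (simp add: Collect_conj_eq)
  moreover have "z \<in> {w. h w \<in> mball (h z) (r / 2)}" using hM r by simp
  ultimately obtain e where e: "e > 0" "ball z e \<subseteq> {w. h w \<in> mball (h z) (r / 2)}"
    using open_contains_ball by blast
  have "eventually (\<lambda>j. \<forall>w\<in>ball z 1. g j w \<in> M \<and> d (g j w) (h w) < r / 2) F"
    by (rule g) (use r in simp)
  then have "eventually (\<lambda>j. \<forall>w\<in>ball z (min 1 e). g j w \<in> V) F"
  proof eventually_elim
    case (elim j)
    show ?case
    proof
      fix w assume w: "w \<in> ball z (min 1 e)"
      then have 1: "g j w \<in> M" "d (g j w) (h w) < r / 2" using elim by auto
      have "h w \<in> mball (h z) (r / 2)" using e(2) w by auto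
      then have "d (h z) (h w) < r / 2" by simp
      then have "d (h z) (g j w) < r"
        using triangle[OF hM[of z] hM[of w] 1(1)] 1 commute[of "h w" "g j w"] by linarith
      then show "g j w \<in> V" using r(2) 1(1) hM by auto
    qed
  qed
  then show ?thesis using e(1) by (intro exI[of _ "min 1 e"]) auto
qed

text \<open>A proper filter finer than \<open>sequentially\<close> contains only infinite sets of
  indices, so the \<open>n\<close>-th index can satisfy \<open>P n\<close> and exceed the previous
  one.\<close>

lemma ultrafilter_subseq:
  assumes U: "ultrafilter U" "U \<le> sequentially" and P: "\<And>n. eventually (P n) U"
  obtains \<sigma> :: "nat \<Rightarrow> nat" where "strict_mono \<sigma>" "\<And>n. P n (\<sigma> n)"
proof -
  have ex: "\<exists>j>k. P n j" for n k
  proof -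
    have "eventually (\<lambda>j. j > k) U" using U(2) eventually_gt_at_top by (rule filter_leD)
    then have "eventually (\<lambda>j. j > k \<and> P n j) U" using P by (rule eventually_conj)
    then show ?thesis using eventually_happens'[OF ultrafilter_nontrivial[OF U(1)]] by blast
  qed
  have "\<exists>\<sigma>. \<forall>n. P n (\<sigma> n) \<and> \<sigma> n < \<sigma> (Suc n)"
  proof (rule dependent_nat_choice)
    show "\<exists>x. P 0 x" using ex by blast
    show "\<exists>y. P (Suc n) y \<and> x < y" for x n using ex[of x "Suc n"] by blast
  qed
  then obtain \<sigma> where \<sigma>: "\<And>n. P n (\<sigma> n)" "\<And>n. \<sigma> n < \<sigma> (Suc n)" by blast
  have "strict_mono \<sigma>" using \<sigma>(2) by (simp add: strict_mono_Suc_iff)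
  then show thesis using \<sigma>(1) by (rule that)
qed

text \<open>Since \<open>K \<subseteq> D j\<close> holds eventually, failure of divergence must come
  from infinitely many indices for which the image of \<open>K\<close> meets \<open>L\<close>. Along
  an ultrafilter containing these indices, the points of \<open>K\<close> and their images converge
  by compactness.\<close>

lemma not_compactly_divergentE:
  fixes g :: "nat \<Rightarrow> complex \<Rightarrow> 'm"
  assumes nd: "\<not> compactly_divergent M D g"
    and D: "\<And>K. compact K \<Longrightarrow> eventually (\<lambda>j. K \<subseteq> D j) sequentially"
  obtains U \<xi> x y where "ultrafilter U" "U \<le> sequentially" "(\<xi> \<longlongrightarrow> x) U"
    "limitin M (\<lambda>j. g j (\<xi> j)) y U"
proof -
  have "\<exists>K L. (compact K \<and> compactin M L) \<and> \<not> (\<exists>j0. \<forall>j\<ge>j0. K \<subseteq> D j \<and> g j ` K \<inter> L = {})"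
    using nd unfolding compactly_divergent_def by meson
  then obtain K L where KL: "compact K" "compactin M L"
    and inf: "\<not> (\<exists>j0. \<forall>j\<ge>j0. K \<subseteq> D j \<and> g j ` K \<inter> L = {})"
    by blast
  define J where "J = {j. g j ` K \<inter> L \<noteq> {}}"
  have "inf sequentially (principal J) \<noteq> bot"
  proof
    assume "inf sequentially (principal J) = bot"
    then have "eventually (\<lambda>j. j \<notin> J) sequentially"
      by (simp add: trivial_limit_def eventually_inf_principal)
    with D[OF KL(1)] have "eventually (\<lambda>j. K \<subseteq> D j \<and> j \<notin> J) sequentially" by (rule eventually_conj)
    then show False using inf by (simp add: J_def eventually_sequentially)
  qed
  then obtain U where U: "ultrafilter U" "U \<le> inf sequentially (principal J)" by (rule ultrafilter_below)
  have Us: "U \<le> sequentially" using U(2) by simp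
  have "U \<le> principal J" using U(2) by simp
  then have evJ: "eventually (\<lambda>j. j \<in> J) U" by (rule filter_leD) (simp add: eventually_principal)
  have "\<forall>j\<in>J. \<exists>\<xi>. \<xi> \<in> K \<and> g j \<xi> \<in> L" by (auto simp: J_def)
  from bchoice[OF this] obtain \<xi> where \<xi>: "\<And>j. j \<in> J \<Longrightarrow> \<xi> j \<in> K \<and> g j (\<xi> j) \<in> L" by blast
  have "compactin euclidean K" using KL(1) by simp
  moreover have "eventually (\<lambda>j. \<xi> j \<in> K) U" using evJ by eventually_elim (use \<xi> in blast)
  ultimately obtain x where x: "limitin euclidean \<xi> x U" by (rule ultrafilter_limitin_compactin[OF U(1)])
  have "eventually (\<lambda>j. g j (\<xi> j) \<in> L) U" using evJ by eventually_elim (use \<xi> in blast)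
  then obtain y where "limitin M (\<lambda>j. g j (\<xi> j)) y U" by (rule ultrafilter_limitin_compactin[OF U(1) KL(2)])
  then show thesis using x by (intro that[OF U(1) Us]) auto
qed

subsection \<open>Calculus on \<open>cvec n\<close>\<close>

text \<open>Closed polydiscs instead of Euclidean balls: they are products of compact sets in
  \<open>nat \<Rightarrow> complex\<close>, and estimates made one coordinate at a time land in
  them.\<close>

definition cpoly :: "nat \<Rightarrow> (nat \<Rightarrow> complex) \<Rightarrow> real \<Rightarrow> (nat \<Rightarrow> complex) set" where
  "cpoly n z r = {w\<in>cvec n. \<forall>i<n. cmod (w i - z i) \<le> r}"

lemma copen_subset_cvec: "copen n W \<Longrightarrow> W \<subseteq> cvec n"
  by (auto simp: copen_def dest: openin_imp_subset)

lemma cpoly_mono: "r \<le> s \<Longrightarrow> cpoly n z r \<subseteq> cpoly n z s"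
  by (force simp: cpoly_def)

lemma compact_cpoly: "compact (cpoly n z r)"
proof -
  \<comment> \<open>Coordinates from \<open>n\<close> on contribute the factor \<open>{0}\<close>,
    so Tychonoff's theorem applies in the full function space.\<close>
  have "cpoly n z r = (\<Pi>\<^sub>E i\<in>UNIV. if i < n then cball (z i) r else {0})"
    by (auto simp: cpoly_def cvec_def PiE_iff dist_norm norm_minus_commute split: if_splits)
  moreover have "compactin (product_topology (\<lambda>i. euclidean) UNIV)
      (\<Pi>\<^sub>E i\<in>UNIV. if i < n then cball (z i) r else {0})"
    unfolding compactin_PiE by auto
  ultimately show ?thesis
    by (simp add: euclidean_product_topology)
qed

lemma cpoly_subset_open:
  assumes "open O'" "z \<in> O'" "z \<in> cvec n"
  obtains r where "r > 0" "cpoly n z r \<subseteq> O'"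
proof -
  have "openin (product_topology (\<lambda>i. euclidean) UNIV) O'"
    using assms(1) by (simp add: euclidean_product_topology)
  from product_topology_open_contains_basis[OF this assms(2)]
  obtain X where X: "z \<in> (\<Pi>\<^sub>E i\<in>UNIV. X i)" "\<And>i. open (X i)" "(\<Pi>\<^sub>E i\<in>UNIV. X i) \<subseteq> O'"
    by auto
  have "\<exists>r>0. cball (z i) r \<subseteq> X i" for i
    using X(1,2) open_contains_cball by blast
  then obtain r where r: "\<And>i. r i > 0" "\<And>i. cball (z i) (r i) \<subseteq> X i" by metis
  \<comment> \<open>The \<open>1\<close> keeps the minimum defined when
    \<open>n = 0\<close>.\<close>
  define s where "s = Min (insert 1 (r ` {..<n}))"
  have s: "s > 0" "\<And>i. i < n \<Longrightarrow> s \<le> r i"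
    using r(1) by (auto simp: s_def)
  have "cpoly n z s \<subseteq> (\<Pi>\<^sub>E i\<in>UNIV. X i)"
  proof
    fix w assume w: "w \<in> cpoly n z s"
    have "w i \<in> X i" for i
    proof (cases "i < n")
      case True
      then have "w i \<in> cball (z i) (r i)"
        using w s(2)[OF True] by (force simp: cpoly_def dist_norm norm_minus_commute)
      then show ?thesis using r by blast
    next
      case False
      then have "w i = z i" using w assms(3) by (auto simp: cpoly_def cvec_def)
      then show ?thesis using X(1) by auto
    qed
    then show "w \<in> (\<Pi>\<^sub>E i\<in>UNIV. X i)" by auto
  qed
  then have "cpoly n z s \<subseteq> O'" using X(3) by (rule order_trans)
  with s(1) show thesis by (rule that)
qed

lemma cpoly_subset_copen:
  assumes "copen n W" "z \<in> W"
  obtains r where "r > 0" "cpoly n z r \<subseteq> W"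
proof -
  obtain O' where O': "open O'" "W = cvec n \<inter> O'"
    using assms(1) by (auto simp: copen_def openin_open)
  obtain r where "r > 0" "cpoly n z r \<subseteq> O'"
    using cpoly_subset_open[of O' z n] O' assms(2) by blast
  then show thesis using that O' by (auto simp: cpoly_def)
qed

lemma cnorm_nonneg: "0 \<le> cnorm n v"
  by (simp add: cnorm_def L2_set_nonneg)

lemma cmod_le_cnorm: "i < n \<Longrightarrow> cmod (v i) \<le> cnorm n v"
  unfolding cnorm_def by (intro member_le_L2_set) auto

lemma cnorm_le_sum: "cnorm n v \<le> (\<Sum>i<n. cmod (v i))"
  unfolding cnorm_def by (rule L2_set_le_sum) auto

lemma cmod_sum_le_cnorm: "cmod (\<Sum>i<n. a i * v i) \<le> (\<Sum>i<n. cmod (a i)) * cnorm n v"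
proof -
  have "cmod (\<Sum>i<n. a i * v i) \<le> (\<Sum>i<n. cmod (a i) * cmod (v i))"
    by (rule order_trans[OF norm_sum]) (simp add: norm_mult)
  also have "\<dots> \<le> (\<Sum>i<n. cmod (a i) * cnorm n v)"
    by (intro sum_mono mult_left_mono cmod_le_cnorm) auto
  finally show ?thesis by (simp add: sum_distrib_right)
qed

lemma tendsto_coordinate:
  "((\<lambda>w::nat \<Rightarrow> complex. w i) \<longlongrightarrow> z i) (at z within S)"
proof -
  have "continuous_on UNIV (\<lambda>w::nat \<Rightarrow> complex. w i)"
    by (rule continuous_on_product_coordinates)
  then show ?thesis
    by (metis UNIV_I continuous_on_def tendsto_within_subset top_greatest)
qed

lemma has_cgradE:
  assumes "has_cgrad n f z a" "\<epsilon> > 0"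
  obtains \<delta> where "\<delta> > 0" "\<And>w. w \<in> cvec n \<Longrightarrow> cnorm n (\<lambda>i. w i - z i) < \<delta> \<Longrightarrow>
        cmod (f w - f z - (\<Sum>i<n. a i * (w i - z i))) \<le> \<epsilon> * cnorm n (\<lambda>i. w i - z i)"
  using assms unfolding has_cgrad_def by blast

lemma has_cgrad_imp_tendsto:
  assumes "has_cgrad n f z a" "S \<subseteq> cvec n"
  shows "(f \<longlongrightarrow> f z) (at z within S)"
proof -
  have 0: "((\<lambda>w. \<Sum>i<n. cmod (w i - z i)) \<longlongrightarrow> 0) (at z within S)"
  proof -
    have "((\<lambda>w. \<Sum>i<n. cmod (w i - z i)) \<longlongrightarrow> (\<Sum>i<n. cmod (z i - z i))) (at z within S)"
      by (intro tendsto_sum tendsto_norm tendsto_diff tendsto_const tendsto_coordinate)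
    then show ?thesis by simp
  qed
  have lim: "((\<lambda>w. cnorm n (\<lambda>i. w i - z i)) \<longlongrightarrow> 0) (at z within S)"
    by (rule tendsto_sandwich[OF _ _ tendsto_const 0])
      (auto intro: always_eventually cnorm_nonneg cnorm_le_sum)
  obtain \<delta> where \<delta>: "\<delta> > 0" "\<And>w. w \<in> cvec n \<Longrightarrow> cnorm n (\<lambda>i. w i - z i) < \<delta> \<Longrightarrow>
        cmod (f w - f z - (\<Sum>i<n. a i * (w i - z i))) \<le> 1 * cnorm n (\<lambda>i. w i - z i)"
    using has_cgradE[OF assms(1) zero_less_one] by blast
  \<comment> \<open>One unit for the error term with \<open>\<epsilon> = 1\<close>, the rest for the
    linear part.\<close>
  define B where "B = 1 + (\<Sum>i<n. cmod (a i))"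
  have "eventually (\<lambda>w. w \<in> cvec n \<and> cnorm n (\<lambda>i. w i - z i) < \<delta>) (at z within S)"
    using order_tendstoD(2)[OF lim \<delta>(1)] assms(2)
    by (auto simp: eventually_at_filter elim: eventually_mono)
  then have ev: "eventually (\<lambda>w. norm (f w - f z) \<le> B * cnorm n (\<lambda>i. w i - z i)) (at z within S)"
  proof eventually_elim
    case (elim w)
    let ?l = "\<Sum>i<n. a i * (w i - z i)"
    have "norm (f w - f z) = cmod ((f w - f z - ?l) + ?l)" by simp
    also have "\<dots> \<le> cmod (f w - f z - ?l) + cmod ?l" by (rule norm_triangle_ineq)
    also have "\<dots> \<le> 1 * cnorm n (\<lambda>i. w i - z i) + (\<Sum>i<n. cmod (a i)) * cnorm n (\<lambda>i. w i - z i)"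
      using elim by (intro add_mono \<delta>(2) cmod_sum_le_cnorm) auto
    finally show ?case by (simp add: B_def algebra_simps)
  qed
  have "((\<lambda>w. f w - f z) \<longlongrightarrow> 0) (at z within S)"
    by (rule Lim_null_comparison[OF ev]) (use tendsto_mult_right_zero[OF lim] in simp)
  then show ?thesis by (simp add: LIM_zero_iff)
qed

lemma holo_imp_continuous_on: "holo n W f \<Longrightarrow> continuous_on W f"
  unfolding continuous_on_def holo_def
  by (metis has_cgrad_imp_tendsto copen_subset_cvec)

text \<open>The source is any real normed space, so that real curves and holomorphic maps are both
  covered, and the derivative is taken within \<open>S\<close>, where \<open>u\<close> lies in
  \<open>cvec n\<close>. The error \<open>R\<close> of the linear part is small against
  \<open>cnorm\<close>, which the coordinate derivatives bound by a multiple of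
  \<open>norm (s - t)\<close>.\<close>

lemma has_cgrad_chain:
  fixes u :: "'a::real_normed_vector \<Rightarrow> nat \<Rightarrow> complex"
  assumes F: "has_cgrad n F (u t) a"
    and u: "\<And>i. i < n \<Longrightarrow> ((\<lambda>s. u s i) has_derivative L i) (at t within S)"
    and S: "\<And>s. s \<in> S \<Longrightarrow> u s \<in> cvec n"
  shows "((\<lambda>s. F (u s)) has_derivative (\<lambda>h. \<Sum>i<n. a i * L i h)) (at t within S)"
proof -
  define R where "R = (\<lambda>s. F (u s) - F (u t) - (\<Sum>i<n. a i * (u s i - u t i)))"
  have "\<exists>K>0. \<exists>d>0. \<forall>s\<in>S. norm (s - t) < d \<longrightarrow> cmod (u s i - u t i) \<le> K * norm (s - t)"
    if "i < n" for i
  proof -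
    have L: "bounded_linear (L i)" "\<forall>e>0. \<exists>d>0. \<forall>s\<in>S. norm (s - t) < d \<longrightarrow>
        norm (u s i - u t i - L i (s - t)) \<le> e * norm (s - t)"
      using u[OF that] unfolding has_derivative_within_alt by auto
    obtain K where K: "K > 0" "\<And>x. norm (L i x) \<le> norm x * K"
      using bounded_linear.pos_bounded[OF L(1)] by blast
    obtain d where d: "d > 0" "\<And>s. s \<in> S \<Longrightarrow> norm (s - t) < d \<Longrightarrow>
        norm (u s i - u t i - L i (s - t)) \<le> norm (s - t)"
      using L(2)[rule_format, of 1] by auto
    have "cmod (u s i - u t i) \<le> (K + 1) * norm (s - t)" if "s \<in> S" "norm (s - t) < d" for s
    proof -
      have "cmod (u s i - u t i) \<le> cmod (u s i - u t i - L i (s - t)) + cmod (L i (s - t))"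
        by (metis diff_add_cancel norm_triangle_ineq)
      also have "\<dots> \<le> norm (s - t) + norm (s - t) * K"
        by (intro add_mono d(2) that K(2))
      finally show ?thesis by (simp add: algebra_simps)
    qed
    then show ?thesis using K d by (intro exI[of _ "K + 1"] conjI exI[of _ d]) auto
  qed
  then obtain K d where K: "\<And>i. i < n \<Longrightarrow> K i > 0" and d: "\<And>i. i < n \<Longrightarrow> d i > 0"
    and Kd: "\<And>i s. i < n \<Longrightarrow> s \<in> S \<Longrightarrow> norm (s - t) < d i \<Longrightarrow> cmod (u s i - u t i) \<le> K i * norm (s - t)"
    by metis
  \<comment> \<open>The \<open>1\<close> makes \<open>C\<close> positive for \<open>n = 0\<close>,
    as division by \<open>C\<close> requires.\<close>
  define C where "C = 1 + (\<Sum>i<n. K i)"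
  have C: "C > 0" unfolding C_def using K by (intro add_pos_nonneg sum_nonneg) (auto simp: less_imp_le)
  define d0 where "d0 = Min (insert 1 (d ` {..<n}))"
  have d0: "d0 > 0" "\<And>i. i < n \<Longrightarrow> d0 \<le> d i" using d by (auto simp: d0_def)
  have un: "cnorm n (\<lambda>i. u s i - u t i) \<le> C * norm (s - t)" if "s \<in> S" "norm (s - t) < d0" for s
  proof -
    have "cnorm n (\<lambda>i. u s i - u t i) \<le> (\<Sum>i<n. K i * norm (s - t))"
      by (rule order_trans[OF cnorm_le_sum], rule sum_mono, rule Kd)
        (use that d0(2) in \<open>auto intro: less_le_trans\<close>)
    also have "\<dots> \<le> C * norm (s - t)" by (simp add: C_def sum_distrib_right algebra_simps)
    finally show ?thesis .
  qed
  have "(R has_derivative (\<lambda>h. 0)) (at t within S)"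
    unfolding has_derivative_within_alt
  proof (intro conjI allI impI)
    fix e :: real assume e: "e > 0"
    then have "e / C > 0" using C by simp
    then obtain \<delta> where \<delta>: "\<delta> > 0" "\<And>w. w \<in> cvec n \<Longrightarrow> cnorm n (\<lambda>i. w i - u t i) < \<delta> \<Longrightarrow>
        cmod (F w - F (u t) - (\<Sum>i<n. a i * (w i - u t i))) \<le> e / C * cnorm n (\<lambda>i. w i - u t i)"
      by (rule has_cgradE[OF F]) blast
    show "\<exists>d>0. \<forall>s\<in>S. norm (s - t) < d \<longrightarrow> norm (R s - R t - 0) \<le> e * norm (s - t)"
    proof (intro exI[of _ "min d0 (\<delta> / C)"] conjI ballI impI)
      show "min d0 (\<delta> / C) > 0" using d0 \<delta> C by simp
      fix s assume s: "s \<in> S" "norm (s - t) < min d0 (\<delta> / C)"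
      have 1: "cnorm n (\<lambda>i. u s i - u t i) \<le> C * norm (s - t)" using un s by simp
      also have "\<dots> < \<delta>" using s C by (simp add: field_simps)
      finally have "norm (R s) \<le> e / C * cnorm n (\<lambda>i. u s i - u t i)"
        unfolding R_def by (intro \<delta>(2) S s)
      also have "\<dots> \<le> e / C * (C * norm (s - t))"
        using e C by (intro mult_left_mono 1) auto
      finally show "norm (R s - R t - 0) \<le> e * norm (s - t)"
        using C by (simp add: R_def)
    qed
  qed simp
  moreover have "((\<lambda>s. F (u t) + (\<Sum>i<n. a i * (u s i - u t i))) has_derivative
      (\<lambda>h. 0 + (\<Sum>i<n. a i * (L i h - 0)))) (at t within S)"
    by (intro has_derivative_add has_derivative_const has_derivative_sum has_derivative_mult_right
        has_derivative_diff u) auto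
  ultimately have "((\<lambda>s. R s + (F (u t) + (\<Sum>i<n. a i * (u s i - u t i)))) has_derivative
      (\<lambda>h. 0 + (0 + (\<Sum>i<n. a i * (L i h - 0))))) (at t within S)"
    by (rule has_derivative_add)
  then show ?thesis by (simp add: R_def)
qed

lemma eventually_in_copen:
  fixes u :: "'a \<Rightarrow> nat \<Rightarrow> complex"
  assumes "copen n W" "z \<in> W" "\<And>i. i < n \<Longrightarrow> ((\<lambda>s. u s i) \<longlongrightarrow> z i) F"
    and "eventually (\<lambda>s. u s \<in> cvec n) F"
  shows "eventually (\<lambda>s. u s \<in> W) F"
proof -
  obtain r where r: "r > 0" "cpoly n z r \<subseteq> W" using cpoly_subset_copen assms(1,2) by blast
  have "eventually (\<lambda>s. \<forall>i\<in>{..<n}. dist (u s i) (z i) < r) F"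
    using assms(3) r(1) by (intro eventually_ball_finite) (auto simp: tendsto_iff)
  with assms(4) show ?thesis
    by eventually_elim (use r(2) in \<open>force simp: cpoly_def dist_norm\<close>)
qed

text \<open>A function vanishing on \<open>Z\<close> vanishes along any motion in \<open>Z\<close>,
  so by the chain rule its differential kills the velocity. This admits velocities to the metric,
  which is specified on Zariski tangent vectors only.\<close>

lemma ztangent_derivative:
  fixes u :: "'a::real_normed_vector \<Rightarrow> nat \<Rightarrow> complex"
  assumes u: "\<And>i. i < n \<Longrightarrow> ((\<lambda>s. u s i) has_derivative L i) (at t)"
    and S: "open S" "t \<in> S" "\<And>s. s \<in> S \<Longrightarrow> u s \<in> Z" and Z: "Z \<subseteq> cvec n"
  shows "(\<lambda>i. if i < n then L i h else 0) \<in> ztangent n Z (u t)"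
  unfolding ztangent_def
proof (intro CollectI conjI allI impI)
  show "(\<lambda>i. if i < n then L i h else 0) \<in> cvec n" by (simp add: cvec_def)
  fix V g a assume V: "u t \<in> V \<and> holo n V g \<and> (\<forall>w\<in>Z \<inter> V. g w = 0) \<and> has_cgrad n g (u t) a"
  have atS: "at t within S = at t" using S at_within_open by blast
  have 1: "((\<lambda>s. g (u s)) has_derivative (\<lambda>h. \<Sum>i<n. a i * L i h)) (at t)"
    using has_cgrad_chain[of n g u t a L S] V u S(3) Z unfolding atS by blast
  have S': "eventually (\<lambda>s. s \<in> S) (nhds t)" using S by (simp add: eventually_nhds_in_open)
  then have evS: "eventually (\<lambda>s. s \<in> S) (at t)" by (simp add: eventually_at_filter eventually_mono)
  have "eventually (\<lambda>s. u s \<in> V) (at t)"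
  proof (rule eventually_in_copen)
    show "copen n V" "u t \<in> V" using V by (auto simp: holo_def)
    show "((\<lambda>s. u s i) \<longlongrightarrow> u t i) (at t)" if "i < n" for i
      using has_derivative_continuous[OF u[OF that]] by (simp add: continuous_within)
    show "eventually (\<lambda>s. u s \<in> cvec n) (at t)" using evS by eventually_elim (use S Z in blast)
  qed
  with evS have "eventually (\<lambda>s. 0 = g (u s)) (at t)" by eventually_elim (use V S in force)
  moreover have "0 = g (u t)" using V S(2) S(3)[OF S(2)] by force
  ultimately have "((\<lambda>s. g (u s)) has_derivative (\<lambda>h. 0)) (at t)"
    by (rule has_derivative_transform_eventually[OF has_derivative_const _ _ UNIV_I])
  with 1 have "(\<lambda>h. \<Sum>i<n. a i * L i h) = (\<lambda>h. 0)" by (rule has_derivative_unique)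
  then have "(\<Sum>i<n. a i * L i h) = 0" by metis
  then show "(\<Sum>i<n. a i * (if i < n then L i h else 0)) = 0" by simp
qed

lemma ztangent_scale: "v \<in> ztangent n Z z \<Longrightarrow> (\<lambda>i. c * v i) \<in> ztangent n Z z"
proof -
  have "(\<Sum>i<n. a i * (c * v i)) = c * (\<Sum>i<n. a i * v i)" for a
    by (simp add: sum_distrib_left mult_ac)
  then show "v \<in> ztangent n Z z \<Longrightarrow> (\<lambda>i. c * v i) \<in> ztangent n Z z"
    unfolding ztangent_def cvec_def by auto
qed

lemma zero_in_ztangent: "(\<lambda>i. 0) \<in> ztangent n Z z"
  by (auto simp: ztangent_def cvec_def)

lemma hform_scale: "hform n H (\<lambda>i. c * v i) (\<lambda>i. c * v i) = of_real ((cmod c)\<^sup>2) * hform n H v v"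
  by (simp add: hform_def sum_distrib_left complex_norm_square mult_ac del: of_real_power)

lemma hform_tendsto:
  assumes "\<And>i j. i < n \<Longrightarrow> j < n \<Longrightarrow> ((\<lambda>x. H x i j) \<longlongrightarrow> H0 i j) F"
    and "\<And>i. i < n \<Longrightarrow> ((\<lambda>x. v x i) \<longlongrightarrow> v0 i) F"
  shows "((\<lambda>x. hform n (H x) (v x) (v x)) \<longlongrightarrow> hform n H0 v0 v0) F"
  unfolding hform_def by (intro tendsto_intros assms) auto

text \<open>A positive continuous function has a positive minimum on the compact product of
  \<open>P\<close> with the unit sphere of the norm \<open>\<Sum>i<n. cmod (v i)\<close>. The
  constant \<open>m\<close> is its square root, and homogeneity extends the bound to all
  \<open>v\<close>.\<close>

lemma posdef_hermitian_lower_bound: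
  fixes H :: "(nat \<Rightarrow> complex) \<Rightarrow> nat \<Rightarrow> nat \<Rightarrow> complex"
  assumes P: "compact P" and cont: "\<And>i j. i < n \<Longrightarrow> j < n \<Longrightarrow> continuous_on P (\<lambda>z. H z i j)"
    and pos: "\<And>z. z \<in> P \<Longrightarrow> posdef_hermitian n (H z)"
  obtains m where "m > 0"
    "\<And>z v i. z \<in> P \<Longrightarrow> i < n \<Longrightarrow> m * cmod (v i) \<le> sqrt (Re (hform n (H z) v v))"
proof (cases "P = {} \<or> n = 0")
  case True
  then show thesis by (intro that[of 1]) auto
next
  case False
  define S where "S = {v \<in> cpoly n (\<lambda>_. 0) 1. (\<Sum>i<n. cmod (v i)) = 1}"
  have contS: "continuous_on UNIV (\<lambda>v::nat \<Rightarrow> complex. \<Sum>i<n. cmod (v i))"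
    by (intro continuous_intros continuous_on_product_coordinates)
  have "closed {v::nat \<Rightarrow> complex. (\<Sum>i<n. cmod (v i)) = 1}"
    by (rule closed_Collect_eq[OF contS continuous_on_const])
  then have "compact (cpoly n (\<lambda>_. 0) 1 \<inter> {v. (\<Sum>i<n. cmod (v i)) = 1})"
    by (rule compact_Int_closed[OF compact_cpoly])
  moreover have "S = cpoly n (\<lambda>_. 0) 1 \<inter> {v. (\<Sum>i<n. cmod (v i)) = 1}"
    unfolding S_def by blast
  ultimately have S: "compact S" by metis
  \<comment> \<open>The first basis vector shows that the sphere is nonempty, as the existence of a
    minimum requires; this is why \<open>n = 0\<close> was split off.\<close>
  define e :: "nat \<Rightarrow> complex" where "e = (\<lambda>i. if i = 0 then 1 else 0)"
  have "(\<Sum>i<n. cmod (e i)) = (\<Sum>i<n. if i = 0 then 1 else 0)"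
    by (intro sum.cong) (auto simp: e_def)
  also have "\<dots> = 1" using False by simp
  finally have "(\<Sum>i<n. cmod (e i)) = 1" .
  moreover have "e \<in> cpoly n (\<lambda>_. 0) 1" using False by (simp add: e_def cpoly_def cvec_def)
  ultimately have "e \<in> S" by (simp add: S_def)
  define \<phi> where "\<phi> = (\<lambda>(z, v). Re (hform n (H z) v v))"
  have "continuous_on (P \<times> S) \<phi>"
  proof -
    have c: "continuous_on (P \<times> S) (\<lambda>x. H (fst x) i j)" if "i < n" "j < n" for i j
      by (rule continuous_on_compose2[OF cont[OF that]]) (auto intro: continuous_intros)
    have v: "continuous_on (P \<times> S) (\<lambda>x. snd x i)" for i
      by (rule continuous_on_compose2[OF continuous_on_product_coordinates[of i]])
        (auto intro: continuous_intros)
    show ?thesis unfolding \<phi>_def hform_def case_prod_beta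
      by (intro continuous_intros c v) auto
  qed
  moreover have "compact (P \<times> S)" using P S by (rule compact_Times)
  moreover have "P \<times> S \<noteq> {}" using False \<open>e \<in> S\<close> by auto
  ultimately obtain x where x: "x \<in> P \<times> S" "\<And>y. y \<in> P \<times> S \<Longrightarrow> \<phi> x \<le> \<phi> y"
    using continuous_attains_inf[of "P \<times> S" \<phi>] by blast
  have "\<exists>i<n. snd x i \<noteq> 0"
  proof (rule ccontr)
    assume "\<not> ?thesis"
    then have "(\<Sum>i<n. cmod (snd x i)) = 0" by simp
    then show False using x(1) by (auto simp: S_def)
  qed
  then have "\<phi> x > 0"
    using x(1) pos[of "fst x"] unfolding \<phi>_def posdef_hermitian_def case_prod_beta
    by (metis mem_Times_iff)
  define m where "m = sqrt (\<phi> x)"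
  have m: "m > 0" using \<open>\<phi> x > 0\<close> by (simp add: m_def)
  have "m * cmod (v i) \<le> sqrt (Re (hform n (H z) v v))" if z: "z \<in> P" and i: "i < n" for z v i
  proof -
    define s where "s = (\<Sum>i<n. cmod (v i))"
    have vs: "cmod (v j) \<le> s" if "j < n" for j
      unfolding s_def using that by (intro member_le_sum) auto
    show ?thesis
    proof (cases "s = 0")
      case True
      then have "v j = 0" if "j < n" for j using vs[OF that] by simp
      then have "hform n (H z) v v = 0" by (simp add: hform_def)
      then show ?thesis using \<open>\<And>j. j < n \<Longrightarrow> v j = 0\<close> i by simp
    next
      case False
      then have s: "s > 0" using vs[OF i] by (smt (verit) norm_ge_zero)
      \<comment> \<open>Cut off beyond \<open>n\<close> as well as normalised, because
        \<open>v\<close> is arbitrary and the sphere lies in \<open>cvec n\<close>.\<close>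
      define w where "w = (\<lambda>j. if j < n then v j / of_real s else 0)"
      have "(\<Sum>j<n. cmod (w j)) = (\<Sum>j<n. cmod (v j) / s)"
        using s by (intro sum.cong) (auto simp: w_def norm_divide)
      also have "\<dots> = 1" using s by (simp add: s_def flip: sum_divide_distrib)
      finally have "(\<Sum>j<n. cmod (w j)) = 1" .
      moreover have "w \<in> cpoly n (\<lambda>_. 0) 1"
        using s vs by (auto simp: w_def cpoly_def cvec_def norm_divide)
      ultimately have "w \<in> S" by (simp add: S_def)
      then have "\<phi> x \<le> Re (hform n (H z) w w)" using x(2)[of "(z, w)"] z by (simp add: \<phi>_def)
      then have "s\<^sup>2 * \<phi> x \<le> s\<^sup>2 * Re (hform n (H z) w w)" by (simp add: mult_left_mono)
      also have "\<dots> = Re (hform n (H z) (\<lambda>i. of_real s * w i) (\<lambda>i. of_real s * w i))"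
        by (simp add: hform_scale)
      also have "hform n (H z) (\<lambda>i. of_real s * w i) (\<lambda>i. of_real s * w i) = hform n (H z) v v"
        unfolding hform_def using s by (intro sum.cong) (auto simp: w_def)
      finally have "s * m \<le> sqrt (Re (hform n (H z) v v))"
        using s \<open>\<phi> x > 0\<close> by (intro real_le_rsqrt) (simp add: m_def power_mult_distrib)
      moreover have "m * cmod (v i) \<le> s * m" using vs[OF i] m by (simp add: mult.commute)
      ultimately show ?thesis by linarith
    qed
  qed
  with m show thesis by (rule that)
qed

subsection \<open>Charts and the metric\<close>

text \<open>Off \<open>Z\<close> some local equation is nonzero, and stays so nearby. Closedness in
  \<open>D\<close> is what makes small polydiscs of a chart compact.\<close>

lemma analytic_subset_closedin:
  assumes "analytic_subset n D Z"
  shows "closedin (top_of_set D) Z"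
proof -
  have D: "copen n D" "Z \<subseteq> D" using assms by (auto simp: analytic_subset_def)
  have "openin (top_of_set D) (D - Z)"
  proof (subst openin_subopen, intro ballI)
    fix z assume z: "z \<in> D - Z"
    have "\<exists>V G. copen n V \<and> z \<in> V \<and> V \<subseteq> D \<and> finite G \<and> (\<forall>g\<in>G. holo n V g) \<and>
        Z \<inter> V = {w\<in>V. \<forall>g\<in>G. g w = 0}"
      using assms z unfolding analytic_subset_def by blast
    then obtain V G where VG: "copen n V" "z \<in> V" "V \<subseteq> D" "\<forall>g\<in>G. holo n V g"
        "Z \<inter> V = {w\<in>V. \<forall>g\<in>G. g w = 0}" by blast
    obtain g where g: "g \<in> G" "g z \<noteq> 0" using VG z by blast
    have "openin (top_of_set V) (V \<inter> g -` (- {0}))"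
      using VG(4) g(1) by (intro continuous_openin_preimage_gen holo_imp_continuous_on) auto
    moreover have "openin (top_of_set D) V"
      using VG(1,3) copen_subset_cvec[OF D(1)] unfolding copen_def
      by (rule openin_subset_trans)
    ultimately have "openin (top_of_set D) (V \<inter> g -` (- {0}))" by (rule openin_trans)
    moreover have "V \<inter> g -` (- {0}) \<subseteq> D - Z" using VG(3,5) g(1) by blast
    ultimately show "\<exists>T. openin (top_of_set D) T \<and> z \<in> T \<and> T \<subseteq> D - Z"
      using g VG(2) by (intro exI[of _ "V \<inter> g -` (- {0})"]) auto
  qed
  then show ?thesis using D(2) by (simp add: closedin_def)
qed

text \<open>For large \<open>r\<close> such a set may stop at the edge of the chart domain and fail
  to be closed in \<open>M\<close>; \<open>good_chart\<close> therefore comes with a radius up to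
  which it is compact.\<close>

definition cnbhd :: "'m chart \<Rightarrow> 'm \<Rightarrow> real \<Rightarrow> 'm set" where
  "cnbhd c x r = {y\<in>cdom c. \<forall>i<cdim c. cmod (cmap c y i - cmap c x i) \<le> r}"

text \<open>\<open>Hol\<close> without the convention on values outside the domain, so that one
  function can be holomorphic on several domains and can be restricted to discs.\<close>

definition hol_on :: "'m topology \<Rightarrow> 'm chart set \<Rightarrow> complex set \<Rightarrow> (complex \<Rightarrow> 'm) \<Rightarrow> bool" where
  "hol_on M A D f \<longleftrightarrow> continuous_map (top_of_set D) M f \<and>
     (\<forall>c\<in>A. \<forall>i<cdim c. (\<lambda>z. cmap c (f z) i) holomorphic_on {z\<in>D. f z \<in> cdom c})"

definition hvel :: "'m chart \<Rightarrow> (complex \<Rightarrow> 'm) \<Rightarrow> complex \<Rightarrow> nat \<Rightarrow> complex" where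
  "hvel c f z = (\<lambda>i. if i < cdim c then deriv (\<lambda>w. cmap c (f w) i) z else 0)"

definition hspeed :: "'m chart set \<Rightarrow> 'm metric_data \<Rightarrow> (complex \<Rightarrow> 'm) \<Rightarrow> complex \<Rightarrow> real" where
  "hspeed A E f z = tangent_length E (chart_at A (f z)) (f z) (hvel (chart_at A (f z)) f z)"

lemma cnbhd_mono: "r \<le> s \<Longrightarrow> cnbhd c x r \<subseteq> cnbhd c x s"
  by (force simp: cnbhd_def)

lemma hol_on_subset: "hol_on M A D f \<Longrightarrow> S \<subseteq> D \<Longrightarrow> hol_on M A S f"
  unfolding hol_on_def
  by (auto intro: continuous_map_from_subtopology_mono holomorphic_on_subset)

locale hermitian_space =
  fixes M :: "'m topology" and A :: "'m chart set" and E :: "'m metric_data"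
  assumes complex_space: "complex_space M A" and hermitian_metric: "hermitian_metric A E"
begin

lemma Hausdorff: "Hausdorff_space M" and second_countable: "second_countable M"
  and topspace_eq: "topspace M = (\<Union>c\<in>A. cdom c)"
  using complex_space by (auto simp: complex_space_def)

lemma chart_local_model: "c \<in> A \<Longrightarrow> local_model M c"
  using complex_space by (auto simp: complex_space_def)

lemma openin_cdom: "c \<in> A \<Longrightarrow> openin M (cdom c)"
  using chart_local_model by (auto simp: local_model_def)

lemma cimg_subset: "c \<in> A \<Longrightarrow> cimg c \<subseteq> cvec (cdim c)"
  using chart_local_model[of c] copen_subset_cvec
  by (fastforce simp: local_model_def analytic_subset_def)

lemma cmap_in_cvec: "c \<in> A \<Longrightarrow> x \<in> cdom c \<Longrightarrow> cmap c x \<in> cvec (cdim c)"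
  using cimg_subset by blast

lemma chart_at: "x \<in> topspace M \<Longrightarrow> chart_at A x \<in> A \<and> x \<in> cdom (chart_at A x)"
  unfolding chart_at_def by (rule someI_ex) (auto simp: topspace_eq)

lemma continuous_map_cmap: "c \<in> A \<Longrightarrow> continuous_map (subtopology M (cdom c)) euclidean (cmap c)"
  using chart_local_model[of c]
  by (auto simp: local_model_def continuous_map_in_subtopology dest!: homeomorphic_imp_continuous_map)

lemma continuous_map_coord:
  assumes "c \<in> A" shows "continuous_map (subtopology M (cdom c)) euclidean (\<lambda>y. cmap c y i)"
proof -
  have "continuous_map euclidean euclidean (\<lambda>w::nat \<Rightarrow> complex. w i)"
    by (simp add: continuous_on_product_coordinates)
  from continuous_map_compose[OF continuous_map_cmap[OF assms] this]
  show ?thesis by (simp add: o_def)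
qed

lemma openin_chart_preimage:
  assumes "c \<in> A" "\<And>i. i < cdim c \<Longrightarrow> open (S i)"
  shows "openin M {y\<in>cdom c. \<forall>i<cdim c. cmap c y i \<in> S i}"
proof -
  have "openin (subtopology M (cdom c)) {y \<in> topspace (subtopology M (cdom c)). cmap c y i \<in> S i}"
    if "i < cdim c" for i
    using openin_continuous_map_preimage[OF continuous_map_coord[OF assms(1)], of "S i" i] assms(2)[OF that]
    by simp
  then have "openin M {y\<in>cdom c. cmap c y i \<in> S i}" if "i < cdim c" for i
    using that openin_trans_full[OF _ openin_cdom[OF assms(1)]] openin_subset[OF openin_cdom[OF assms(1)]]
    by (simp add: Int_absorb1)
  then have "openin M (cdom c \<inter> (\<Inter>i\<in>{..<cdim c}. {y\<in>cdom c. cmap c y i \<in> S i}))"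
    using openin_cdom[OF assms(1)] by (intro openin_Int_Inter[of "_ ` _", simplified]) auto
  moreover have "cdom c \<inter> (\<Inter>i\<in>{..<cdim c}. {y\<in>cdom c. cmap c y i \<in> S i})
      = {y\<in>cdom c. \<forall>i<cdim c. cmap c y i \<in> S i}" by auto
  ultimately show ?thesis by simp
qed

lemma openin_cball_chart:
  assumes "c \<in> A"
  shows "openin M {y\<in>cdom c. \<forall>i<cdim c. cmod (cmap c y i - cmap c x i) < r}"
  using openin_chart_preimage[OF assms, of "\<lambda>i. ball (cmap c x i) r"]
  by (simp add: dist_norm norm_minus_commute)

lemma cnbhd_base:
  assumes c: "c \<in> A" "x \<in> cdom c" and U: "openin M U" "x \<in> U"
  obtains r where "r > 0" "cnbhd c x r \<subseteq> U"
proof -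
  have hom: "homeomorphic_map (subtopology M (cdom c)) (top_of_set (cimg c)) (cmap c)"
    using chart_local_model[OF c(1)] by (simp add: local_model_def)
  have "openin (subtopology M (cdom c)) (cdom c \<inter> U)"
    using U by (auto simp: openin_subtopology)
  then have "openin (top_of_set (cimg c)) (cmap c ` (cdom c \<inter> U))"
    using homeomorphic_imp_open_map[OF hom] by (simp add: open_map_def)
  then obtain O' where O': "open O'" "cmap c ` (cdom c \<inter> U) = cimg c \<inter> O'"
    by (auto simp: openin_open)
  then have "cmap c x \<in> O'" using c U by blast
  then obtain r where r: "r > 0" "cpoly (cdim c) (cmap c x) r \<subseteq> O'"
    using cpoly_subset_open[OF O'(1)] cmap_in_cvec[OF c] by metis
  have inj: "inj_on (cmap c) (cdom c)"
    using homeomorphic_imp_injective_map[OF hom] openin_subset[OF openin_cdom[OF c(1)]]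
    by (simp add: Int_absorb1)
  have "y \<in> U" if "y \<in> cnbhd c x r" for y
  proof -
    have y: "y \<in> cdom c" using that by (simp add: cnbhd_def)
    have "cmap c y \<in> cpoly (cdim c) (cmap c x) r"
      using that cmap_in_cvec[OF c(1) y] by (simp add: cnbhd_def cpoly_def)
    then have "cmap c y \<in> cmap c ` (cdom c \<inter> U)" using r O' y by blast
    then show ?thesis using inj y by (auto dest: inj_onD)
  qed
  with r(1) show thesis by (intro that[of r]) auto
qed

text \<open>The image of the chart is closed in an open set \<open>D\<close> of \<open>cvec\<close>,
  so it meets a closed polydisc inside \<open>D\<close> in a compact set, which the homeomorphism
  carries back to \<open>M\<close>.\<close>

lemma compactin_cnbhd:
  assumes c: "c \<in> A" "x \<in> cdom c"
  obtains r where "r > 0" "\<And>s. s \<le> r \<Longrightarrow> compactin M (cnbhd c x s)"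
proof -
  have lm: "local_model M c" by (rule chart_local_model[OF c(1)])
  then have hom: "homeomorphic_map (subtopology M (cdom c)) (top_of_set (cimg c)) (cmap c)"
    by (simp add: local_model_def)
  from lm obtain D where D: "analytic_subset (cdim c) D (cimg c)" by (auto simp: local_model_def)
  then have Dc: "copen (cdim c) D" "cimg c \<subseteq> D" by (auto simp: analytic_subset_def)
  obtain r where r: "r > 0" "cpoly (cdim c) (cmap c x) r \<subseteq> D"
    using cpoly_subset_copen[OF Dc(1)] Dc(2) c(2) by (metis imageI subsetD)
  obtain C where C: "closed C" "cimg c = D \<inter> C"
    using analytic_subset_closedin[OF D] by (auto simp: closedin_closed)
  have "compactin M (cnbhd c x s)" if "s \<le> r" for s
  proof -
    have "cmap c ` cnbhd c x s = cimg c \<inter> cpoly (cdim c) (cmap c x) s"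
      using cmap_in_cvec[OF c(1)] by (auto simp: cnbhd_def cpoly_def)
    also have "\<dots> = cpoly (cdim c) (cmap c x) s \<inter> C"
      using C(2) r(2) cpoly_mono[OF that] by blast
    finally have img: "cmap c ` cnbhd c x s = cpoly (cdim c) (cmap c x) s \<inter> C" .
    have "compact (cpoly (cdim c) (cmap c x) s \<inter> C)"
      by (rule compact_Int_closed[OF compact_cpoly C(1)])
    then have "compactin (top_of_set (cimg c)) (cmap c ` cnbhd c x s)"
      unfolding img using C(2) order_trans[OF cpoly_mono[OF that] r(2)]
      by (auto simp: compactin_subtopology)
    then have "compactin (subtopology M (cdom c)) (cnbhd c x s)"
      using homeomorphic_map_compactness_eq[OF hom] openin_subset[OF openin_cdom[OF c(1)]]
      by (auto simp: cnbhd_def)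
    then show ?thesis by (simp add: compactin_subtopology)
  qed
  with r(1) show thesis by (rule that)
qed

text \<open>\<open>G\<close> is the Gram matrix of an ambient extension of the metric, read on
  \<open>M\<close>. By the constant \<open>m\<close> a coordinate moves at most \<open>1 / m\<close>
  times as fast as length grows; the bound can be asked for all \<open>v\<close>, as the extension
  is positive definite on the whole of \<open>C^n\<close>.\<close>

definition good_chart :: "'m chart \<Rightarrow> 'm \<Rightarrow> real \<Rightarrow> real \<Rightarrow> ('m \<Rightarrow> nat \<Rightarrow> nat \<Rightarrow> complex) \<Rightarrow> bool" where
  "good_chart c x R m G \<longleftrightarrow> c \<in> A \<and> x \<in> cdom c \<and> 0 < R \<and> 0 < m \<and>
     (\<forall>r\<le>R. compactin M (cnbhd c x r)) \<and>
     (\<forall>y\<in>cnbhd c x R. \<forall>v\<in>ztangent (cdim c) (cimg c) (cmap c y).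
        E c y v v = hform (cdim c) (G y) v v) \<and>
     (\<forall>y\<in>cnbhd c x R. \<forall>v. \<forall>i<cdim c. m * cmod (v i) \<le> sqrt (Re (hform (cdim c) (G y) v v))) \<and>
     (\<forall>i<cdim c. \<forall>j<cdim c.
        continuous_map (subtopology M (cnbhd c x R)) euclidean (\<lambda>y. G y i j))"

lemma good_chart_exists:
  assumes c: "c \<in> A" "x \<in> cdom c" and U: "openin M U" "x \<in> U"
  obtains R m G where "good_chart c x R m G" "cnbhd c x R \<subseteq> U"
proof -
  let ?n = "cdim c"
  have "\<exists>W H. copen ?n W \<and> cmap c x \<in> W \<and>
        (\<forall>i<?n. \<forall>j<?n. smooth ?n W (\<lambda>z. H z i j)) \<and>
        (\<forall>z\<in>W. posdef_hermitian ?n (H z)) \<and>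
        (\<forall>y\<in>cdom c. cmap c y \<in> W \<longrightarrow>
           (\<forall>v\<in>ztangent ?n (cimg c) (cmap c y). \<forall>w\<in>ztangent ?n (cimg c) (cmap c y).
              E c y v w = hform ?n (H (cmap c y)) v w))"
    using hermitian_metric c unfolding hermitian_metric_def by blast
  then obtain W H where W: "copen ?n W" "cmap c x \<in> W"
    and sm: "\<forall>i<?n. \<forall>j<?n. smooth ?n W (\<lambda>z. H z i j)"
    and pd: "\<forall>z\<in>W. posdef_hermitian ?n (H z)"
    and EH: "\<forall>y\<in>cdom c. cmap c y \<in> W \<longrightarrow>
           (\<forall>v\<in>ztangent ?n (cimg c) (cmap c y). \<forall>w\<in>ztangent ?n (cimg c) (cmap c y).
              E c y v w = hform ?n (H (cmap c y)) v w)"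
    by blast
  have cont: "continuous_on W (\<lambda>z. H z i j)" if "i < ?n" "j < ?n" for i j
  proof -
    have "Ck_on ?n 0 W (\<lambda>z. H z i j)" using sm that unfolding smooth_def by blast
    then show ?thesis by simp
  qed
  obtain r1 where r1: "r1 > 0" "cpoly ?n (cmap c x) r1 \<subseteq> W"
    using cpoly_subset_copen[OF W] by blast
  obtain r2 where r2: "r2 > 0" "\<And>s. s \<le> r2 \<Longrightarrow> compactin M (cnbhd c x s)"
    using compactin_cnbhd[OF c] by blast
  obtain r3 where r3: "r3 > 0" "cnbhd c x r3 \<subseteq> U"
    using cnbhd_base[OF c U] by blast
  \<comment> \<open>Three demands on the radius: the ambient metric is defined, the neighbourhoods
    are compact, and they lie in \<open>U\<close>.\<close>
  define R where "R = min r1 (min r2 r3)"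
  have R: "R > 0" "R \<le> r1" "R \<le> r2" "R \<le> r3" using r1 r2 r3 by (auto simp: R_def)
  obtain m where m: "m > 0" "\<And>z v i. z \<in> cpoly ?n (cmap c x) r1 \<Longrightarrow> i < ?n \<Longrightarrow>
      m * cmod (v i) \<le> sqrt (Re (hform ?n (H z) v v))"
  proof (rule posdef_hermitian_lower_bound[of "cpoly ?n (cmap c x) r1" ?n H])
    show "compact (cpoly ?n (cmap c x) r1)" by (rule compact_cpoly)
    show "continuous_on (cpoly ?n (cmap c x) r1) (\<lambda>z. H z i j)" if "i < ?n" "j < ?n" for i j
      by (rule continuous_on_subset[OF cont[OF that] r1(2)])
    show "posdef_hermitian ?n (H z)" if "z \<in> cpoly ?n (cmap c x) r1" for z
      using pd r1(2) that by blast
  qed blast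
  have in_poly: "cmap c y \<in> cpoly ?n (cmap c x) r1" if "y \<in> cnbhd c x R" for y
    using that cmap_in_cvec[OF c(1), of y] R(2) by (force simp: cnbhd_def cpoly_def)
  have G: "continuous_map (subtopology M (cnbhd c x R)) euclidean (\<lambda>y. H (cmap c y) i j)"
    if "i < ?n" "j < ?n" for i j
  proof -
    have "continuous_map (subtopology M (cnbhd c x R)) euclidean (cmap c)"
      using continuous_map_cmap[OF c(1)]
      by (rule continuous_map_from_subtopology_mono) (auto simp: cnbhd_def)
    then have 1: "continuous_map (subtopology M (cnbhd c x R)) (top_of_set W) (cmap c)"
      using in_poly r1(2) by (auto simp: continuous_map_in_subtopology)
    have 2: "continuous_map (top_of_set W) euclidean (\<lambda>z. H z i j)"
      using cont[OF that] by simp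
    from continuous_map_compose[OF 1 2] show ?thesis by (simp add: o_def)
  qed
  have EG: "E c y v v = hform ?n (H (cmap c y)) v v"
    if "y \<in> cnbhd c x R" "v \<in> ztangent ?n (cimg c) (cmap c y)" for y v
    using EH in_poly[OF that(1)] r1(2) that by (auto simp: cnbhd_def)
  have K: "compactin M (cnbhd c x r)" if "r \<le> R" for r using r2(2) that R by simp
  have "good_chart c x R m (\<lambda>y. H (cmap c y))"
    unfolding good_chart_def using c R(1) m(1) K EG m(2)[OF in_poly] G by simp
  moreover have "cnbhd c x R \<subseteq> U" using cnbhd_mono[OF R(4)] r3(2) by (rule order_trans)
  ultimately show thesis by (rule that)
qed

lemma limitin_coord:
  assumes c: "c \<in> A" "x \<in> cdom c" and lim: "limitin M g x F"
  shows "((\<lambda>s. cmap c (g s) i) \<longlongrightarrow> cmap c x i) F"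
proof -
  have "limitin (subtopology M (cdom c)) g x F"
    using lim c(2) limitinD[OF lim openin_cdom[OF c(1)] c(2)] by (simp add: limitin_subtopology)
  from continuous_map_limit[OF continuous_map_coord[OF c(1), of i] this]
  show ?thesis by (simp add: o_def)
qed

text \<open>By the chain rule the differential \<open>J\<close> of the transition maps the velocity
  in \<open>c\<close> to the velocity in \<open>d\<close>, and the metric makes \<open>J\<close>
  isometric on tangent vectors. The general source covers curves and holomorphic maps.\<close>

lemma tangent_length_chart_change:
  fixes u :: "'a::real_normed_vector \<Rightarrow> 'm"
  assumes c: "c \<in> A" and d: "d \<in> A" and S: "open S" "t \<in> S" "\<And>s. s \<in> S \<Longrightarrow> u s \<in> cdom c \<inter> cdom d"
    and L: "\<And>i. i < cdim c \<Longrightarrow> ((\<lambda>s. cmap c (u s) i) has_derivative L i) (at t)"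
    and L': "\<And>k. k < cdim d \<Longrightarrow> ((\<lambda>s. cmap d (u s) k) has_derivative L' k) (at t)"
  shows "tangent_length E c (u t) (\<lambda>i. if i < cdim c then L i h else 0)
       = tangent_length E d (u t) (\<lambda>k. if k < cdim d then L' k h else 0)"
proof -
  let ?v = "\<lambda>i. if i < cdim c then L i h else 0"
  have ut: "u t \<in> cdom c \<inter> cdom d" using S by blast
  then obtain W F where tr: "transition c d (u t) W F"
    using complex_space c d unfolding complex_space_def by meson
  have ho: "holo (cdim c) W (\<lambda>w. F w k)" if "k < cdim d" for k
    using tr that by (simp add: transition_def)
  have W: "copen (cdim c) W" "cmap c (u t) \<in> W" using tr by (auto simp: transition_def)
  have "\<exists>a. has_cgrad (cdim c) (\<lambda>w. F w k) (cmap c (u t)) a" if "k < cdim d" for k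
    using ho[OF that] W by (auto simp: holo_def)
  then obtain J where J: "\<And>k. k < cdim d \<Longrightarrow> has_cgrad (cdim c) (\<lambda>w. F w k) (cmap c (u t)) (J k)"
    by metis
  have vt: "?v \<in> ztangent (cdim c) (cimg c) (cmap c (u t))"
    using ztangent_derivative[where u = "\<lambda>s. cmap c (u s)" and L = L and t = t and S = S and Z = "cimg c"]
      L S cimg_subset[OF c] by blast
  have iso: "E c (u t) ?v ?v = E d (u t) (\<lambda>k. if k < cdim d then \<Sum>i<cdim c. J k i * ?v i else 0)
                             (\<lambda>k. if k < cdim d then \<Sum>i<cdim c. J k i * ?v i else 0)"
    using hermitian_metric c d ut tr J vt unfolding hermitian_metric_def by blast
  have "L' k h = (\<Sum>i<cdim c. J k i * ?v i)" if k: "k < cdim d" for k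
  proof -
    have atS: "at t within S = at t" using S at_within_open by blast
    have 1: "((\<lambda>s. F (cmap c (u s)) k) has_derivative (\<lambda>h. \<Sum>i<cdim c. J k i * L i h)) (at t)"
      using has_cgrad_chain[of "cdim c" "\<lambda>w. F w k" "\<lambda>s. cmap c (u s)" t "J k" L S] J[OF k] L
        cmap_in_cvec[OF c] S(3) unfolding atS by blast
    have "eventually (\<lambda>s. s \<in> S) (nhds t)" using S by (simp add: eventually_nhds_in_open)
    then have evS: "eventually (\<lambda>s. s \<in> S) (at t)" by (simp add: eventually_at_filter eventually_mono)
    have "eventually (\<lambda>s. cmap c (u s) \<in> W) (at t)"
    proof (rule eventually_in_copen[OF W])
      show "((\<lambda>s. cmap c (u s) i) \<longlongrightarrow> cmap c (u t) i) (at t)" if "i < cdim c" for i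
        using has_derivative_continuous[OF L[OF that]] by (simp add: continuous_within)
      show "eventually (\<lambda>s. cmap c (u s) \<in> cvec (cdim c)) (at t)"
        using evS by eventually_elim (use cmap_in_cvec[OF c] S in blast)
    qed
    with evS have "eventually (\<lambda>s. F (cmap c (u s)) k = cmap d (u s) k) (at t)"
      by eventually_elim (use tr S k in \<open>auto simp: transition_def\<close>)
    moreover have "F (cmap c (u t)) k = cmap d (u t) k"
      using tr ut k by (auto simp: transition_def)
    ultimately have "((\<lambda>s. cmap d (u s) k) has_derivative (\<lambda>h. \<Sum>i<cdim c. J k i * L i h)) (at t)"
      by (rule has_derivative_transform_eventually[OF 1 _ _ UNIV_I])
    with L'[OF k] have "L' k = (\<lambda>h. \<Sum>i<cdim c. J k i * L i h)" by (rule has_derivative_unique)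
    then show ?thesis by simp
  qed
  then have "(\<lambda>k. if k < cdim d then \<Sum>i<cdim c. J k i * ?v i else 0) = (\<lambda>k. if k < cdim d then L' k h else 0)"
    by auto
  then show ?thesis using iso by (simp only: tangent_length_def)
qed

section \<open>Speed of holomorphic maps\<close>

lemma hol_on_open_preimage:
  assumes "hol_on M A D f" "open D" "openin M U"
  shows "open {z\<in>D. f z \<in> U}"
proof -
  have "openin (top_of_set D) {z \<in> topspace (top_of_set D). f z \<in> U}"
    using assms by (intro openin_continuous_map_preimage) (auto simp: hol_on_def)
  then show ?thesis using assms(2) by (auto dest: openin_open_trans)
qed

lemma hol_on_in_topspace: "hol_on M A D f \<Longrightarrow> z \<in> D \<Longrightarrow> f z \<in> topspace M"
  by (auto simp: hol_on_def continuous_map_def)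

lemma hol_on_coord_derivative:
  assumes "hol_on M A D f" "open D" "z \<in> D" "c \<in> A" "f z \<in> cdom c" "i < cdim c"
  shows "((\<lambda>w. cmap c (f w) i) has_field_derivative hvel c f z i) (at z)"
  using holomorphic_derivI[of "\<lambda>w. cmap c (f w) i" "{z\<in>D. f z \<in> cdom c}" z UNIV]
    hol_on_open_preimage[OF assms(1,2) openin_cdom[OF assms(4)]] assms
  by (auto simp: hol_on_def hvel_def)

lemma hvel_eqI:
  assumes "\<And>i. i < cdim c \<Longrightarrow> ((\<lambda>w. cmap c (f w) i) has_field_derivative v i) (at z)"
  shows "hvel c f z = (\<lambda>i. if i < cdim c then v i else 0)"
  using assms by (auto simp: hvel_def DERIV_imp_deriv)

lemma hvel_in_ztangent:
  assumes "hol_on M A D f" "open D" "z \<in> D" "c \<in> A" "f z \<in> cdom c"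
  shows "hvel c f z \<in> ztangent (cdim c) (cimg c) (cmap c (f z))"
proof -
  have "(\<lambda>i. if i < cdim c then hvel c f z i * 1 else 0) \<in> ztangent (cdim c) (cimg c) (cmap c (f z))"
  proof (rule ztangent_derivative[where u = "\<lambda>w. cmap c (f w)" and S = "{z\<in>D. f z \<in> cdom c}"])
    show "open {z\<in>D. f z \<in> cdom c}"
      by (rule hol_on_open_preimage[OF assms(1,2) openin_cdom[OF assms(4)]])
    show "((\<lambda>w. cmap c (f w) i) has_derivative (\<lambda>h. hvel c f z i * h)) (at z)" if "i < cdim c" for i
      using hol_on_coord_derivative[OF assms that] by (simp add: has_field_derivative_def)
  qed (use assms cimg_subset in auto)
  moreover have "(\<lambda>i. if i < cdim c then hvel c f z i * 1 else 0) = hvel c f z"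
    by (auto simp: hvel_def)
  ultimately show ?thesis by simp
qed

text \<open>\<open>hspeed\<close> picks a chart by choice, which may jump from point to point; local
  arguments need the speed in one fixed chart.\<close>

lemma hspeed_chart:
  assumes "hol_on M A D f" "open D" "z \<in> D" "c \<in> A" "f z \<in> cdom c"
  shows "hspeed A E f z = tangent_length E c (f z) (hvel c f z)"
proof -
  define d where "d = chart_at A (f z)"
  have d: "d \<in> A" "f z \<in> cdom d" using chart_at[OF hol_on_in_topspace[OF assms(1,3)]] by (auto simp: d_def)
  have "tangent_length E d (f z) (\<lambda>i. if i < cdim d then hvel d f z i * 1 else 0)
      = tangent_length E c (f z) (\<lambda>i. if i < cdim c then hvel c f z i * 1 else 0)"
  proof (rule tangent_length_chart_change[OF d(1) assms(4), where S = "{z\<in>D. f z \<in> cdom c} \<inter> {z\<in>D. f z \<in> cdom d}"])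
    show "open ({z\<in>D. f z \<in> cdom c} \<inter> {z\<in>D. f z \<in> cdom d})"
      using hol_on_open_preimage[OF assms(1,2)] openin_cdom assms(4) d(1) by (intro open_Int) auto
    show "((\<lambda>w. cmap c (f w) i) has_derivative (\<lambda>h. hvel c f z i * h)) (at z)" if "i < cdim c" for i
      using hol_on_coord_derivative[OF assms that] by (simp add: has_field_derivative_def)
    show "((\<lambda>w. cmap d (f w) i) has_derivative (\<lambda>h. hvel d f z i * h)) (at z)" if "i < cdim d" for i
      using hol_on_coord_derivative[OF assms(1-3) d that] by (simp add: has_field_derivative_def)
  qed (use assms d in auto)
  moreover have "(\<lambda>i. if i < cdim d then hvel d f z i * 1 else 0) = hvel d f z"
    "(\<lambda>i. if i < cdim c then hvel c f z i * 1 else 0) = hvel c f z"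
    by (auto simp: hvel_def)
  ultimately show ?thesis by (simp add: hspeed_def d_def)
qed

lemma good_chart_exists':
  assumes "x \<in> topspace M"
  obtains c R m G where "good_chart c x R m G"
proof -
  have c: "chart_at A x \<in> A" "x \<in> cdom (chart_at A x)" using chart_at[OF assms] by auto
  show thesis by (rule good_chart_exists[OF c openin_topspace assms], rule that)
qed

lemma good_chartD:
  assumes "good_chart c x R m G"
  shows "c \<in> A" "x \<in> cdom c" "0 < R" "0 < m"
    and "\<And>r. r \<le> R \<Longrightarrow> compactin M (cnbhd c x r)"
    and "\<And>y v. y \<in> cnbhd c x R \<Longrightarrow> v \<in> ztangent (cdim c) (cimg c) (cmap c y) \<Longrightarrow>
      E c y v v = hform (cdim c) (G y) v v"
    and "\<And>y v i. y \<in> cnbhd c x R \<Longrightarrow> i < cdim c \<Longrightarrow>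
      m * cmod (v i) \<le> sqrt (Re (hform (cdim c) (G y) v v))"
    and "\<And>i j. i < cdim c \<Longrightarrow> j < cdim c \<Longrightarrow>
      continuous_map (subtopology M (cnbhd c x R)) euclidean (\<lambda>y. G y i j)"
  using assms unfolding good_chart_def by blast+

lemma center_in_cnbhd: "good_chart c x R m G \<Longrightarrow> 0 \<le> r \<Longrightarrow> x \<in> cnbhd c x r"
  by (auto simp: good_chart_def cnbhd_def)

lemma good_chart_closedin: "good_chart c x R m G \<Longrightarrow> r \<le> R \<Longrightarrow> closedin M (cnbhd c x r)"
  using good_chartD(5) compactin_imp_closedin[OF Hausdorff] by blast

lemma good_chart_interior:
  assumes "good_chart c x R m G"
  obtains V where "openin M V" "V \<subseteq> cnbhd c x R" "x \<in> V" "\<And>r. r < R \<Longrightarrow> cnbhd c x r \<subseteq> V"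
proof (rule that)
  show "openin M {y\<in>cdom c. \<forall>i<cdim c. cmod (cmap c y i - cmap c x i) < R}"
    using good_chartD(1)[OF assms] by (rule openin_cball_chart)
qed (use good_chartD(2,3)[OF assms] in \<open>auto simp: cnbhd_def\<close>)

lemma tangent_length_ge:
  assumes "good_chart c x R m G" "y \<in> cnbhd c x R" "v \<in> ztangent (cdim c) (cimg c) (cmap c y)" "i < cdim c"
  shows "m * cmod (v i) \<le> tangent_length E c y v"
  using good_chartD(6,7)[OF assms(1)] assms by (simp add: tangent_length_def)

text \<open>\<open>sqrt\<close> is an odd function, so a negative argument would give a negative
  length; positivity of the metric excludes that.\<close>

lemma tangent_length_nonneg:
  assumes "c \<in> A" "y \<in> cdom c" "v \<in> ztangent (cdim c) (cimg c) (cmap c y)"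
  shows "0 \<le> tangent_length E c y v"
proof -
  obtain R m G where g: "good_chart c y R m G"
    using good_chart_exists[OF assms(1,2) openin_cdom[OF assms(1)] assms(2)] by blast
  have y: "y \<in> cnbhd c y R" using g good_chartD(3)[OF g] by (auto intro: center_in_cnbhd)
  show ?thesis
  \<comment> \<open>In dimension \<open>0\<close> there is no coordinate to supply a lower bound,
    but the form is an empty sum.\<close>
  proof (cases "cdim c = 0")
    case True
    then have "hform (cdim c) (G y) v v = 0" by (simp add: hform_def)
    then show ?thesis using good_chartD(6)[OF g y assms(3)] by (simp add: tangent_length_def)
  next
    case False
    have "0 \<le> m * cmod (v 0)" using good_chartD(4)[OF g] by simp
    also have "\<dots> \<le> tangent_length E c y v" using tangent_length_ge[OF g y assms(3)] False by simp
    finally show ?thesis .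
  qed
qed

lemma tangent_length_scale:
  assumes "c \<in> A" "y \<in> cdom c" "v \<in> ztangent (cdim c) (cimg c) (cmap c y)"
  shows "tangent_length E c y (\<lambda>i. k * v i) = cmod k * tangent_length E c y v"
proof -
  obtain R m G where g: "good_chart c y R m G"
    using good_chart_exists[OF assms(1,2) openin_cdom[OF assms(1)] assms(2)] by blast
  have y: "y \<in> cnbhd c y R" using g good_chartD(3)[OF g] by (auto intro: center_in_cnbhd)
  have "E c y (\<lambda>i. k * v i) (\<lambda>i. k * v i) = of_real ((cmod k)\<^sup>2) * E c y v v"
    unfolding good_chartD(6)[OF g y assms(3)] good_chartD(6)[OF g y ztangent_scale[OF assms(3)]]
    by (rule hform_scale)
  then show ?thesis by (simp add: tangent_length_def real_sqrt_mult)
qed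

lemma tangent_length_zero:
  assumes "c \<in> A" "y \<in> cdom c"
  shows "tangent_length E c y (\<lambda>i. 0) = 0"
  using tangent_length_scale[OF assms zero_in_ztangent, of 0] by simp

lemma hspeed_nonneg:
  assumes "hol_on M A D f" "open D" "z \<in> D"
  shows "0 \<le> hspeed A E f z"
  using tangent_length_nonneg hvel_in_ztangent[OF assms] chart_at[OF hol_on_in_topspace[OF assms(1,3)]]
  by (simp add: hspeed_def)

lemma hvel_le_hspeed:
  assumes g: "good_chart c x R m G" and f: "hol_on M A D f" "open D" "z \<in> D"
    and "f z \<in> cnbhd c x R" "i < cdim c"
  shows "m * cmod (hvel c f z i) \<le> hspeed A E f z"
proof -
  have "f z \<in> cdom c" using assms(5) by (simp add: cnbhd_def)
  then show ?thesis
    using tangent_length_ge[OF g assms(5) hvel_in_ztangent[OF f good_chartD(1)[OF g]] assms(6)]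
      hspeed_chart[OF f good_chartD(1)[OF g]] by simp
qed

text \<open>The mean value inequality: a speed of at most \<open>C\<close> bounds the derivative of
  each coordinate by \<open>C / m\<close>.\<close>

lemma coord_lipschitz:
  assumes g: "good_chart c x R m G" and f: "hol_on M A D f" "open D"
    and S: "convex S" "S \<subseteq> D" "\<And>z. z \<in> S \<Longrightarrow> f z \<in> cnbhd c x R" "\<And>z. z \<in> S \<Longrightarrow> hspeed A E f z \<le> C"
    and zw: "z \<in> S" "w \<in> S" and i: "i < cdim c"
  shows "cmod (cmap c (f z) i - cmap c (f w) i) \<le> C / m * cmod (z - w)"
proof (rule field_differentiable_bound[OF S(1)])
  fix s assume s: "s \<in> S"
  then have fs: "f s \<in> cdom c" "s \<in> D" using S(2,3) by (auto simp: cnbhd_def)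
  show "((\<lambda>z. cmap c (f z) i) has_field_derivative hvel c f s i) (at s within S)"
    using hol_on_coord_derivative[OF f fs(2) good_chartD(1)[OF g] fs(1) i]
    by (rule has_field_derivative_at_within)
  have "m * cmod (hvel c f s i) \<le> C"
    using hvel_le_hspeed[OF g f fs(2) S(3)[OF s] i] S(4)[OF s] by linarith
  then show "cmod (hvel c f s i) \<le> C / m"
    using good_chartD(4)[OF g] by (simp add: field_simps)
qed (use zw in auto)

text \<open>Along the segment from \<open>z0\<close> to \<open>z\<close> a coordinate moves by at
  most \<open>C * \<delta> / m\<close>, hence at most \<open>s\<close>, as long as the image is in
  the chart; \<open>path_stays_in_openin\<close> removes the proviso.\<close>

lemma hol_stays_in_cnbhd:
  assumes g: "good_chart c x R m G" and f: "hol_on M A D f" "open D" "ball z0 \<delta> \<subseteq> D"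
    and speed: "\<And>z. z \<in> ball z0 \<delta> \<Longrightarrow> hspeed A E f z \<le> C"
    and C: "0 \<le> C" "C * \<delta> \<le> m * s" and start: "f z0 \<in> cnbhd c x r" and rs: "0 \<le> s" "r + s < R"
    and z: "z \<in> ball z0 \<delta>"
  shows "f z \<in> cnbhd c x (r + s)"
proof -
  define p where "p = (\<lambda>t::real. z0 + of_real t * (z - z0))"
  have nz: "cmod (z - z0) < \<delta>" using z by (simp add: dist_norm norm_minus_commute)
  have p: "p t \<in> ball z0 \<delta>" if "t \<in> {0..1}" for t
  proof -
    have "dist z0 (p t) = \<bar>t\<bar> * cmod (z - z0)" by (simp add: p_def dist_norm norm_mult)
    also have "\<dots> \<le> 1 * cmod (z - z0)" using that by (intro mult_right_mono) auto
    finally show ?thesis using nz by simp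
  qed
  obtain V where V: "openin M V" "V \<subseteq> cnbhd c x R" "x \<in> V" "\<And>r. r < R \<Longrightarrow> cnbhd c x r \<subseteq> V"
    by (rule good_chart_interior[OF g]) blast
  have "(f \<circ> p) ` {0..1} \<subseteq> cnbhd c x (r + s)"
  proof (rule path_stays_in_openin[OF _ V(1)])
    have 1: "continuous_map (top_of_set {0..1}) (top_of_set D) p"
      using p f(3) by (auto simp: p_def continuous_map_in_subtopology intro!: continuous_intros)
    have 2: "continuous_map (top_of_set D) M f" using f(1) by (simp add: hol_on_def)
    show "continuous_map (top_of_set {0..1}) M (f \<circ> p)" by (rule continuous_map_compose[OF 1 2])
    show "closedin M (cnbhd c x (r + s))" using good_chart_closedin[OF g] rs by simp
    show "cnbhd c x (r + s) \<subseteq> V" using V(4) rs by simp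
    show "(f \<circ> p) 0 \<in> V" using start V(4)[of r] rs by (auto simp: p_def)
    fix t :: real assume t: "0 \<le> t" "t \<le> 1" and tV: "(f \<circ> p) ` {0..t} \<subseteq> V"
    \<comment> \<open>The part of the segment up to \<open>p t\<close> is parametrised by the times
      \<open>u * t \<le> t\<close>, where \<open>tV\<close> keeps the image in the chart.\<close>
    have in_seg: "q \<in> ball z0 \<delta> \<and> f q \<in> cnbhd c x R" if q: "q \<in> closed_segment z0 (p t)" for q
    proof -
      obtain u where u: "0 \<le> u" "u \<le> 1" "q = (1 - u) *\<^sub>R z0 + u *\<^sub>R p t"
        using q by (auto simp: closed_segment_def)
      have "q = p (u * t)" by (simp add: u(3) p_def scaleR_conv_of_real algebra_simps)
      moreover have "0 \<le> u * t" "u * t \<le> t" using u t by (auto simp: mult_left_le_one_le)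
      ultimately show ?thesis using p[of "u * t"] tV V(2) t by fastforce
    qed
    have pt: "f (p t) \<in> cnbhd c x R" using in_seg by auto
    have "cmod (cmap c (f (p t)) i - cmap c x i) \<le> r + s" if i: "i < cdim c" for i
    proof -
      have "cmod (cmap c (f (p t)) i - cmap c (f z0) i) \<le> C / m * cmod (p t - z0)"
        by (rule coord_lipschitz[OF g f(1,2) convex_closed_segment _ _ _ _ _ i])
          (use in_seg speed f(3) in auto)
      also have "\<dots> \<le> C / m * \<delta>"
      proof (rule mult_left_mono)
        show "cmod (p t - z0) \<le> \<delta>" using p[of t] t by (simp add: dist_norm norm_minus_commute)
      qed (use C good_chartD(4)[OF g] in auto)
      also have "\<dots> \<le> s" using C good_chartD(4)[OF g] by (simp add: field_simps)
      finally have "cmod (cmap c (f (p t)) i - cmap c (f z0) i) \<le> s" .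
      moreover have "cmod (cmap c (f z0) i - cmap c x i) \<le> r" using start i by (simp add: cnbhd_def)
      ultimately show ?thesis
        using norm_triangle_ineq[of "cmap c (f (p t)) i - cmap c (f z0) i" "cmap c (f z0) i - cmap c x i"]
        by simp
    qed
    then show "(f \<circ> p) t \<in> cnbhd c x (r + s)" using pt by (simp add: cnbhd_def)
  qed
  moreover have "(f \<circ> p) 1 = f z" by (simp add: p_def)
  ultimately show ?thesis by (metis atLeastAtMost_iff image_subset_iff order_refl zero_le_one)
qed

subsection \<open>Lengths of curves\<close>

definition cvel :: "'m chart \<Rightarrow> (real \<Rightarrow> 'm) \<Rightarrow> real \<Rightarrow> nat \<Rightarrow> complex" where
  "cvel c \<gamma> t = (\<lambda>i. if i < cdim c then vector_derivative (\<lambda>s. cmap c (\<gamma> s) i) (at t) else 0)"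

lemma curve_speed_eq:
  "curve_speed A E \<gamma> t = tangent_length E (chart_at A (\<gamma> t)) (\<gamma> t) (cvel (chart_at A (\<gamma> t)) \<gamma> t)"
  by (simp add: curve_speed_def cvel_def Let_def)

text \<open>The exceptional set of a piecewise C^1 curve is kept explicit, because at its points a
  two-sided derivative may fail to exist.\<close>

definition smooth_off :: "(real \<Rightarrow> 'm) \<Rightarrow> real set \<Rightarrow> bool" where
  "smooth_off \<gamma> S \<longleftrightarrow> pathin M \<gamma> \<and> finite S \<and>
     (\<forall>a b. 0 \<le> a \<and> a < b \<and> b \<le> 1 \<and> {a<..<b} \<inter> S = {} \<longrightarrow> C1_curve_on A \<gamma> a b)"

lemma piecewise_C1_curveE:
  assumes "piecewise_C1_curve M A \<gamma>" obtains S where "smooth_off \<gamma> S"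
  using assms unfolding piecewise_C1_curve_def smooth_off_def by blast

lemma smooth_off_open_preimage:
  assumes "smooth_off \<gamma> S" "openin M U"
  shows "open {t\<in>{0<..<1}. \<gamma> t \<in> U}"
proof -
  have "openin (top_of_set {0..1}) {t \<in> topspace (top_of_set {0..1}). \<gamma> t \<in> U}"
    using assms unfolding smooth_off_def pathin_def by (intro openin_continuous_map_preimage) auto
  then obtain T where T: "open T" "{t \<in> {0..1}. \<gamma> t \<in> U} = {0..1} \<inter> T"
    by (auto simp: openin_open)
  have "{t\<in>{0<..<1}. \<gamma> t \<in> U} = {0<..<1} \<inter> T" using T(2) by fastforce
  then show ?thesis using open_Int[OF open_greaterThanLessThan T(1)] by simp
qed

text \<open>The derivative in \<open>C1_curve_on\<close> is relative to the times spent in the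
  chart; around an interior time these contain a neighbourhood, which makes it two-sided.\<close>

lemma C1_curve_derivative:
  assumes C1: "C1_curve_on A \<gamma> a b" and t: "t \<in> {a<..<b}" and ab: "0 \<le> a" "b \<le> 1"
    and sm: "smooth_off \<gamma> S" and c: "c \<in> A" "\<gamma> t \<in> cdom c" "i < cdim c"
    and D: "((\<lambda>s. cmap c (\<gamma> s) i) has_vector_derivative D) (at t within {t\<in>{a..b}. \<gamma> t \<in> cdom c})"
  shows "((\<lambda>s. cmap c (\<gamma> s) i) has_vector_derivative D) (at t)"
proof -
  define T where "T = {t\<in>{0<..<1}. \<gamma> t \<in> cdom c} \<inter> {a<..<b}"
  have T: "open T" unfolding T_def
    using smooth_off_open_preimage[OF sm openin_cdom[OF c(1)]] by (intro open_Int) auto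
  have "t \<in> T" using t ab c by (auto simp: T_def)
  moreover have "T \<subseteq> {t\<in>{a..b}. \<gamma> t \<in> cdom c}" by (auto simp: T_def)
  ultimately show ?thesis
    using has_vector_derivative_within_subset[OF D] at_within_open[OF _ T] by metis
qed

lemma smooth_off_derivative:
  assumes sm: "smooth_off \<gamma> S" and t: "t \<in> {0<..<1} - S" and c: "c \<in> A" "\<gamma> t \<in> cdom c" "i < cdim c"
  shows "((\<lambda>s. cmap c (\<gamma> s) i) has_vector_derivative cvel c \<gamma> t i) (at t)"
proof -
  have "open ({0<..<1} - S)" using sm by (auto simp: smooth_off_def intro!: open_Diff finite_imp_closed)
  then obtain e where e: "e > 0" "cball t e \<subseteq> {0<..<1} - S" using t open_contains_cball by blast
  define a b where "a = t - e" and "b = t + e"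
  have cb: "{a..b} \<subseteq> {0<..<1} - S" using e(2) by (simp add: a_def b_def cball_eq_atLeastAtMost)
  have ab: "0 \<le> a" "a < b" "b \<le> 1" 
    using subsetD[OF cb, of a] subsetD[OF cb, of b] e(1) by (auto simp: a_def b_def)
  have "{a<..<b} \<inter> S = {}" using cb by (auto simp: subset_iff)
  then have C1: "C1_curve_on A \<gamma> a b" using sm ab by (simp add: smooth_off_def)
  moreover have "t \<in> {t\<in>{a..b}. \<gamma> t \<in> cdom c}" using e c by (auto simp: a_def b_def)
  ultimately obtain D where D: "((\<lambda>s. cmap c (\<gamma> s) i) has_vector_derivative D)
      (at t within {t\<in>{a..b}. \<gamma> t \<in> cdom c})"
    using c unfolding C1_curve_on_def by meson
  have "((\<lambda>s. cmap c (\<gamma> s) i) has_vector_derivative D) (at t)"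
    by (rule C1_curve_derivative[OF C1 _ ab(1,3) sm c D]) (use e in \<open>auto simp: a_def b_def\<close>)
  then show ?thesis using c by (simp add: cvel_def vector_derivative_at)
qed

lemma cvel_in_ztangent:
  assumes sm: "smooth_off \<gamma> S" and t: "t \<in> {0<..<1} - S" and c: "c \<in> A" "\<gamma> t \<in> cdom c"
  shows "cvel c \<gamma> t \<in> ztangent (cdim c) (cimg c) (cmap c (\<gamma> t))"
proof -
  have "(\<lambda>i. if i < cdim c then 1 *\<^sub>R cvel c \<gamma> t i else 0) \<in> ztangent (cdim c) (cimg c) (cmap c (\<gamma> t))"
  proof (rule ztangent_derivative[where u = "\<lambda>s. cmap c (\<gamma> s)" and S = "{t\<in>{0<..<1}. \<gamma> t \<in> cdom c}"
        and L = "\<lambda>i h. h *\<^sub>R cvel c \<gamma> t i" and h = 1])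
    show "((\<lambda>s. cmap c (\<gamma> s) i) has_derivative (\<lambda>h. h *\<^sub>R cvel c \<gamma> t i)) (at t)" if "i < cdim c" for i
      using smooth_off_derivative[OF assms that] by (simp add: has_vector_derivative_def)
    show "open {t\<in>{0<..<1}. \<gamma> t \<in> cdom c}" by (rule smooth_off_open_preimage[OF sm openin_cdom[OF c(1)]])
  qed (use t c cimg_subset in auto)
  moreover have "(\<lambda>i. if i < cdim c then 1 *\<^sub>R cvel c \<gamma> t i else 0) = cvel c \<gamma> t"
    by (auto simp: cvel_def)
  ultimately show ?thesis by simp
qed

lemma smooth_off_in_topspace: "smooth_off \<gamma> S \<Longrightarrow> t \<in> {0..1} \<Longrightarrow> \<gamma> t \<in> topspace M"
  by (auto simp: smooth_off_def pathin_def continuous_map_def)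

lemma curve_speed_chart:
  assumes sm: "smooth_off \<gamma> S" and t: "t \<in> {0<..<1} - S" and c: "c \<in> A" "\<gamma> t \<in> cdom c"
  shows "curve_speed A E \<gamma> t = tangent_length E c (\<gamma> t) (cvel c \<gamma> t)"
proof -
  define d where "d = chart_at A (\<gamma> t)"
  have d: "d \<in> A" "\<gamma> t \<in> cdom d" using chart_at[of "\<gamma> t"] smooth_off_in_topspace[OF sm, of t] t
    by (auto simp: d_def)
  let ?L = "\<lambda>c i h. h *\<^sub>R cvel c \<gamma> t i"
  have "tangent_length E d (\<gamma> t) (\<lambda>i. if i < cdim d then ?L d i 1 else 0)
      = tangent_length E c (\<gamma> t) (\<lambda>i. if i < cdim c then ?L c i 1 else 0)"
  proof (rule tangent_length_chart_change[OF d(1) c(1), where L = "?L d" and L' = "?L c" and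
        S = "{t\<in>{0<..<1}. \<gamma> t \<in> cdom c} \<inter> {t\<in>{0<..<1}. \<gamma> t \<in> cdom d}"])
    show "open ({t\<in>{0<..<1}. \<gamma> t \<in> cdom c} \<inter> {t\<in>{0<..<1}. \<gamma> t \<in> cdom d})"
      using smooth_off_open_preimage[OF sm] openin_cdom c(1) d(1) by (intro open_Int) auto
    show "((\<lambda>s. cmap c (\<gamma> s) i) has_derivative ?L c i) (at t)" if "i < cdim c" for i
      using smooth_off_derivative[OF sm t c that] by (simp add: has_vector_derivative_def)
    show "((\<lambda>s. cmap d (\<gamma> s) i) has_derivative ?L d i) (at t)" if "i < cdim d" for i
      using smooth_off_derivative[OF sm t d that] by (simp add: has_vector_derivative_def)
  qed (use t c d in auto)
  moreover have "(\<lambda>i. if i < cdim d then ?L d i 1 else 0) = cvel d \<gamma> t"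
    "(\<lambda>i. if i < cdim c then ?L c i 1 else 0) = cvel c \<gamma> t"
    by (auto simp: cvel_def)
  ultimately show ?thesis by (simp add: curve_speed_eq d_def)
qed

lemma curve_speed_nonneg:
  assumes sm: "smooth_off \<gamma> S" and t: "t \<in> {0<..<1} - S"
  shows "0 \<le> curve_speed A E \<gamma> t"
proof -
  have d: "chart_at A (\<gamma> t) \<in> A" "\<gamma> t \<in> cdom (chart_at A (\<gamma> t))"
    using chart_at[of "\<gamma> t"] smooth_off_in_topspace[OF sm, of t] t by auto
  then show ?thesis
    using tangent_length_nonneg[OF d cvel_in_ztangent[OF assms d]] by (simp add: curve_speed_eq)
qed

text \<open>\<open>curve_speed\<close> changes charts by choice along the curve, but inside one good
  chart it agrees off the end points with the continuous \<open>\<sigma>\<close>, built from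
  derivatives that extend to the ends.\<close>

lemma curve_speed_integrable_piece:
  assumes sm: "smooth_off \<gamma> S" and g: "good_chart c x R m G"
    and ab: "0 \<le> a" "b \<le> 1" "{a<..<b} \<inter> S = {}" and img: "\<gamma> ` {a..b} \<subseteq> cnbhd c x R"
  shows "curve_speed A E \<gamma> integrable_on {a..b}"
proof (cases "a < b")
  case False
  then have "{a..b} = {} \<or> {a..b} = {a}" by auto
  then show ?thesis using integrable_on_refl[of "curve_speed A E \<gamma>" a] by auto
next
  case True
  have cA: "c \<in> A" using good_chartD(1)[OF g] .
  have C1: "C1_curve_on A \<gamma> a b" using sm ab True by (simp add: smooth_off_def)
  have dom: "{t\<in>{a..b}. \<gamma> t \<in> cdom c} = {a..b}" using img by (auto simp: cnbhd_def)
  have "\<forall>i<cdim c. \<exists>D. continuous_on {a..b} D \<and>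
      (\<forall>t\<in>{a..b}. ((\<lambda>s. cmap c (\<gamma> s) i) has_vector_derivative D t) (at t within {a..b}))"
    using C1[unfolded C1_curve_on_def, rule_format, OF cA] unfolding dom by blast
  then obtain D where D: "\<And>i. i < cdim c \<Longrightarrow> continuous_on {a..b} (D i)"
    "\<And>i t. i < cdim c \<Longrightarrow> t \<in> {a..b} \<Longrightarrow>
      ((\<lambda>s. cmap c (\<gamma> s) i) has_vector_derivative D i t) (at t within {a..b})"
    by metis
  have path: "continuous_map (top_of_set {a..b}) (subtopology M (cnbhd c x R)) \<gamma>"
  proof -
    have "continuous_map (top_of_set {0..1}) M \<gamma>" using sm by (simp add: smooth_off_def pathin_def)
    then have "continuous_map (top_of_set {a..b}) M \<gamma>"
      by (rule continuous_map_from_subtopology_mono) (use ab in auto)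
    then show ?thesis using img by (auto simp: continuous_map_in_subtopology)
  qed
  have G: "continuous_on {a..b} (\<lambda>t. G (\<gamma> t) i j)" if "i < cdim c" "j < cdim c" for i j
    using continuous_map_compose[OF path good_chartD(8)[OF g that]] by (simp add: o_def)
  define \<sigma> where "\<sigma> = (\<lambda>t. sqrt (Re (hform (cdim c) (G (\<gamma> t)) (\<lambda>i. D i t) (\<lambda>i. D i t))))"
  have "continuous_on {a..b} \<sigma>"
    unfolding \<sigma>_def hform_def by (intro continuous_intros G D(1)) auto
  then have "\<sigma> integrable_on {a..b}" by (rule integrable_continuous_real)
  moreover have "curve_speed A E \<gamma> t = \<sigma> t" if t: "t \<in> {a..b} - {a, b}" for t
  proof -
    have t1: "t \<in> {a..b}" "t \<in> {a<..<b}" using t by auto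
    then have t2: "t \<in> {0<..<1} - S" using ab by auto
    have "\<gamma> t \<in> cnbhd c x R" using img t1(1) by blast
    then have ct: "\<gamma> t \<in> cdom c" "\<gamma> t \<in> cnbhd c x R" by (simp_all add: cnbhd_def)
    have "cvel c \<gamma> t i = D i t" if i: "i < cdim c" for i
    proof -
      have "((\<lambda>s. cmap c (\<gamma> s) i) has_vector_derivative D i t) (at t)"
        by (rule C1_curve_derivative[OF C1 t1(2) ab(1,2) sm cA ct(1) i, unfolded dom])
          (rule D(2)[OF i t1(1)])
      then show ?thesis using i by (simp add: cvel_def vector_derivative_at)
    qed
    then have "hform (cdim c) (G (\<gamma> t)) (cvel c \<gamma> t) (cvel c \<gamma> t)
        = hform (cdim c) (G (\<gamma> t)) (\<lambda>i. D i t) (\<lambda>i. D i t)"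
      by (simp add: hform_def)
    then show ?thesis
      using curve_speed_chart[OF sm t2 cA ct(1)] good_chartD(6)[OF g ct(2) cvel_in_ztangent[OF sm t2 cA ct(1)]]
      by (simp add: tangent_length_def \<sigma>_def)
  qed
  ultimately show ?thesis
    using integrable_spike_finite[of "{a, b}" "{a..b}" "curve_speed A E \<gamma>" \<sigma>] by simp
qed

text \<open>A non-integrable speed would have the default \<open>0\<close> as its
  \<open>integral\<close>, so every estimate of lengths depends on this. It is enough to treat short
  intervals, which the curve maps into one chart.\<close>

lemma curve_speed_integrable:
  assumes sm: "smooth_off \<gamma> S"
  shows "curve_speed A E \<gamma> integrable_on {0..1}"
proof -
  have "\<exists>d>0. \<forall>u v. t \<in> cbox u v \<and> cbox u v \<subseteq> ball t d \<and> cbox u v \<subseteq> cbox 0 1 \<longrightarrow>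
    curve_speed A E \<gamma> integrable_on cbox u v" if t: "t \<in> cbox 0 1" for t
  proof -
    obtain c R m G where g: "good_chart c (\<gamma> t) R m G"
      using good_chart_exists'[OF smooth_off_in_topspace[OF sm]] t by (metis box_real(2))
    obtain V where V: "openin M V" "V \<subseteq> cnbhd c (\<gamma> t) R" "\<gamma> t \<in> V"
      by (rule good_chart_interior[OF g]) blast
    have "openin (top_of_set {0..1}) {s \<in> topspace (top_of_set {0..1}). \<gamma> s \<in> V}"
      using sm V(1) unfolding smooth_off_def pathin_def by (intro openin_continuous_map_preimage) auto
    then obtain e where e: "e > 0" "\<And>s. s \<in> {0..1} \<Longrightarrow> dist s t < e \<Longrightarrow> \<gamma> s \<in> V"
      using t V(3) unfolding openin_euclidean_subtopology_iff by force
    \<comment> \<open>Keeps every exceptional time except possibly \<open>t\<close> itself out of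
      the interval, which is then cut at \<open>t\<close>.\<close>
    obtain e' where e': "e' > 0" "\<forall>s\<in>S. s \<noteq> t \<longrightarrow> e' \<le> dist t s"
      using finite_set_avoid[of S t] sm by (auto simp: smooth_off_def)
    show ?thesis
    proof (intro exI[of _ "min e e'"] conjI allI impI)
      show "min e e' > 0" using e e' by simp
      fix u v assume "t \<in> cbox u v \<and> cbox u v \<subseteq> ball t (min e e') \<and> cbox u v \<subseteq> cbox 0 1"
      then have uv: "u \<le> t" "t \<le> v" "{u..v} \<subseteq> ball t e" "{u..v} \<subseteq> ball t e'" "{u..v} \<subseteq> {0..1}" by auto
      then have uv01: "0 \<le> u" "v \<le> 1" by auto
      have img: "\<gamma> s \<in> cnbhd c (\<gamma> t) R" if "s \<in> {u..v}" for s
        using e(2)[of s] uv that V(2) by (auto simp: dist_commute subset_iff)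
      have av: "s \<notin> S" if "s \<in> {u..v}" "s \<noteq> t" for s
        using e'(2) uv(4) that by (force simp: subset_iff)
      have "curve_speed A E \<gamma> integrable_on {u..t}"
        by (rule curve_speed_integrable_piece[OF sm g uv01(1)]) (use img av uv uv01 in auto)
      moreover have "curve_speed A E \<gamma> integrable_on {t..v}"
        by (rule curve_speed_integrable_piece[OF sm g _ uv01(2)]) (use img av uv uv01 in auto)
      ultimately have "curve_speed A E \<gamma> integrable_on {u..v}"
        by (rule Henstock_Kurzweil_Integration.integrable_combine[OF uv(1,2)])
      then show "curve_speed A E \<gamma> integrable_on cbox u v" by simp
    qed
  qed
  then show ?thesis using integrable_on_little_subintervals[of 0 1 "curve_speed A E \<gamma>"] by simp
qed

text \<open>The fundamental theorem of calculus for one coordinate, whose derivative is at most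
  \<open>1 / m\<close> times the speed. Only the final stretch from \<open>a\<close> has to lie in
  the chart; the rest of the curve adds nonnegative length.\<close>

lemma coord_diff_le_length:
  assumes sm: "smooth_off \<gamma> S" and g: "good_chart c x R m G"
    and a: "0 \<le> a" "a \<le> 1" and img: "\<gamma> ` {a..1} \<subseteq> cnbhd c x R" and i: "i < cdim c"
  shows "m * cmod (cmap c (\<gamma> 1) i - cmap c (\<gamma> a) i) \<le> integral {0..1} (curve_speed A E \<gamma>)"
proof -
  \<comment> \<open>At these finitely many times the two-sided derivatives may be default values.
    Setting the integrands to \<open>0\<close> there changes no integral and makes the speed
    nonnegative on all of \<open>{0..1}\<close>.\<close>
  define T where "T = insert 0 (insert 1 S)"
  have T: "finite T" using sm by (simp add: T_def smooth_off_def)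
  have m: "m > 0" and cA: "c \<in> A" using good_chartD[OF g] by auto
  define \<sigma> where "\<sigma> = (\<lambda>t. if t \<in> T then 0 else curve_speed A E \<gamma> t)"
  have \<sigma>int: "\<sigma> integrable_on {0..1}"
    by (rule integrable_spike_finite[OF T _ curve_speed_integrable[OF sm]]) (auto simp: \<sigma>_def)
  have \<sigma>eq: "integral {0..1} (curve_speed A E \<gamma>) = integral {0..1} \<sigma>"
    by (rule integral_spike[OF negligible_finite[OF T]]) (auto simp: \<sigma>_def)
  have \<sigma>0: "\<sigma> t \<ge> 0" if "t \<in> {0..1}" for t
    using that curve_speed_nonneg[OF sm, of t] by (auto simp: \<sigma>_def T_def)
  have \<sigma>inta: "\<sigma> integrable_on {a..1}"
    using a by (intro integrable_subinterval_real[OF \<sigma>int]) auto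
  define v where "v = (\<lambda>t. if t \<in> T then 0 else cvel c \<gamma> t i)"
  have dom: "\<gamma> t \<in> cdom c" if "t \<in> {a..1}" for t
    using img that unfolding cnbhd_def by blast
  have "continuous_map (top_of_set {a..1}) M \<gamma>"
  proof -
    have "continuous_map (top_of_set {0..1}) M \<gamma>" using sm by (simp add: smooth_off_def pathin_def)
    then show ?thesis by (rule continuous_map_from_subtopology_mono) (use a in auto)
  qed
  then have "continuous_map (top_of_set {a..1}) (subtopology M (cdom c)) \<gamma>"
    using dom by (auto simp: continuous_map_in_subtopology)
  from continuous_map_compose[OF this continuous_map_coord[OF cA, of i]]
  have cont: "continuous_on {a..1} (\<lambda>t. cmap c (\<gamma> t) i)" by (simp add: o_def)
  have "(v has_integral (cmap c (\<gamma> 1) i - cmap c (\<gamma> a) i)) {a..1}"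
  proof (rule fundamental_theorem_of_calculus_interior_strong[OF T a(2) _ cont])
    fix t assume t: "t \<in> {a<..<1} - T"
    then have "t \<in> {0<..<1} - S" "\<gamma> t \<in> cdom c" using a dom by (auto simp: T_def)
    then show "((\<lambda>t. cmap c (\<gamma> t) i) has_vector_derivative v t) (at t)"
      using smooth_off_derivative[OF sm _ cA _ i] t by (simp add: v_def)
  qed
  then have v: "v integrable_on {a..1}" "integral {a..1} v = cmap c (\<gamma> 1) i - cmap c (\<gamma> a) i"
    by (auto simp: has_integral_integrable_integral)
  have "norm (v t) \<le> \<sigma> t / m" if t: "t \<in> {a..1}" for t
  proof (cases "t \<in> T")
    case False
    then have t': "t \<in> {0<..<1} - S" using a t by (auto simp: T_def)
    have "m * cmod (cvel c \<gamma> t i) \<le> tangent_length E c (\<gamma> t) (cvel c \<gamma> t)"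
      using img t by (intro tangent_length_ge[OF g _ cvel_in_ztangent[OF sm t' cA dom[OF t]] i]) auto
    then show ?thesis
      using False m curve_speed_chart[OF sm t' cA dom[OF t]] by (simp add: v_def \<sigma>_def field_simps)
  qed (simp add: v_def \<sigma>_def)
  then have "norm (integral {a..1} v) \<le> integral {a..1} (\<lambda>t. \<sigma> t / m)"
    using \<sigma>inta by (intro integral_norm_bound_integral v integrable_on_divide) auto
  also have "\<dots> = integral {a..1} \<sigma> / m" by simp
  also have "\<dots> \<le> integral {0..1} \<sigma> / m"
    using m a \<sigma>0 by (intro divide_right_mono integral_subset_le \<sigma>int \<sigma>inta) auto
  finally show ?thesis using m v(2) \<sigma>eq by (simp add: field_simps)
qed

text \<open>Followed from \<open>x\<close>, a curve shorter than \<open>m * s\<close> cannot carry a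
  coordinate further than \<open>s\<close>, so it never leaves the polydisc.\<close>

lemma herm_dist_less_imp_cnbhd:
  assumes g: "good_chart c x R m G" and s: "0 < s" "s < R"
    and d: "herm_dist M A E y x < ennreal (m * s)"
  shows "y \<in> cnbhd c x s"
proof -
  obtain \<gamma> where \<gamma>: "piecewise_C1_curve M A \<gamma>" "\<gamma> 0 = y" "\<gamma> 1 = x"
    "ennreal (integral {0..1} (curve_speed A E \<gamma>)) < ennreal (m * s)"
    using d unfolding herm_dist_def by (auto simp: INF_less_iff)
  have int: "integral {0..1} (curve_speed A E \<gamma>) \<le> m * s"
    using \<gamma>(4) by (meson ennreal_leI leD le_less_linear less_imp_le)
  obtain S where sm: "smooth_off \<gamma> S" using piecewise_C1_curveE[OF \<gamma>(1)] .
  obtain V where V: "openin M V" "V \<subseteq> cnbhd c x R" "x \<in> V" "\<And>r. r < R \<Longrightarrow> cnbhd c x r \<subseteq> V"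
    by (rule good_chart_interior[OF g]) blast
  \<comment> \<open>Run backwards, since the good chart is centred at the end point \<open>x\<close>
    of \<open>\<gamma>\<close>.\<close>
  have "(\<gamma> \<circ> (\<lambda>t. 1 - t)) ` {0..1} \<subseteq> cnbhd c x s"
  proof (rule path_stays_in_openin[OF _ V(1)])
    have 1: "continuous_map (top_of_set {0..1}) (top_of_set {0..1}) (\<lambda>t::real. 1 - t)"
      by (auto simp: continuous_map_in_subtopology intro!: continuous_intros)
    have 2: "continuous_map (top_of_set {0..1}) M \<gamma>" using sm by (simp add: smooth_off_def pathin_def)
    show "continuous_map (top_of_set {0..1}) M (\<gamma> \<circ> (\<lambda>t. 1 - t))"
      by (rule continuous_map_compose[OF 1 2])
    show "closedin M (cnbhd c x s)" using good_chart_closedin[OF g] s by simp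
    show "cnbhd c x s \<subseteq> V" using V(4) s by simp
    show "(\<gamma> \<circ> (\<lambda>t. 1 - t)) 0 \<in> V" using V(3) \<gamma> by simp
    fix t :: real assume t: "0 \<le> t" "t \<le> 1" and tV: "(\<gamma> \<circ> (\<lambda>t. 1 - t)) ` {0..t} \<subseteq> V"
    have img: "\<gamma> u \<in> cnbhd c x R" if "u \<in> {1 - t..1}" for u
    proof -
      have "(\<gamma> \<circ> (\<lambda>t. 1 - t)) (1 - u) \<in> V" using tV that by (intro subsetD[OF tV] imageI) auto
      then show ?thesis using V(2) by auto
    qed
    have "cmod (cmap c (\<gamma> (1 - t)) i - cmap c x i) \<le> s" if i: "i < cdim c" for i
    proof -
      have "m * cmod (cmap c (\<gamma> 1) i - cmap c (\<gamma> (1 - t)) i) \<le> m * s"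
        by (rule order_trans[OF coord_diff_le_length[OF sm g _ _ _ i] int]) (use t img in auto)
      then show ?thesis using good_chartD(4)[OF g] \<gamma>(3) by (simp add: norm_minus_commute)
    qed
    then show "(\<gamma> \<circ> (\<lambda>t. 1 - t)) t \<in> cnbhd c x s"
      using img[of "1 - t"] t by (auto simp: cnbhd_def)
  qed
  then have "(\<gamma> \<circ> (\<lambda>t. 1 - t)) 1 \<in> cnbhd c x s" by (rule subsetD) (rule image_eqI[of _ _ 1], auto)
  then show ?thesis using \<gamma> by simp
qed

text \<open>The image of the segment is an admissible curve: holomorphic coordinates have continuous
  derivatives, so it is C^1 in every chart, and its speed is \<open>cmod (w2 - w1)\<close> times
  \<open>hspeed\<close>.\<close>

lemma herm_dist_hol_segment:
  assumes f: "hol_on M A D f" "open D" and seg: "closed_segment w1 w2 \<subseteq> D"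
    and speed: "\<And>z. z \<in> closed_segment w1 w2 \<Longrightarrow> hspeed A E f z \<le> C"
  shows "herm_dist M A E (f w1) (f w2) \<le> ennreal (C * dist w1 w2)"
proof -
  define p where "p = (\<lambda>t::real. w1 + of_real t * (w2 - w1))"
  define \<gamma> where "\<gamma> = (\<lambda>t. f (p t))"
  have ps: "p t \<in> closed_segment w1 w2" if "t \<in> {0..1}" for t
    using that by (auto simp: p_def closed_segment_def scaleR_conv_of_real algebra_simps)
  have pD: "p t \<in> D" if "t \<in> {0..1}" for t using ps[OF that] seg by blast
  have dp: "(p has_vector_derivative (w2 - w1)) (at t within T)" for t T
    unfolding p_def by (auto intro!: derivative_eq_intros)
  have der: "((\<lambda>s. cmap c (\<gamma> s) i) has_vector_derivative (w2 - w1) * hvel c f (p t) i) (at t within T)"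
    if "t \<in> {0..1}" "c \<in> A" "\<gamma> t \<in> cdom c" "i < cdim c" for t T c i
  proof -
    have "((\<lambda>w. cmap c (f w) i) has_field_derivative hvel c f (p t) i) (at (p t) within p ` T)"
      using hol_on_coord_derivative[OF f pD[OF that(1)] that(2) _ that(4)] that(3)
      by (auto simp: \<gamma>_def intro: has_field_derivative_at_within)
    from field_vector_diff_chain_within[OF dp this] show ?thesis by (simp add: o_def \<gamma>_def)
  qed
  have contp: "continuous_on T p" for T unfolding p_def by (intro continuous_intros)
  have path: "pathin M \<gamma>"
  proof -
    have 1: "continuous_map (top_of_set {0..1}) (top_of_set D) p"
      using pD contp by (auto simp: continuous_map_in_subtopology)
    have 2: "continuous_map (top_of_set D) M f" using f(1) by (simp add: hol_on_def)
    show ?thesis unfolding pathin_def \<gamma>_def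
      using continuous_map_compose[OF 1 2] by (simp add: o_def)
  qed
  have "C1_curve_on A \<gamma> a b" if "0 \<le> a" "b \<le> 1" for a b
    unfolding C1_curve_on_def
  proof (intro ballI allI impI)
    fix c i assume c: "c \<in> A" "i < cdim c"
    let ?T = "{t\<in>{a..b}. \<gamma> t \<in> cdom c}"
    have op: "open {z\<in>D. f z \<in> cdom c}" by (rule hol_on_open_preimage[OF f openin_cdom[OF c(1)]])
    have "(\<lambda>z. cmap c (f z) i) holomorphic_on {z\<in>D. f z \<in> cdom c}"
      using f(1) c by (auto simp: hol_on_def)
    then have "continuous_on {z\<in>D. f z \<in> cdom c} (deriv (\<lambda>z. cmap c (f z) i))"
      by (intro holomorphic_on_imp_continuous_on holomorphic_deriv op)
    then have "continuous_on ?T (\<lambda>t. deriv (\<lambda>z. cmap c (f z) i) (p t))"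
      by (rule continuous_on_compose2[OF _ contp]) (use pD that in \<open>auto simp: \<gamma>_def\<close>)
    then have "continuous_on ?T (\<lambda>t. (w2 - w1) * hvel c f (p t) i)"
      using c(2) by (auto simp: hvel_def intro!: continuous_intros)
    moreover have "\<forall>t\<in>?T. ((\<lambda>s. cmap c (\<gamma> s) i) has_vector_derivative (w2 - w1) * hvel c f (p t) i)
        (at t within ?T)"
      using der c that by auto
    ultimately show "\<exists>D. continuous_on ?T D \<and>
        (\<forall>t\<in>?T. ((\<lambda>s. cmap c (\<gamma> s) i) has_vector_derivative D t) (at t within ?T))"
      by blast
  qed
  then have pw: "piecewise_C1_curve M A \<gamma>"
    using path unfolding piecewise_C1_curve_def by (intro conjI exI[of _ "{}"]) auto
  have sp: "curve_speed A E \<gamma> t \<le> C * dist w1 w2" if t: "t \<in> {0..1}" for t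
  proof -
    define d where "d = chart_at A (f (p t))"
    have gt: "\<gamma> t = f (p t)" by (simp add: \<gamma>_def)
    have d: "d \<in> A" "f (p t) \<in> cdom d"
      using chart_at[OF hol_on_in_topspace[OF f(1) pD[OF t]]] by (auto simp: d_def)
    have "cvel d \<gamma> t = (\<lambda>i. (w2 - w1) * hvel d f (p t) i)"
      using vector_derivative_at[OF der[OF t d(1) d(2)[folded gt]]] by (auto simp: cvel_def hvel_def)
    then have "curve_speed A E \<gamma> t = cmod (w2 - w1) * tangent_length E d (f (p t)) (hvel d f (p t))"
      using tangent_length_scale[OF d hvel_in_ztangent[OF f pD[OF t] d]]
      by (simp add: curve_speed_eq gt flip: d_def)
    also have "\<dots> = cmod (w2 - w1) * hspeed A E f (p t)" by (simp add: hspeed_def d_def)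
    also have "\<dots> \<le> cmod (w2 - w1) * C" by (intro mult_left_mono speed ps t) auto
    finally show ?thesis by (simp add: dist_norm norm_minus_commute mult.commute)
  qed
  have "integral {0..1} (curve_speed A E \<gamma>) \<le> integral {0..1} (\<lambda>t::real. C * dist w1 w2)"
  proof (rule integral_le)
    show "curve_speed A E \<gamma> integrable_on {0..1}"
      using piecewise_C1_curveE[OF pw] curve_speed_integrable by blast
  qed (use sp in auto)
  then have "ennreal (integral {0..1} (curve_speed A E \<gamma>)) \<le> ennreal (C * dist w1 w2)"
    by (intro ennreal_leI) simp
  moreover have "\<gamma> 0 = f w1" "\<gamma> 1 = f w2" by (auto simp: \<gamma>_def p_def)
  ultimately show ?thesis unfolding herm_dist_def using pw
    by (intro INF_lower2[of \<gamma>]) auto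
qed

subsection \<open>Limits of holomorphic maps of bounded speed\<close>

lemma eventually_in_cnbhd:
  assumes "limitin M h x F" "c \<in> A" "x \<in> cdom c" "r > 0"
  shows "eventually (\<lambda>s. h s \<in> cnbhd c x r) F"
proof -
  have "eventually (\<lambda>s. h s \<in> {y\<in>cdom c. \<forall>i<cdim c. cmod (cmap c y i - cmap c x i) < r}) F"
    by (rule limitinD[OF assms(1) openin_cball_chart[OF assms(2)]]) (use assms in auto)
  then show ?thesis by eventually_elim (auto simp: cnbhd_def less_imp_le)
qed

text \<open>Base point and vector vary together. In a good chart the length of tangent vectors is a
  continuous expression in the Gram matrix and the components. This serves both the continuity of
  the speed and its limit along a filter.\<close>

lemma tangent_length_tendsto:
  assumes c: "c \<in> A" "x \<in> cdom c" and h: "limitin M h x F"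
    and v: "\<And>i. i < cdim c \<Longrightarrow> ((\<lambda>s. v s i) \<longlongrightarrow> v0 i) F"
    and tan: "eventually (\<lambda>s. v s \<in> ztangent (cdim c) (cimg c) (cmap c (h s))) F"
      "v0 \<in> ztangent (cdim c) (cimg c) (cmap c x)"
  shows "((\<lambda>s. tangent_length E c (h s) (v s)) \<longlongrightarrow> tangent_length E c x v0) F"
proof -
  obtain R m G where g: "good_chart c x R m G"
    using good_chart_exists[OF c openin_cdom[OF c(1)] c(2)] by blast
  have R: "R > 0" by (rule good_chartD(3)[OF g])
  have x: "x \<in> cnbhd c x R" using center_in_cnbhd[OF g] R by simp
  have ev: "eventually (\<lambda>s. h s \<in> cnbhd c x R) F" by (rule eventually_in_cnbhd[OF h c R])
  have "limitin (subtopology M (cnbhd c x R)) h x F"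
    using h ev x by (simp add: limitin_subtopology)
  then have "((\<lambda>s. G (h s) i j) \<longlongrightarrow> G x i j) F" if "i < cdim c" "j < cdim c" for i j
    using continuous_map_limit[OF good_chartD(8)[OF g that]] by (simp add: o_def)
  then have "((\<lambda>s. hform (cdim c) (G (h s)) (v s) (v s)) \<longlongrightarrow> hform (cdim c) (G x) v0 v0) F"
    by (intro hform_tendsto v) auto
  then have "((\<lambda>s. sqrt (Re (hform (cdim c) (G (h s)) (v s) (v s))))
      \<longlongrightarrow> sqrt (Re (hform (cdim c) (G x) v0 v0))) F"
    by (intro tendsto_real_sqrt tendsto_Re)
  then have "((\<lambda>s. sqrt (Re (hform (cdim c) (G (h s)) (v s) (v s))))
      \<longlongrightarrow> tangent_length E c x v0) F"
    using good_chartD(6)[OF g x tan(2)] by (simp add: tangent_length_def)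
  moreover have "eventually (\<lambda>s. sqrt (Re (hform (cdim c) (G (h s)) (v s) (v s)))
      = tangent_length E c (h s) (v s)) F"
    using ev tan(1) by eventually_elim (use good_chartD(6)[OF g] in \<open>simp add: tangent_length_def\<close>)
  ultimately show ?thesis by (rule Lim_transform_eventually)
qed

lemma hol_on_limitin:
  assumes f: "hol_on M A D f" "open D" "z \<in> D"
  shows "limitin M f (f z) (at z)"
  unfolding limitin_def
proof (intro conjI allI impI)
  show "f z \<in> topspace M" by (rule hol_on_in_topspace[OF f(1,3)])
  fix U assume U: "openin M U \<and> f z \<in> U"
  then have "eventually (\<lambda>w. w \<in> {w\<in>D. f w \<in> U}) (nhds z)"
    using hol_on_open_preimage[OF f(1,2), of U] f(3) by (intro eventually_nhds_in_open) auto
  then show "eventually (\<lambda>w. f w \<in> U) (at z)" by (simp add: eventually_at_filter eventually_mono)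
qed

lemma continuous_on_hspeed:
  assumes f: "hol_on M A D f" "open D"
  shows "continuous_on D (hspeed A E f)"
proof (rule continuous_at_imp_continuous_on, intro ballI)
  fix z assume z: "z \<in> D"
  \<comment> \<open>One chart for all \<open>w\<close> near \<open>z\<close>, in place of the chart
    chosen at each \<open>f w\<close>.\<close>
  define c where "c = chart_at A (f z)"
  have c: "c \<in> A" "f z \<in> cdom c" using chart_at[OF hol_on_in_topspace[OF f(1) z]] by (auto simp: c_def)
  have op: "open {w\<in>D. f w \<in> cdom c}" by (rule hol_on_open_preimage[OF f openin_cdom[OF c(1)]])
  then have "eventually (\<lambda>w. w \<in> {w\<in>D. f w \<in> cdom c}) (nhds z)"
    using z c by (intro eventually_nhds_in_open) auto
  then have ev: "eventually (\<lambda>w. w \<in> {w\<in>D. f w \<in> cdom c}) (at z)"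
    by (simp add: eventually_at_filter eventually_mono)
  have "((\<lambda>w. tangent_length E c (f w) (hvel c f w)) \<longlongrightarrow> tangent_length E c (f z) (hvel c f z)) (at z)"
  proof (rule tangent_length_tendsto[OF c hol_on_limitin[OF f z]])
    show "((\<lambda>w. hvel c f w i) \<longlongrightarrow> hvel c f z i) (at z)" if i: "i < cdim c" for i
    proof -
      have "(\<lambda>z. cmap c (f z) i) holomorphic_on {z\<in>D. f z \<in> cdom c}"
        using f(1) c i by (auto simp: hol_on_def)
      then have "continuous_on {z\<in>D. f z \<in> cdom c} (deriv (\<lambda>z. cmap c (f z) i))"
        by (intro holomorphic_on_imp_continuous_on holomorphic_deriv op)
      then have "isCont (deriv (\<lambda>z. cmap c (f z) i)) z"
        using op z c by (simp add: continuous_on_eq_continuous_at)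
      then show ?thesis using i by (simp add: hvel_def isCont_def)
    qed
    show "eventually (\<lambda>w. hvel c f w \<in> ztangent (cdim c) (cimg c) (cmap c (f w))) (at z)"
      using ev by eventually_elim (use hvel_in_ztangent[OF f _ c(1)] in auto)
  qed (rule hvel_in_ztangent[OF f z c])
  moreover have "eventually (\<lambda>w. tangent_length E c (f w) (hvel c f w) = hspeed A E f w) (at z)"
    using ev by eventually_elim (use hspeed_chart[OF f _ c(1)] in auto)
  ultimately show "isCont (hspeed A E f) z"
    unfolding isCont_def hspeed_chart[OF f z c] by (rule Lim_transform_eventually)
qed

text \<open>Holomorphy, too, is asked only eventually and on a disc, because rescaled maps live on
  growing domains. The index type is arbitrary so that a family can be indexed by itself.\<close>

definition locally_bounded_speed :: "complex set \<Rightarrow> ('i \<Rightarrow> complex \<Rightarrow> 'm) \<Rightarrow> 'i filter \<Rightarrow> bool" where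
  "locally_bounded_speed D g F \<longleftrightarrow> (\<forall>z\<in>D. \<exists>\<delta>>0. \<exists>C\<ge>0. ball z \<delta> \<subseteq> D \<and>
     eventually (\<lambda>j. hol_on M A (ball z \<delta>) (g j) \<and> (\<forall>w\<in>ball z \<delta>. hspeed A E (g j) w \<le> C)) F)"

text \<open>Across a sufficiently small disc, speed \<open>C\<close> moves a coordinate by at most
  \<open>r / 2\<close>. One value in the half polydisc then traps the whole disc, with a radius
  valid for almost all indices at once.\<close>

lemma speed_bound_limit_local:
  assumes bd: "locally_bounded_speed D g F" and z0: "z0 \<in> D"
    and gc: "good_chart c x R m G" and r: "0 < r" "r < R"
  obtains \<delta> C where "\<delta> > 0" "C \<ge> 0" "ball z0 \<delta> \<subseteq> D"
    "eventually (\<lambda>j. hol_on M A (ball z0 \<delta>) (g j) \<and> (\<forall>w\<in>ball z0 \<delta>. hspeed A E (g j) w \<le> C) \<and>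
       (\<forall>w\<in>ball z0 \<delta>. g j w \<in> cnbhd c x (r / 2) \<longrightarrow> (\<forall>v\<in>ball z0 \<delta>. g j v \<in> cnbhd c x r))) F"
proof -
  obtain \<delta>1 C where \<delta>1: "\<delta>1 > 0" "C \<ge> 0" "ball z0 \<delta>1 \<subseteq> D"
    and ev: "eventually (\<lambda>j. hol_on M A (ball z0 \<delta>1) (g j) \<and> (\<forall>w\<in>ball z0 \<delta>1. hspeed A E (g j) w \<le> C)) F"
    using bd z0 unfolding locally_bounded_speed_def by blast
  have m: "m > 0" by (rule good_chartD(4)[OF gc])
  \<comment> \<open>Moving a coordinate by \<open>r / 2\<close> takes at least this much
    length.\<close>
  define Q where "Q = m * (r / 2)"
  have Q: "Q > 0" using m r by (simp add: Q_def)
  \<comment> \<open>\<open>C + 1\<close> keeps the quotient defined for \<open>C = 0\<close>. The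
    bound \<open>\<delta>1 / 2\<close> and the halving in \<open>\<delta>\<close> make the
    \<open>\<epsilon>\<close>-disc about any point of the \<open>\<delta>\<close>-disc contain the
    latter and stay where the speed is bounded.\<close>
  define \<epsilon> where "\<epsilon> = min (\<delta>1 / 2) (Q / (C + 1))"
  define \<delta> where "\<delta> = \<epsilon> / 2"
  have \<epsilon>: "\<epsilon> > 0" "2 * \<epsilon> \<le> \<delta>1" using \<delta>1 Q by (auto simp: \<epsilon>_def)
  have "C * \<epsilon> \<le> (C + 1) * (Q / (C + 1))"
    using \<delta>1(2) Q \<epsilon>(1) by (intro mult_mono) (auto simp: \<epsilon>_def)
  also have "\<dots> = Q" using \<delta>1(2) by simp
  finally have C\<epsilon>: "C * \<epsilon> \<le> m * (r / 2)" by (simp add: Q_def)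
  have \<delta>: "\<delta> > 0" "2 * \<delta> = \<epsilon>" using \<epsilon> by (auto simp: \<delta>_def)
  have sub: "ball z0 \<delta> \<subseteq> ball z0 \<delta>1" using \<epsilon> \<delta> by (intro subset_ball) simp
  have sub2: "ball w \<epsilon> \<subseteq> ball z0 \<delta>1" if "w \<in> ball z0 \<delta>" for w
  proof
    fix v assume "v \<in> ball w \<epsilon>"
    then show "v \<in> ball z0 \<delta>1" using dist_triangle[of z0 v w] that \<epsilon> \<delta> by simp
  qed
  show thesis
  proof (rule that[OF \<delta>(1) \<delta>1(2)])
    show "ball z0 \<delta> \<subseteq> D" using sub \<delta>1(3) by (rule order_trans)
    show "eventually (\<lambda>j. hol_on M A (ball z0 \<delta>) (g j) \<and> (\<forall>w\<in>ball z0 \<delta>. hspeed A E (g j) w \<le> C) \<and>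
       (\<forall>w\<in>ball z0 \<delta>. g j w \<in> cnbhd c x (r / 2) \<longrightarrow> (\<forall>v\<in>ball z0 \<delta>. g j v \<in> cnbhd c x r))) F"
      using ev
    proof eventually_elim
      case (elim j)
      have "g j v \<in> cnbhd c x (r / 2 + r / 2)"
        if w: "w \<in> ball z0 \<delta>" "g j w \<in> cnbhd c x (r / 2)" and v: "v \<in> ball z0 \<delta>" for w v
      proof -
        have 1: "hol_on M A (ball z0 \<delta>1) (g j)" using elim by simp
        have 2: "hspeed A E (g j) u \<le> C" if "u \<in> ball w \<epsilon>" for u
          using elim sub2[OF w(1)] that by blast
        have 3: "v \<in> ball w \<epsilon>" using v w(1) dist_triangle3[of w v z0] \<delta> by (simp add: dist_commute)
        show ?thesis
          by (rule hol_stays_in_cnbhd[where f = "g j" and r = "r / 2" and s = "r / 2" and C = C,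
                OF gc 1 open_ball sub2[OF w(1)] 2 \<delta>1(2) C\<epsilon> w(2) _ _ 3])
            (use r in auto)
      qed
      then show ?case using elim hol_on_subset[OF _ sub] sub by auto
    qed
  qed
qed

section \<open>Pointwise limits of maps of bounded speed\<close>

context
  fixes F :: "'i filter" and g :: "'i \<Rightarrow> complex \<Rightarrow> 'm" and f D
  assumes F: "F \<noteq> bot" and D: "open D"
    and pw: "\<And>z. z \<in> D \<Longrightarrow> limitin M (\<lambda>j. g j z) (f z) F"
    and bd: "locally_bounded_speed D g F"
begin

lemma limit_local:
  assumes z0: "z0 \<in> D" and gc: "good_chart c (f z0) R m G" and r: "0 < r" "r < R"
  obtains \<delta> C where "\<delta> > 0" "C \<ge> 0" "ball z0 \<delta> \<subseteq> D"
    "eventually (\<lambda>j. hol_on M A (ball z0 \<delta>) (g j) \<and> (\<forall>w\<in>ball z0 \<delta>. hspeed A E (g j) w \<le> C) \<and>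
       (\<forall>w\<in>ball z0 \<delta>. g j w \<in> cnbhd c (f z0) r)) F"
    "\<And>w. w \<in> ball z0 \<delta> \<Longrightarrow> f w \<in> cnbhd c (f z0) r"
proof -
  obtain \<delta> C where \<delta>: "\<delta> > 0" "C \<ge> 0" "ball z0 \<delta> \<subseteq> D"
    and ev: "eventually (\<lambda>j. hol_on M A (ball z0 \<delta>) (g j) \<and> (\<forall>w\<in>ball z0 \<delta>. hspeed A E (g j) w \<le> C) \<and>
       (\<forall>w\<in>ball z0 \<delta>. g j w \<in> cnbhd c (f z0) (r / 2) \<longrightarrow> (\<forall>v\<in>ball z0 \<delta>. g j v \<in> cnbhd c (f z0) r))) F"
    by (rule speed_bound_limit_local[OF bd z0 gc r]) blast
  have "eventually (\<lambda>j. g j z0 \<in> cnbhd c (f z0) (r / 2)) F"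
    by (rule eventually_in_cnbhd[OF pw[OF z0] good_chartD(1,2)[OF gc]]) (use r in simp)
  with ev have ev': "eventually (\<lambda>j. hol_on M A (ball z0 \<delta>) (g j) \<and> (\<forall>w\<in>ball z0 \<delta>. hspeed A E (g j) w \<le> C) \<and>
       (\<forall>w\<in>ball z0 \<delta>. g j w \<in> cnbhd c (f z0) r)) F"
    by eventually_elim (use \<delta> in auto)
  moreover have "f w \<in> cnbhd c (f z0) r" if w: "w \<in> ball z0 \<delta>" for w
  proof (rule limitin_closedin[OF pw])
    show "w \<in> D" using w \<delta> by blast
    show "closedin M (cnbhd c (f z0) r)" using good_chart_closedin[OF gc] r by simp
    show "eventually (\<lambda>j. g j w \<in> cnbhd c (f z0) r) F"
      using ev' by eventually_elim (use w in blast)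
  qed (rule F)
  ultimately show thesis by (rule that[OF \<delta>])
qed

text \<open>Bounded speed upgrades pointwise convergence: near \<open>z\<close> almost all maps, and
  their limit, stay in one small polydisc inside \<open>U\<close>.\<close>

lemma limit_nbhd:
  assumes z: "z \<in> D" and U: "openin M U" "f z \<in> U"
  obtains \<delta> where "\<delta> > 0" "eventually (\<lambda>j. \<forall>w\<in>ball z \<delta>. g j w \<in> U) F"
    "ball z \<delta> \<subseteq> {w\<in>D. f w \<in> U}"
proof -
  have c: "chart_at A (f z) \<in> A" "f z \<in> cdom (chart_at A (f z))"
    using chart_at[OF limitin_topspace[OF pw[OF z]]] by auto
  obtain R m G where gc: "good_chart (chart_at A (f z)) (f z) R m G" "cnbhd (chart_at A (f z)) (f z) R \<subseteq> U"
    by (rule good_chart_exists[OF c U])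
  have R: "0 < R / 2" "R / 2 < R" using good_chartD(3)[OF gc(1)] by auto
  obtain \<delta> C where \<delta>: "\<delta> > 0" "ball z \<delta> \<subseteq> D" and ev: "eventually (\<lambda>j. hol_on M A (ball z \<delta>) (g j) \<and>
     (\<forall>w\<in>ball z \<delta>. hspeed A E (g j) w \<le> C) \<and>
     (\<forall>w\<in>ball z \<delta>. g j w \<in> cnbhd (chart_at A (f z)) (f z) (R / 2))) F"
    and f: "\<And>w. w \<in> ball z \<delta> \<Longrightarrow> f w \<in> cnbhd (chart_at A (f z)) (f z) (R / 2)"
    by (rule limit_local[OF z gc(1) R]) blast
  have sub: "cnbhd (chart_at A (f z)) (f z) (R / 2) \<subseteq> U"
    using cnbhd_mono[of "R / 2" R] R gc(2) by (metis less_imp_le order_trans)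
  have "eventually (\<lambda>j. \<forall>w\<in>ball z \<delta>. g j w \<in> U) F"
    using ev by eventually_elim (use sub in blast)
  moreover have "ball z \<delta> \<subseteq> {w\<in>D. f w \<in> U}" using \<delta>(2) f sub by blast
  ultimately show thesis by (rule that[OF \<delta>(1)])
qed

lemma limit_compact_open:
  assumes K: "compact K" "K \<subseteq> D" and U: "openin M U" "f ` K \<subseteq> U"
  shows "eventually (\<lambda>j. g j ` K \<subseteq> U) F"
proof -
  have "eventually (\<lambda>j. \<forall>w\<in>K. g j w \<in> U) F"
  proof (rule eventually_ball_compact[OF K(1)])
    fix z assume "z \<in> K"
    then have z: "z \<in> D" "f z \<in> U" using K U by auto
    obtain \<delta> where \<delta>: "\<delta> > 0" "eventually (\<lambda>j. \<forall>w\<in>ball z \<delta>. g j w \<in> U) F"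
      by (rule limit_nbhd[OF z(1) U(1) z(2)])
    have "eventually (\<lambda>j. \<forall>w\<in>ball z \<delta> \<inter> K. g j w \<in> U) F"
      using \<delta>(2) by eventually_elim blast
    with \<delta>(1) show "\<exists>\<delta>>0. eventually (\<lambda>j. \<forall>w\<in>ball z \<delta> \<inter> K. g j w \<in> U) F" by blast
  qed
  then show ?thesis by eventually_elim blast
qed

text \<open>Equicontinuity does the work: the coordinates share the Lipschitz constant
  \<open>C / m\<close>, so convergence at the points of a finite net is uniform. This argument is
  valid along any proper filter, not only along sequences.\<close>

lemma limit_coord_uniform:
  assumes z0: "z0 \<in> D" and c: "c \<in> A" "f z0 \<in> cdom c"
  obtains \<delta> where "\<delta> > 0" "ball z0 \<delta> \<subseteq> D" "\<And>w. w \<in> ball z0 \<delta> \<Longrightarrow> f w \<in> cdom c"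
    "eventually (\<lambda>j. hol_on M A (ball z0 \<delta>) (g j) \<and> (\<forall>w\<in>ball z0 \<delta>. g j w \<in> cdom c)) F"
    "\<And>i. i < cdim c \<Longrightarrow> uniform_limit (cball z0 (\<delta> / 2)) (\<lambda>j w. cmap c (g j w) i) (\<lambda>w. cmap c (f w) i) F"
proof -
  obtain R m G where gc: "good_chart c (f z0) R m G"
    using good_chart_exists[OF c openin_cdom[OF c(1)] c(2)] by blast
  have R: "0 < R / 2" "R / 2 < R" "R / 2 \<le> R" using good_chartD(3)[OF gc] by auto
  have m: "m > 0" by (rule good_chartD(4)[OF gc])
  obtain \<delta> C where \<delta>: "\<delta> > 0" "C \<ge> 0" "ball z0 \<delta> \<subseteq> D"
    and ev: "eventually (\<lambda>j. hol_on M A (ball z0 \<delta>) (g j) \<and> (\<forall>w\<in>ball z0 \<delta>. hspeed A E (g j) w \<le> C) \<and>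
       (\<forall>w\<in>ball z0 \<delta>. g j w \<in> cnbhd c (f z0) (R / 2))) F"
    and fw: "\<And>w. w \<in> ball z0 \<delta> \<Longrightarrow> f w \<in> cnbhd c (f z0) (R / 2)"
    by (rule limit_local[OF z0 gc R(1,2)]) blast
  define u where "u = (\<lambda>i j w. cmap c (g j w) i)"
  define v where "v = (\<lambda>i w. cmap c (f w) i)"
  have fc: "f w \<in> cdom c" if "w \<in> ball z0 \<delta>" for w using fw[OF that] by (simp add: cnbhd_def)
  have ptw: "((\<lambda>j. u i j w) \<longlongrightarrow> v i w) F" if "w \<in> ball z0 \<delta>" for i w
    unfolding u_def v_def using \<delta>(3) that by (intro limitin_coord c pw fc) auto
  have lip: "eventually (\<lambda>j. \<forall>z\<in>ball z0 \<delta>. \<forall>w\<in>ball z0 \<delta>. cmod (u i j z - u i j w) \<le> C / m * cmod (z - w)) F"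
    if i: "i < cdim c" for i
    using ev
  proof eventually_elim
    case (elim j)
    have "cmod (u i j z - u i j w) \<le> C / m * cmod (z - w)"
      if zw: "z \<in> ball z0 \<delta>" "w \<in> ball z0 \<delta>" for z w
      unfolding u_def
      by (rule coord_lipschitz[OF gc _ open_ball convex_ball order_refl _ _ zw i])
        (use elim cnbhd_mono[OF R(3), of c "f z0"] in blast)+
    then show ?case by blast
  qed
  have vlip: "cmod (v i z - v i w) \<le> C / m * cmod (z - w)"
    if zw: "z \<in> ball z0 \<delta>" "w \<in> ball z0 \<delta>" and i: "i < cdim c" for i z w
  proof (rule tendsto_upperbound[OF _ _ F])
    show "((\<lambda>j. cmod (u i j z - u i j w)) \<longlongrightarrow> cmod (v i z - v i w)) F"
      by (intro tendsto_intros ptw zw)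
    show "eventually (\<lambda>j. cmod (u i j z - u i j w) \<le> C / m * cmod (z - w)) F"
      using lip[OF i] by eventually_elim (use zw in blast)
  qed
  have "uniform_limit (cball z0 (\<delta> / 2)) (u i) (v i) F" if i: "i < cdim c" for i
  proof (rule uniform_limitI)
    fix e :: real assume e: "e > 0"
    define K where "K = C / m"
    have K: "K \<ge> 0" using \<delta> m by (simp add: K_def)
    \<comment> \<open>A third of \<open>e\<close> is spent by the maps and a third by the limit in
      passing from \<open>w\<close> to a net point, the last third on convergence there;
      \<open>K + 1\<close> avoids division by zero.\<close>
    define \<eta> where "\<eta> = e / (3 * (K + 1))"
    have \<eta>: "\<eta> > 0" "K * \<eta> \<le> e / 3" using e K by (auto simp: \<eta>_def field_simps)
    obtain N where N: "finite N" "N \<subseteq> cball z0 (\<delta> / 2)" "cball z0 (\<delta> / 2) \<subseteq> (\<Union>x\<in>N. ball x \<eta>)"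
      using seq_compact_imp_totally_bounded[OF compact_imp_seq_compact[OF compact_cball[of z0 "\<delta> / 2"]],
          rule_format, OF \<eta>(1)] by blast
    have Nb: "cball z0 (\<delta> / 2) \<subseteq> ball z0 \<delta>" using \<delta> by auto
    have "eventually (\<lambda>j. dist (u i j x) (v i x) < e / 3) F" if "x \<in> N" for x
      using tendstoD[OF ptw[of x i], of "e / 3"] N(2) Nb that e by auto
    then have "eventually (\<lambda>j. \<forall>x\<in>N. dist (u i j x) (v i x) < e / 3) F"
      using N(1) by (intro eventually_ball_finite) auto
    with lip[OF i] show "eventually (\<lambda>j. \<forall>w\<in>cball z0 (\<delta> / 2). dist (u i j w) (v i w) < e) F"
    proof eventually_elim
      case (elim j)
      show ?case
      proof
        fix w assume w: "w \<in> cball z0 (\<delta> / 2)"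
        then obtain x where x: "x \<in> N" "w \<in> ball x \<eta>" using N(3) by blast
        have wx: "w \<in> ball z0 \<delta>" "x \<in> ball z0 \<delta>" using w x N(2) Nb by blast+
        have le: "K * cmod (w - x) \<le> e / 3"
        proof -
          have "K * cmod (w - x) \<le> K * \<eta>"
            using x(2) K by (intro mult_left_mono) (auto simp: dist_norm norm_minus_commute)
          then show ?thesis using \<eta> by simp
        qed
        have "dist (u i j w) (u i j x) \<le> e / 3"
          using order_trans[OF elim(1)[rule_format, OF wx] le[unfolded K_def]] by (simp add: dist_norm)
        moreover have "dist (v i w) (v i x) \<le> e / 3"
          using order_trans[OF vlip[OF wx i] le[unfolded K_def]] by (simp add: dist_norm)
        moreover have "dist (u i j x) (v i x) < e / 3" using elim(2) x(1) by blast
        ultimately show "dist (u i j w) (v i w) < e"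
          using dist_triangle[of "u i j w" "v i w" "u i j x"] dist_triangle[of "u i j x" "v i w" "v i x"]
          by (simp add: dist_commute)
      qed
    qed
  qed
  moreover have "eventually (\<lambda>j. hol_on M A (ball z0 \<delta>) (g j) \<and> (\<forall>w\<in>ball z0 \<delta>. g j w \<in> cdom c)) F"
    using ev by eventually_elim (auto simp: cnbhd_def)
  ultimately show thesis
    using fc unfolding u_def v_def by (intro that[OF \<delta>(1,3)]) auto
qed

text \<open>Weierstrass' theorem on limits of derivatives, applied to the coordinates on their disc
  of uniform convergence.\<close>

lemma limit_coord_derivative:
  assumes z0: "z0 \<in> D" and c: "c \<in> A" "f z0 \<in> cdom c" and i: "i < cdim c"
  shows "((\<lambda>w. cmap c (f w) i) has_field_derivative hvel c f z0 i) (at z0)"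
    and "((\<lambda>j. hvel c (g j) z0 i) \<longlongrightarrow> hvel c f z0 i) F"
proof -
  obtain \<delta> where \<delta>: "\<delta> > 0" "ball z0 \<delta> \<subseteq> D" "\<And>w. w \<in> ball z0 \<delta> \<Longrightarrow> f w \<in> cdom c"
    and ev: "eventually (\<lambda>j. hol_on M A (ball z0 \<delta>) (g j) \<and> (\<forall>w\<in>ball z0 \<delta>. g j w \<in> cdom c)) F"
    and ul: "\<And>i. i < cdim c \<Longrightarrow> uniform_limit (cball z0 (\<delta> / 2)) (\<lambda>j w. cmap c (g j w) i) (\<lambda>w. cmap c (f w) i) F"
    by (rule limit_coord_uniform[OF z0 c]) blast
  have Nb: "cball z0 (\<delta> / 2) \<subseteq> ball z0 \<delta>" using \<delta> by auto
  have "eventually (\<lambda>j. continuous_on (cball z0 (\<delta> / 2)) (\<lambda>w. cmap c (g j w) i) \<and>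
     (\<forall>w\<in>ball z0 (\<delta> / 2). ((\<lambda>w. cmap c (g j w) i) has_field_derivative hvel c (g j) w i) (at w))) F"
    using ev
  proof eventually_elim
    case (elim j)
    have der: "((\<lambda>w. cmap c (g j w) i) has_field_derivative hvel c (g j) w i) (at w)"
      if "w \<in> ball z0 \<delta>" for w
      by (rule hol_on_coord_derivative[of "ball z0 \<delta>"]) (use elim that c i in auto)
    then have "continuous_on (ball z0 \<delta>) (\<lambda>w. cmap c (g j w) i)"
      by (meson DERIV_isCont continuous_at_imp_continuous_on)
    then have "continuous_on (cball z0 (\<delta> / 2)) (\<lambda>w. cmap c (g j w) i)"
      using Nb by (rule continuous_on_subset)
    moreover have "ball z0 (\<delta> / 2) \<subseteq> ball z0 \<delta>" using \<delta> by (intro subset_ball) simp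
    ultimately show ?case using der by blast
  qed
  then obtain g' where g': "\<And>w. w \<in> ball z0 (\<delta> / 2) \<Longrightarrow>
      ((\<lambda>w. cmap c (f w) i) has_field_derivative g' w) (at w) \<and> ((\<lambda>j. hvel c (g j) w i) \<longlongrightarrow> g' w) F"
    by (rule has_complex_derivative_uniform_limit[OF _ ul[OF i] F]) (use \<delta> in auto)
  have z: "z0 \<in> ball z0 (\<delta> / 2)" using \<delta> by simp
  have "hvel c f z0 i = g' z0" using g'[OF z] i by (simp add: hvel_def DERIV_imp_deriv)
  then show "((\<lambda>w. cmap c (f w) i) has_field_derivative hvel c f z0 i) (at z0)"
    "((\<lambda>j. hvel c (g j) z0 i) \<longlongrightarrow> hvel c f z0 i) F" using g'[OF z] by auto
qed

lemma limit_hol_on: "hol_on M A D f"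
  unfolding hol_on_def
proof (intro conjI ballI allI impI)
  have "openin (top_of_set D) {z\<in>D. f z \<in> U}" if U: "openin M U" for U
  proof -
    have "open {z\<in>D. f z \<in> U}"
      unfolding open_contains_ball
    proof (intro ballI)
      fix z assume z: "z \<in> {z\<in>D. f z \<in> U}"
      then obtain \<delta> where "\<delta> > 0" "ball z \<delta> \<subseteq> {w\<in>D. f w \<in> U}"
        using limit_nbhd[of z U] U by blast
      then show "\<exists>e>0. ball z e \<subseteq> {z\<in>D. f z \<in> U}" by blast
    qed
    then show ?thesis by (auto intro: open_subset)
  qed
  moreover have "f z \<in> topspace M" if "z \<in> D" for z by (rule limitin_topspace[OF pw[OF that]])
  ultimately show "continuous_map (top_of_set D) M f" by (auto simp: continuous_map_def)
  fix c i assume "c \<in> A" "i < cdim c"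
  then show "(\<lambda>z. cmap c (f z) i) holomorphic_on {z\<in>D. f z \<in> cdom c}"
    unfolding holomorphic_on_def
    using limit_coord_derivative(1) field_differentiable_at_within field_differentiable_def
    by (metis (no_types, lifting) mem_Collect_eq)
qed

text \<open>Values and derivatives converge in one chart. This is how a bound on the speed and its
  normalisation at the origin survive in the limit.\<close>

lemma limit_hspeed:
  assumes z: "z \<in> D"
  shows "((\<lambda>j. hspeed A E (g j) z) \<longlongrightarrow> hspeed A E f z) F"
proof -
  define c where "c = chart_at A (f z)"
  have c: "c \<in> A" "f z \<in> cdom c" using chart_at[OF limitin_topspace[OF pw[OF z]]] by (auto simp: c_def)
  obtain \<delta> where \<delta>: "\<delta> > 0"
    and ev: "eventually (\<lambda>j. hol_on M A (ball z \<delta>) (g j) \<and> (\<forall>w\<in>ball z \<delta>. g j w \<in> cdom c)) F"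
    by (rule limit_coord_uniform[OF z c]) blast
  have zb: "z \<in> ball z \<delta>" using \<delta> by simp
  have "((\<lambda>j. tangent_length E c (g j z) (hvel c (g j) z)) \<longlongrightarrow> tangent_length E c (f z) (hvel c f z)) F"
  proof (rule tangent_length_tendsto[OF c pw[OF z] limit_coord_derivative(2)[OF z c]])
    show "eventually (\<lambda>j. hvel c (g j) z \<in> ztangent (cdim c) (cimg c) (cmap c (g j z))) F"
      using ev by eventually_elim (use hvel_in_ztangent[OF _ open_ball zb c(1)] zb in blast)
  qed (auto intro: hvel_in_ztangent[OF limit_hol_on D z c])
  moreover have "eventually (\<lambda>j. tangent_length E c (g j z) (hvel c (g j) z) = hspeed A E (g j) z) F"
    using ev by eventually_elim (use hspeed_chart[OF _ open_ball zb c(1)] zb in metis)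
  ultimately show ?thesis
    unfolding hspeed_chart[OF limit_hol_on D z c] by (rule Lim_transform_eventually)
qed

end

section \<open>The convergence set along an ultrafilter\<close>

lemma locally_bounded_speed_mono:
  assumes "locally_bounded_speed D g F" "F' \<le> F"
  shows "locally_bounded_speed D g F'"
  using assms unfolding locally_bounded_speed_def by (meson filter_leD)

lemma locally_bounded_speed_subset:
  assumes bd: "locally_bounded_speed D g F" and S: "open S" "S \<subseteq> D"
  shows "locally_bounded_speed S g F"
  unfolding locally_bounded_speed_def
proof
  fix z assume z: "z \<in> S"
  then obtain \<delta> C where \<delta>: "\<delta> > 0" "C \<ge> 0" "ball z \<delta> \<subseteq> D"
    and ev: "eventually (\<lambda>j. hol_on M A (ball z \<delta>) (g j) \<and> (\<forall>w\<in>ball z \<delta>. hspeed A E (g j) w \<le> C)) F"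
    using bd S(2) unfolding locally_bounded_speed_def by blast
  obtain e where e: "e > 0" "ball z e \<subseteq> S" using S(1) z open_contains_ball by blast
  have sub: "ball z (min \<delta> e) \<subseteq> ball z \<delta>" "ball z (min \<delta> e) \<subseteq> ball z e" by (auto intro: subset_ball)
  have ev': "eventually (\<lambda>j. hol_on M A (ball z (min \<delta> e)) (g j) \<and> (\<forall>w\<in>ball z (min \<delta> e). hspeed A E (g j) w \<le> C)) F"
    using ev by eventually_elim (use hol_on_subset[OF _ sub(1)] sub(1) in blast)
  show "\<exists>\<delta>>0. \<exists>C\<ge>0. ball z \<delta> \<subseteq> S \<and>
     eventually (\<lambda>j. hol_on M A (ball z \<delta>) (g j) \<and> (\<forall>w\<in>ball z \<delta>. hspeed A E (g j) w \<le> C)) F"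
    using \<delta> e sub(2) ev' by (intro exI[of _ "min \<delta> e"] conjI exI[of _ C]) auto
qed

text \<open>\<open>V\<close> and \<open>\<delta>\<close> are fixed before the points
  \<open>w j\<close>, which may move with \<open>j\<close>. One value in \<open>V\<close> for almost
  every \<open>j\<close> traps all values on the disc in a compact set, where an ultrafilter
  converges. This is applied to a point of convergence, to points approaching an exit point, and to
  moving rescaled points.\<close>

lemma converges_near:
  assumes U: "ultrafilter U" and bd: "locally_bounded_speed D g U" and z0: "z0 \<in> D" and y: "y \<in> topspace M"
  obtains V \<delta> where "openin M V" "y \<in> V" "\<delta> > 0" "ball z0 \<delta> \<subseteq> D"
    "\<And>w. eventually (\<lambda>j. w j \<in> ball z0 \<delta> \<and> g j (w j) \<in> V) U \<Longrightarrow>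
       \<exists>L. compactin M L \<and> eventually (\<lambda>j. \<forall>v\<in>ball z0 \<delta>. g j v \<in> L) U"
proof -
  obtain c R m G where gc: "good_chart c y R m G" by (rule good_chart_exists'[OF y])
  have R: "0 < R / 2" "R / 2 < R" using good_chartD(3)[OF gc] by auto
  have c: "c \<in> A" "y \<in> cdom c" using good_chartD[OF gc] by auto
  obtain \<delta> C where \<delta>: "\<delta> > 0" "ball z0 \<delta> \<subseteq> D"
    and ev: "eventually (\<lambda>j. hol_on M A (ball z0 \<delta>) (g j) \<and> (\<forall>w\<in>ball z0 \<delta>. hspeed A E (g j) w \<le> C) \<and>
       (\<forall>w\<in>ball z0 \<delta>. g j w \<in> cnbhd c y (R / 2 / 2) \<longrightarrow> (\<forall>v\<in>ball z0 \<delta>. g j v \<in> cnbhd c y (R / 2)))) U"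
    by (rule speed_bound_limit_local[OF bd z0 gc R]) blast
  define V where "V = {x\<in>cdom c. \<forall>i<cdim c. cmod (cmap c x i - cmap c y i) < R / 2 / 2}"
  have V: "openin M V" "y \<in> V" "V \<subseteq> cnbhd c y (R / 2 / 2)"
    unfolding V_def by (rule openin_cball_chart[OF c(1)]) (use c R in \<open>auto simp: cnbhd_def less_imp_le\<close>)
  show thesis
  proof (rule that[OF V(1,2) \<delta>])
    fix w assume w: "eventually (\<lambda>j. w j \<in> ball z0 \<delta> \<and> g j (w j) \<in> V) U"
    have "eventually (\<lambda>j. \<forall>v\<in>ball z0 \<delta>. g j v \<in> cnbhd c y (R / 2)) U"
      using ev w by eventually_elim (use V(3) in blast)
    then show "\<exists>L. compactin M L \<and> eventually (\<lambda>j. \<forall>v\<in>ball z0 \<delta>. g j v \<in> L) U"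
      using good_chartD(5)[OF gc less_imp_le[OF R(2)]] by blast
  qed
qed

text \<open>A limit \<open>y\<close> at \<open>z\<close> puts \<open>g j z\<close> in the set
  \<open>V\<close> of \<open>converges_near\<close>, hence the values on a whole disc in a compact
  set.\<close>

lemma convergence_set_open:
  assumes U: "ultrafilter U" and bd: "locally_bounded_speed D g U"
  shows "open {z\<in>D. \<exists>y. limitin M (\<lambda>j. g j z) y U}"
  unfolding open_contains_ball
proof
  fix z assume "z \<in> {z\<in>D. \<exists>y. limitin M (\<lambda>j. g j z) y U}"
  then obtain y where z: "z \<in> D" and y: "limitin M (\<lambda>j. g j z) y U" by blast
  obtain V \<delta> where V: "openin M V" "y \<in> V" and \<delta>: "\<delta> > 0" "ball z \<delta> \<subseteq> D"
    and L: "\<And>w. eventually (\<lambda>j. w j \<in> ball z \<delta> \<and> g j (w j) \<in> V) U \<Longrightarrow>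
       \<exists>L. compactin M L \<and> eventually (\<lambda>j. \<forall>v\<in>ball z \<delta>. g j v \<in> L) U"
    by (rule converges_near[OF U bd z limitin_topspace[OF y]]) blast
  have "eventually (\<lambda>j. z \<in> ball z \<delta> \<and> g j z \<in> V) U"
    using limitinD[OF y V] by eventually_elim (use \<delta> in simp)
  from L[OF this] obtain L where L: "compactin M L" "eventually (\<lambda>j. \<forall>v\<in>ball z \<delta>. g j v \<in> L) U"
    by blast
  have "\<exists>y. limitin M (\<lambda>j. g j v) y U" if "v \<in> ball z \<delta>" for v
  proof -
    have "eventually (\<lambda>j. g j v \<in> L) U" using L(2) by eventually_elim (use that in blast)
    then show ?thesis by (rule ultrafilter_limitin_compactin[OF U L(1)]) blast
  qed
  then show "\<exists>e>0. ball z e \<subseteq> {z\<in>D. \<exists>y. limitin M (\<lambda>j. g j z) y U}"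
    using \<delta> by (intro exI[of _ \<delta>]) auto
qed

text \<open>
  Along a segment whose interior lies in the convergence set, the limit map has bounded speed,
  so its values are Cauchy for the distance of \<open>E\<close>; completeness provides their limit.
\<close>

lemma convergence_set_segment:
  assumes comp: "complete_metric M A E"
    and U: "ultrafilter U" and bd: "locally_bounded_speed D g U" and z1: "z1 \<in> D"
    and S: "S = {z\<in>D. \<exists>y. limitin M (\<lambda>j. g j z) y U}"
    and \<delta>0: "eventually (\<lambda>j. \<forall>v\<in>ball z1 \<delta>. hspeed A E (g j) v \<le> C) U" "C \<ge> 0"
    and w: "w \<in> ball z1 \<delta>" and seg: "open_segment w z1 \<subseteq> S" and "w \<noteq> z1"
  shows "z1 \<in> S"
proof -
  have opS: "open S" unfolding S by (rule convergence_set_open[OF U bd])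
  have SD: "S \<subseteq> D" by (auto simp: S)
  have "\<forall>z\<in>S. \<exists>y. limitin M (\<lambda>j. g j z) y U" by (auto simp: S)
  from bchoice[OF this] obtain f where f: "\<And>z. z \<in> S \<Longrightarrow> limitin M (\<lambda>j. g j z) (f z) U" by blast
  have bdS: "locally_bounded_speed S g U" by (rule locally_bounded_speed_subset[OF bd opS SD])
  have Ub: "U \<noteq> bot" using U by (rule ultrafilter_nontrivial)
  have hf: "hol_on M A S f" by (rule limit_hol_on[OF Ub opS f bdS])
  have sp: "hspeed A E f z \<le> C" if "z \<in> S" "z \<in> ball z1 \<delta>" for z
  proof (rule tendsto_upperbound[OF limit_hspeed[OF Ub opS f bdS that(1)] _ Ub])
    show "eventually (\<lambda>j. hspeed A E (g j) z \<le> C) U"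
      using \<delta>0(1) by eventually_elim (use that in blast)
  qed
  \<comment> \<open>\<open>n + 2\<close> keeps the parameter strictly between \<open>0\<close> and
    \<open>1\<close>, so that \<open>q n\<close> lies in the open segment, where \<open>f\<close> is
    the limit map.\<close>
  define q where "q = (\<lambda>n::nat. z1 + of_real (1 / (real n + 2)) * (w - z1))"
  have qin: "q n \<in> open_segment w z1" for n
  proof -
    define s where "s = 1 / (real n + 2)"
    have "q n = (1 - (1 - s)) *\<^sub>R w + (1 - s) *\<^sub>R z1"
      unfolding q_def s_def[symmetric] by (simp add: scaleR_conv_of_real algebra_simps)
    moreover have "0 < s" "s < 1" by (auto simp: s_def)
    ultimately show ?thesis using \<open>w \<noteq> z1\<close> unfolding in_segment(2)
      by (intro conjI exI[of _ "1 - s"]) auto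
  qed
  have segb: "closed_segment w z1 \<subseteq> ball z1 \<delta>"
    using w by (intro closed_segment_subset convex_ball) (auto intro: le_less_trans[OF zero_le_dist])
  have lim_q: "q \<longlonglongrightarrow> z1"
  proof -
    have "(\<lambda>n. 1 / (real n + 2)) \<longlonglongrightarrow> 0"
      using LIMSEQ_ignore_initial_segment[OF lim_1_over_n[where 'a = real], of 2]
      by (simp add: add.commute)
    then have "(\<lambda>n. z1 + of_real (1 / (real n + 2)) * (w - z1)) \<longlonglongrightarrow> z1 + of_real 0 * (w - z1)"
      by (intro tendsto_intros)
    then show ?thesis by (simp add: q_def)
  qed
  have dq: "herm_dist M A E (f (q m)) (f (q n)) \<le> ennreal (C * dist (q m) (q n))" for m n
  proof (rule herm_dist_hol_segment[OF hf opS])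
    have sub: "closed_segment (q m) (q n) \<subseteq> open_segment w z1"
      by (rule closed_segment_subset[OF qin qin convex_open_segment])
    show "closed_segment (q m) (q n) \<subseteq> S" using sub seg by blast
    show "hspeed A E f z \<le> C" if "z \<in> closed_segment (q m) (q n)" for z
      using that sub seg segb segment_open_subset_closed by (intro sp) blast+
  qed
  have "range (\<lambda>n. f (q n)) \<subseteq> topspace M"
    using limitin_topspace[OF f] qin seg by blast
  moreover have "\<exists>N. \<forall>m\<ge>N. \<forall>n\<ge>N. herm_dist M A E (f (q m)) (f (q n)) < \<epsilon>" if \<epsilon>: "\<epsilon> > 0" for \<epsilon>
  proof -
    obtain e where e: "e > 0" "ennreal e < \<epsilon>" by (rule ennreal_pos_realE[OF \<epsilon>])
    have "e / (C + 1) > 0" using e \<delta>0(2) by simp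
    then obtain N where N: "\<And>m n. m \<ge> N \<Longrightarrow> n \<ge> N \<Longrightarrow> dist (q m) (q n) < e / (C + 1)"
      using LIMSEQ_imp_Cauchy[OF lim_q] unfolding Cauchy_def by meson
    have "herm_dist M A E (f (q m)) (f (q n)) < \<epsilon>" if "m \<ge> N" "n \<ge> N" for m n
    proof -
      have "C * dist (q m) (q n) \<le> (C + 1) * (e / (C + 1))"
        using N[OF that] \<delta>0(2) e by (intro mult_mono) auto
      then have "C * dist (q m) (q n) \<le> e" using \<delta>0(2) by simp
      then show ?thesis using dq[of m n] e(2) by (meson ennreal_leI le_less_trans order_trans)
    qed
    then show ?thesis by blast
  qed
  ultimately obtain y where y: "y \<in> topspace M" "(\<lambda>n. herm_dist M A E (f (q n)) y) \<longlonglongrightarrow> 0"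
    using comp unfolding complete_metric_def by blast
  \<comment> \<open>The disc about \<open>z1\<close> and the set \<open>V\<close> about
    \<open>y\<close> are fixed first; then one \<open>n\<close> puts \<open>q n\<close> in the disc
    and \<open>f (q n)\<close> in \<open>V\<close>, and convergence at this single point spreads to
    \<open>z1\<close>.\<close>
  obtain V \<delta>1 where V: "openin M V" "y \<in> V" and \<delta>1: "\<delta>1 > 0" "ball z1 \<delta>1 \<subseteq> D"
    and L: "\<And>w. eventually (\<lambda>j. w j \<in> ball z1 \<delta>1 \<and> g j (w j) \<in> V) U \<Longrightarrow>
       \<exists>L. compactin M L \<and> eventually (\<lambda>j. \<forall>v\<in>ball z1 \<delta>1. g j v \<in> L) U"
    by (rule converges_near[OF U bd z1 y(1)]) blast
  have cy: "chart_at A y \<in> A" "y \<in> cdom (chart_at A y)" using chart_at[OF y(1)] by auto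
  obtain R m G where gc: "good_chart (chart_at A y) y R m G" "cnbhd (chart_at A y) y R \<subseteq> V"
    by (rule good_chart_exists[OF cy V])
  have R: "0 < R / 2" "R / 2 < R" "0 < m" using good_chartD(3,4)[OF gc(1)] by auto
  have "eventually (\<lambda>n. herm_dist M A E (f (q n)) y < ennreal (m * (R / 2))) sequentially"
    using order_tendstoD(2)[OF y(2), of "ennreal (m * (R / 2))"] R by simp
  moreover have "eventually (\<lambda>n. q n \<in> ball z1 \<delta>1) sequentially"
    using tendstoD[OF lim_q \<delta>1(1)] by (simp add: dist_commute)
  ultimately have "eventually (\<lambda>n. herm_dist M A E (f (q n)) y < ennreal (m * (R / 2)) \<and> q n \<in> ball z1 \<delta>1) sequentially"
    by (rule eventually_conj)
  then obtain n where n: "herm_dist M A E (f (q n)) y < ennreal (m * (R / 2))" "q n \<in> ball z1 \<delta>1"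
    using eventually_happens'[OF sequentially_bot] by blast
  have "f (q n) \<in> cnbhd (chart_at A y) y (R / 2)"
    by (rule herm_dist_less_imp_cnbhd[OF gc(1) R(1,2) n(1)])
  then have fV: "f (q n) \<in> V"
    by (rule subsetD[OF order_trans[OF cnbhd_mono[OF less_imp_le[OF R(2)]] gc(2)]])
  have "q n \<in> S" using qin seg by blast
  then have "eventually (\<lambda>j. g j (q n) \<in> V) U" using limitinD[OF f V(1) fV] by blast
  then have "eventually (\<lambda>j. q n \<in> ball z1 \<delta>1 \<and> g j (q n) \<in> V) U"
    by eventually_elim (use n in simp)
  from L[OF this] obtain L where L: "compactin M L" "eventually (\<lambda>j. \<forall>v\<in>ball z1 \<delta>1. g j v \<in> L) U"
    by blast
  have "eventually (\<lambda>j. g j z1 \<in> L) U" using L(2) by eventually_elim (use \<delta>1 in simp)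
  then have "\<exists>y. limitin M (\<lambda>j. g j z1) y U" by (rule ultrafilter_limitin_compactin[OF U L(1)]) blast
  then show ?thesis using z1 by (simp add: S)
qed

text \<open>A point of \<open>D\<close> in the closure of \<open>S\<close> but outside
  \<open>S\<close> could be approached from a nearby \<open>w \<in> S\<close> along a segment, and
  the first exit point would contradict \<open>convergence_set_segment\<close>. So \<open>S\<close>
  is both open and closed in \<open>D\<close>.\<close>

lemma convergence_set_all:
  assumes comp: "complete_metric M A E" and D: "open D" "connected D"
    and U: "ultrafilter U" and bd: "locally_bounded_speed D g U"
    and z: "z \<in> D" "limitin M (\<lambda>j. g j z) y U" and v: "v \<in> D"
  shows "\<exists>y. limitin M (\<lambda>j. g j v) y U"
proof -
  define S where "S = {z\<in>D. \<exists>y. limitin M (\<lambda>j. g j z) y U}"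
  have opS: "open S" unfolding S_def by (rule convergence_set_open[OF U bd])
  have "z0 \<in> S" if z0: "z0 \<in> D" "z0 \<in> closure S" for z0
  proof (rule ccontr)
    assume nS: "z0 \<notin> S"
    obtain \<delta> C where \<delta>: "\<delta> > 0" "C \<ge> 0" "ball z0 \<delta> \<subseteq> D"
      and ev: "eventually (\<lambda>j. hol_on M A (ball z0 \<delta>) (g j) \<and> (\<forall>w\<in>ball z0 \<delta>. hspeed A E (g j) w \<le> C)) U"
      using bd z0 unfolding locally_bounded_speed_def by blast
    \<comment> \<open>Half the radius leaves, about each point of the segment to \<open>z0\<close>,
      a disc of radius \<open>\<delta> / 2\<close> on which the speed bound still holds and which,
      at the exit point, contains \<open>w\<close>.\<close>
    obtain w where w: "w \<in> S" "dist w z0 < \<delta> / 2"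
      using z0(2) \<delta>(1) unfolding closure_approachable by (meson half_gt_zero)
    define p where "p = (\<lambda>t::real. w + of_real t * (z0 - w))"
    define T where "T = {t\<in>{0..1}. p t \<in> - S}"
    have "continuous_on {0..1} p" unfolding p_def by (intro continuous_intros)
    then have "closed ({0..1} \<inter> p -` (- S))"
      using opS by (intro continuous_closed_preimage) auto
    moreover have "{0..1} \<inter> p -` (- S) = T" by (auto simp: T_def)
    ultimately have "closed T" by metis
    moreover have "1 \<in> T" using nS by (simp add: T_def p_def)
    moreover have "bdd_below T" by (auto simp: T_def intro!: bdd_belowI[of _ 0])
    \<comment> \<open>The exit time is attained because \<open>S\<close> is open, and exists because
      the segment ends at \<open>z0\<close>, outside \<open>S\<close>.\<close>
    ultimately have t1: "Inf T \<in> T" "\<And>t. t \<in> T \<Longrightarrow> Inf T \<le> t"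
      by (auto intro: closed_contains_Inf cInf_lower)
    define t1 where "t1 = Inf T"
    have t1: "t1 \<in> T" "\<And>t. t \<in> T \<Longrightarrow> t1 \<le> t" using t1 by (auto simp: t1_def)
    have t01: "0 < t1" "t1 \<le> 1" using t1(1) w(1) by (auto simp: T_def p_def less_eq_real_def)
    have pw: "dist (p t) z0 < \<delta> / 2" if "0 \<le> t" "t \<le> 1" for t
    proof -
      have "p t - z0 = of_real (1 - t) * (w - z0)" by (simp add: p_def algebra_simps)
      then have "dist (p t) z0 = (1 - t) * dist w z0" using that by (simp add: dist_norm norm_mult del: of_real_diff)
      also have "\<dots> \<le> dist w z0" using that by (intro mult_left_le_one_le) auto
      finally show ?thesis using w(2) by simp
    qed
    have sub: "ball (p t1) (\<delta> / 2) \<subseteq> ball z0 \<delta>"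
    proof
      fix x assume "x \<in> ball (p t1) (\<delta> / 2)"
      then show "x \<in> ball z0 \<delta>"
        using pw[of t1] t01 dist_triangle[of z0 x "p t1"] by (simp add: dist_commute)
    qed
    have "p t1 \<in> S"
    proof (rule convergence_set_segment[OF comp U bd _ S_def _ \<delta>(2)])
      show "p t1 \<in> D" using \<delta>(3) pw[of t1] t01 \<delta>(1) by (auto simp: dist_commute)
      show "eventually (\<lambda>j. \<forall>v\<in>ball (p t1) (\<delta> / 2). hspeed A E (g j) v \<le> C) U"
        using ev by eventually_elim (use sub in blast)
      show "w \<noteq> p t1" using t1(1) w(1) by (auto simp: T_def)
      have wp: "w - p t1 = of_real t1 * (w - z0)" by (simp add: p_def algebra_simps)
      have "dist (p t1) w = t1 * dist w z0"
        using t01 wp by (simp add: dist_norm norm_mult norm_minus_commute)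
      also have "\<dots> \<le> dist w z0" using t01 by (intro mult_left_le_one_le) auto
      finally show "w \<in> ball (p t1) (\<delta> / 2)" using w(2) by simp
      show "open_segment w (p t1) \<subseteq> S"
      proof
        fix x assume "x \<in> open_segment w (p t1)"
        then obtain u where u: "0 < u" "u < 1" "x = (1 - u) *\<^sub>R w + u *\<^sub>R p t1"
          unfolding in_segment(2) by blast
        have "x = p (u * t1)" by (simp add: u(3) p_def scaleR_conv_of_real algebra_simps)
        moreover have "u * t1 < t1" "0 \<le> u * t1" using u t01 by auto
        then have "u * t1 \<notin> T" using t1(2) by force
        then have "p (u * t1) \<in> S" using \<open>u * t1 < t1\<close> \<open>0 \<le> u * t1\<close> t01 by (auto simp: T_def)
        ultimately show "x \<in> S" by simp
      qed
    qed
    then show False using t1(1) by (simp add: T_def)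
  qed
  then have "S = D \<inter> closure S" using closure_subset[of S] by (auto simp: S_def)
  then have "closedin (top_of_set D) S" by (metis closed_closure closedin_closed)
  moreover have "openin (top_of_set D) S" using opS by (intro open_subset) (auto simp: S_def)
  ultimately have "S = {} \<or> S = D" using D(2) unfolding connected_clopen by blast
  then show ?thesis using z v by (auto simp: S_def)
qed

subsection \<open>Rescaling\<close>

lemma locally_compact: "locally_compact_space M"
  unfolding locally_compact_space_def
proof
  fix x assume "x \<in> topspace M"
  then obtain c R m G where gc: "good_chart c x R m G" by (rule good_chart_exists')
  obtain V where V: "openin M V" "V \<subseteq> cnbhd c x R" "x \<in> V" by (rule good_chart_interior[OF gc]) blast
  then show "\<exists>U K. openin M U \<and> compactin M K \<and> x \<in> U \<and> U \<subseteq> K"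
    using good_chartD(5)[OF gc order_refl] by blast
qed

lemma regular: "regular_space M"
  using locally_compact_Hausdorff_imp_regular_space[OF locally_compact Hausdorff] .

lemma metrizable: "metrizable_space M"
  by (rule regular_second_countable_imp_metrizable_space[OF regular Hausdorff second_countable])

lemma metricE:
  obtains d where "Metric_space (topspace M) d" "Metric_space.mtopology (topspace M) d = M"
proof -
  obtain S d where S: "Metric_space S d" "M = Metric_space.mtopology S d"
    using metrizable unfolding metrizable_space_def by blast
  have "topspace M = S" unfolding S(2) by (rule Metric_space.topspace_mtopology[OF S(1)])
  then show thesis using S by (intro that[of d]) auto
qed

text \<open>The Lindelof property extracts countably many relatively compact open sets covering
  \<open>M\<close>. A compact set needs only finitely many, so it lies in the finite unions of the
  compact sets around them.\<close>

lemma compact_exhaustion: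
  obtains L :: "nat \<Rightarrow> 'm set" where "\<And>n. compactin M (L n)"
    "\<And>K. compactin M K \<Longrightarrow> eventually (\<lambda>n. K \<subseteq> L n) sequentially"
proof -
  define \<V> where "\<V> = {V. openin M V \<and> (\<exists>C. compactin M C \<and> V \<subseteq> C)}"
  have "\<And>V. V \<in> \<V> \<Longrightarrow> openin M V" by (simp add: \<V>_def)
  moreover have "\<Union>\<V> = topspace M"
  proof
    show "\<Union>\<V> \<subseteq> topspace M" by (auto simp: \<V>_def dest: openin_subset)
    show "topspace M \<subseteq> \<Union>\<V>"
      using locally_compact unfolding locally_compact_space_def \<V>_def by blast
  qed
  ultimately obtain \<W> where \<W>: "countable \<W>" "\<W> \<subseteq> \<V>" "\<Union>\<W> = topspace M"
    using second_countable_imp_Lindelof_space[OF second_countable] unfolding Lindelof_space_def by metis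
  \<comment> \<open>The empty set is added because \<open>from_nat_into\<close> enumerates only
    nonempty sets.\<close>
  define W where "W = from_nat_into (insert {} \<W>)"
  have rW: "range W = insert {} \<W>" using \<W>(1) by (simp add: W_def range_from_nat_into)
  have "{} \<in> \<V>" by (auto simp: \<V>_def)
  then have WV: "W n \<in> \<V>" for n using rW \<W>(2) by (metis insert_iff rangeI subsetD)
  then have "\<exists>C. compactin M C \<and> W n \<subseteq> C" for n by (auto simp: \<V>_def)
  then obtain C where C: "\<And>n. compactin M (C n)" "\<And>n. W n \<subseteq> C n" by metis
  show thesis
  proof (rule that[of "\<lambda>n. \<Union>i\<in>{..n}. C i"])
    show "compactin M (\<Union>i\<in>{..n}. C i)" for n by (rule compactin_Union) (use C in auto)
    fix K assume K: "compactin M K"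
    have "K \<subseteq> \<Union>(range W)" using compactin_subset_topspace[OF K] \<W>(3) rW by auto
    moreover have "openin M V" if "V \<in> range W" for V using WV that by (auto simp: \<V>_def)
    ultimately obtain \<G> where \<G>: "finite \<G>" "\<G> \<subseteq> range W" "K \<subseteq> \<Union>\<G>"
      using K unfolding compactin_def by meson
    obtain I where I: "finite I" "\<G> = W ` I" using finite_subset_image[OF \<G>(1,2)] by blast
    obtain N where N: "\<And>i. i \<in> I \<Longrightarrow> i \<le> N" using I(1) by (meson finite_nat_set_iff_bounded_le)
    have "K \<subseteq> (\<Union>i\<in>{..n}. C i)" if "n \<ge> N" for n
    proof
      fix x assume "x \<in> K"
      then obtain i where i: "i \<in> I" "x \<in> W i" using \<G>(3) I(2) by blast
      have "i \<le> n" using N[OF i(1)] that by simp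
      then show "x \<in> (\<Union>i\<in>{..n}. C i)" using C(2)[of i] i(2) by blast
    qed
    then show "eventually (\<lambda>n. K \<subseteq> (\<Union>i\<in>{..n}. C i)) sequentially"
      unfolding eventually_sequentially by blast
  qed
qed

section \<open>Rescaled maps and their limits\<close>

lemma hol_rescale:
  assumes f: "hol_on M A \<Omega> f" "open \<Omega>" and D: "D = {\<xi>. p + of_real \<rho> * \<xi> \<in> \<Omega>}"
    and g: "g = (\<lambda>\<xi>. f (p + of_real \<rho> * \<xi>))" and \<rho>: "\<rho> > 0"
  shows "open D" and "hol_on M A D g"
    and "\<And>\<xi>. \<xi> \<in> D \<Longrightarrow> hspeed A E g \<xi> = \<rho> * hspeed A E f (p + of_real \<rho> * \<xi>)"
proof -
  let ?a = "\<lambda>\<xi>. p + of_real \<rho> * \<xi>"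
  have "open (?a -` \<Omega>)" by (rule open_vimage[OF f(2)]) (intro continuous_intros)
  then show oD: "open D" by (simp add: D vimage_def)
  show hg: "hol_on M A D g"
    unfolding hol_on_def
  proof (intro conjI ballI allI impI)
    have 1: "continuous_map (top_of_set D) (top_of_set \<Omega>) ?a"
      by (auto simp: D continuous_map_in_subtopology intro!: continuous_intros)
    have 2: "continuous_map (top_of_set \<Omega>) M f" using f(1) by (simp add: hol_on_def)
    show "continuous_map (top_of_set D) M g"
      using continuous_map_compose[OF 1 2] by (simp add: o_def g)
    fix c i assume c: "c \<in> A" "i < cdim c"
    have "((\<lambda>z. cmap c (f z) i) \<circ> ?a) holomorphic_on {\<xi>\<in>D. g \<xi> \<in> cdom c}"
    proof (rule holomorphic_on_compose_gen)
      show "?a holomorphic_on {\<xi>\<in>D. g \<xi> \<in> cdom c}" by (intro holomorphic_intros)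
      show "(\<lambda>z. cmap c (f z) i) holomorphic_on {z\<in>\<Omega>. f z \<in> cdom c}"
        using f(1) c by (auto simp: hol_on_def)
    qed (auto simp: D g)
    then show "(\<lambda>z. cmap c (g z) i) holomorphic_on {z\<in>D. g z \<in> cdom c}" by (simp add: o_def g)
  qed
  fix \<xi> assume \<xi>: "\<xi> \<in> D"
  then have z: "?a \<xi> \<in> \<Omega>" by (simp add: D)
  define c where "c = chart_at A (g \<xi>)"
  have c: "c \<in> A" "g \<xi> \<in> cdom c" using chart_at[OF hol_on_in_topspace[OF hg \<xi>]] by (auto simp: c_def)
  have cf: "f (?a \<xi>) \<in> cdom c" using c by (simp add: g)
  have "((\<lambda>w. cmap c (g w) i) has_field_derivative hvel c f (?a \<xi>) i * of_real \<rho>) (at \<xi>)"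
    if i: "i < cdim c" for i
  proof -
    have "(?a has_field_derivative of_real \<rho>) (at \<xi>)" by (auto intro!: derivative_eq_intros)
    from DERIV_chain2[OF hol_on_coord_derivative[OF f z c(1) cf i] this] show ?thesis by (simp add: g)
  qed
  then have "hvel c g \<xi> = (\<lambda>i. if i < cdim c then hvel c f (?a \<xi>) i * of_real \<rho> else 0)"
    by (rule hvel_eqI)
  also have "\<dots> = (\<lambda>i. of_real \<rho> * hvel c f (?a \<xi>) i)" by (auto simp: hvel_def)
  finally have hv: "hvel c g \<xi> = (\<lambda>i. of_real \<rho> * hvel c f (?a \<xi>) i)" .
  have "hspeed A E g \<xi> = tangent_length E c (f (?a \<xi>)) (\<lambda>i. of_real \<rho> * hvel c f (?a \<xi>) i)"
    using hspeed_chart[OF hg oD \<xi> c] by (simp add: hv) (simp add: g)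
  also have "\<dots> = \<rho> * hspeed A E f (?a \<xi>)"
    using tangent_length_scale[OF c(1) cf hvel_in_ztangent[OF f z c(1) cf], of "of_real \<rho>"]
      hspeed_chart[OF f z c(1) cf] \<rho> by simp
  finally show "hspeed A E g \<xi> = \<rho> * hspeed A E f (?a \<xi>)" .
qed

text \<open>The maximum point of \<open>(r - |z - q|) |f'(z)|\<close> on the disc about \<open>q\<close> is the centre of the rescaling.\<close>

lemma zalcman_point:
  assumes f: "hol_on M A \<Omega> f" "open \<Omega>" and r: "r > 0" "cball q r \<subseteq> \<Omega>" and N: "N > 0"
    and big: "N < r * hspeed A E f q"
  obtains p \<rho> where "dist q p \<le> r" "p \<in> \<Omega>" "0 < \<rho>" "\<rho> \<le> r / N" "\<rho> * hspeed A E f p = 1"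
    "\<And>\<xi>. cmod \<xi> \<le> N / 2 \<Longrightarrow> p + of_real \<rho> * \<xi> \<in> \<Omega> \<and> \<rho> * hspeed A E f (p + of_real \<rho> * \<xi>) \<le> 2"
proof -
  define \<phi> where "\<phi> = (\<lambda>z. (r - dist q z) * hspeed A E f z)"
  have "continuous_on (cball q r) \<phi>"
    unfolding \<phi>_def
    by (intro continuous_intros continuous_on_subset[OF continuous_on_hspeed[OF f] r(2)])
  then obtain p where p: "p \<in> cball q r" "\<And>z. z \<in> cball q r \<Longrightarrow> \<phi> z \<le> \<phi> p"
    using continuous_attains_sup[of "cball q r" \<phi>] r(1) by auto
  have p\<Omega>: "p \<in> \<Omega>" using p r by blast
  have "N < \<phi> q" using big by (simp add: \<phi>_def)
  also have "\<phi> q \<le> \<phi> p" using p(2) r(1) by simp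
  finally have N\<phi>: "N < \<phi> p" .
  have s0: "hspeed A E f p \<ge> 0" by (rule hspeed_nonneg[OF f p\<Omega>])
  define s where "s = hspeed A E f p"
  \<comment> \<open>The distance from \<open>p\<close> to the edge of the disc;
    \<open>N < e * s\<close> says that \<open>N\<close> rescaled units fit into it.\<close>
  define e where "e = r - dist q p"
  have es: "N < e * s" using N\<phi> by (simp add: \<phi>_def e_def s_def)
  have e0: "e \<ge> 0" using p(1) by (simp add: e_def)
  have s: "s > 0" using es N s0 e0 by (cases "s = 0") (auto simp: s_def)
  have e: "e > 0" using es N e0 by (cases "e = 0") auto
  define \<rho> where "\<rho> = 1 / s"
  have \<rho>: "\<rho> > 0" "\<rho> * s = 1" "\<rho> * N < e"
    using s es by (auto simp: \<rho>_def field_simps)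
  show thesis
  proof (rule that[OF _ p\<Omega> \<rho>(1) _ \<rho>(2)[unfolded s_def]])
    show "dist q p \<le> r" using p(1) by simp
    have "\<rho> * N \<le> r" using \<rho>(3) by (simp add: e_def) (smt (verit) zero_le_dist)
    then show "\<rho> \<le> r / N" using N by (simp add: field_simps)
    fix \<xi> assume \<xi>: "cmod \<xi> \<le> N / 2"
    let ?z = "p + of_real \<rho> * \<xi>"
    have "dist p ?z = \<rho> * cmod \<xi>" using \<rho>(1) by (simp add: dist_norm norm_mult)
    also have "\<dots> \<le> \<rho> * (N / 2)" using \<xi> \<rho>(1) by (intro mult_left_mono) auto
    also have "\<dots> \<le> e / 2" using \<rho>(3) by simp
    finally have d: "dist p ?z \<le> e / 2" .
    have "dist q ?z \<le> dist q p + dist p ?z" by (rule dist_triangle)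
    then have zr: "e / 2 \<le> r - dist q ?z" using d by (simp add: e_def)
    then have zb: "?z \<in> cball q r" using e by simp
    then have z\<Omega>: "?z \<in> \<Omega>" using r by blast
    \<comment> \<open>Within \<open>e / 2\<close> of \<open>p\<close> the weight is still at least
      half of its value \<open>e\<close> at \<open>p\<close>, so maximality costs at most a factor
      of \<open>2\<close>. This is the origin of the bound \<open>2\<close> and of the radius
      \<open>N / 2\<close>.\<close>
    have "e / 2 * hspeed A E f ?z \<le> (r - dist q ?z) * hspeed A E f ?z"
      using zr by (intro mult_right_mono hspeed_nonneg[OF f z\<Omega>])
    also have "\<dots> \<le> e * s" using p(2)[OF zb] by (simp add: \<phi>_def e_def s_def)
    finally have "hspeed A E f ?z \<le> 2 * s" using e by simp
    then have "\<rho> * hspeed A E f ?z \<le> \<rho> * (2 * s)" using \<rho>(1) by simp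
    then show "?z \<in> \<Omega> \<and> \<rho> * hspeed A E f ?z \<le> 2" using z\<Omega> \<rho>(2) by simp
  qed
qed

text \<open>Unbounded speed near \<open>p0\<close> supplies, in the disc of radius
  \<open>r n\<close>, a speed above \<open>(n + 1) / r n\<close>: just what
  \<open>zalcman_point\<close> needs with \<open>N = n + 1\<close>. Then
  \<open>\<rho> n \<le> r n\<close> and \<open>dist p0 (p n) \<le> 2 * r n\<close> tend to
  \<open>0\<close>, while the discs of radius \<open>(n + 1) / 2\<close> exhaust the plane.\<close>

lemma zalcman_rescaling:
  assumes \<Omega>: "open \<Omega>" and \<F>: "\<And>f. f \<in> \<F> \<Longrightarrow> hol_on M A \<Omega> f" and p0: "p0 \<in> \<Omega>"
    and nb: "\<And>\<delta> C. \<delta> > 0 \<Longrightarrow> \<exists>f\<in>\<F>. \<exists>q\<in>ball p0 \<delta>. C < hspeed A E f q"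
  obtains p :: "nat \<Rightarrow> complex" and f \<rho> where "range p \<subseteq> \<Omega>" "p \<longlonglongrightarrow> p0" "range f \<subseteq> \<F>"
    "\<And>n. \<rho> n > 0" "\<rho> \<longlonglongrightarrow> 0" "\<And>n. \<rho> n * hspeed A E (f n) (p n) = 1"
    "\<And>n \<xi>. cmod \<xi> \<le> real (Suc n) / 2 \<Longrightarrow>
       p n + of_real (\<rho> n) * \<xi> \<in> \<Omega> \<and> \<rho> n * hspeed A E (f n) (p n + of_real (\<rho> n) * \<xi>) \<le> 2"
proof -
  obtain r0 where r0: "r0 > 0" "cball p0 r0 \<subseteq> \<Omega>" using \<Omega> p0 open_contains_cball by blast
  \<comment> \<open>The half leaves room for the disc of radius \<open>r n\<close> about a point at
    distance less than \<open>r n\<close> from \<open>p0\<close>.\<close>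
  define r where "r = (\<lambda>n. r0 / 2 / real (Suc n))"
  have r: "r n > 0" "2 * r n \<le> r0" for n using r0(1) by (auto simp: r_def field_simps)
  define P where "P = (\<lambda>n p f \<rho>. dist p0 p \<le> 2 * r n \<and> p \<in> \<Omega> \<and> f \<in> \<F> \<and> 0 < \<rho> \<and> \<rho> \<le> r n \<and>
      \<rho> * hspeed A E f p = 1 \<and> (\<forall>\<xi>. cmod \<xi> \<le> real (Suc n) / 2 \<longrightarrow>
       p + of_real \<rho> * \<xi> \<in> \<Omega> \<and> \<rho> * hspeed A E f (p + of_real \<rho> * \<xi>) \<le> 2))"
  have "\<exists>p f \<rho>. P n p f \<rho>" for n
  proof -
    obtain f q where f: "f \<in> \<F>" and q: "q \<in> ball p0 (r n)" "real (Suc n) / r n < hspeed A E f q"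
      using nb[OF r(1)[of n], of "real (Suc n) / r n"] by blast
    have sub: "cball q (r n) \<subseteq> \<Omega>"
    proof
      fix z assume "z \<in> cball q (r n)"
      then have "z \<in> cball p0 r0" using q(1) r(2)[of n] dist_triangle[of p0 z q] by simp
      then show "z \<in> \<Omega>" using r0 by blast
    qed
    have N: "0 < real (Suc n)" by simp
    have big: "real (Suc n) < r n * hspeed A E f q" using q(2) r(1)[of n] by (simp add: field_simps)
    obtain p \<rho> where p: "dist q p \<le> r n" "p \<in> \<Omega>" "0 < \<rho>" "\<rho> \<le> r n / real (Suc n)" "\<rho> * hspeed A E f p = 1"
      "\<And>\<xi>. cmod \<xi> \<le> real (Suc n) / 2 \<Longrightarrow> p + of_real \<rho> * \<xi> \<in> \<Omega> \<and> \<rho> * hspeed A E f (p + of_real \<rho> * \<xi>) \<le> 2"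
      by (rule zalcman_point[OF \<F>[OF f] \<Omega> r(1) sub N big]) blast
    have "r n / real (Suc n) \<le> r n" using r(1)[of n] by (simp add: field_simps)
    then have "\<rho> \<le> r n" using p(4) by linarith
    moreover have "dist p0 p \<le> 2 * r n" using dist_triangle[of p0 p q] q(1) p(1) by simp
    ultimately have "P n p f \<rho>" unfolding P_def using f p by simp
    then show ?thesis by blast
  qed
  then obtain p f \<rho> where "\<And>n. P n (p n) (f n) (\<rho> n)" by metis
  note T = this[unfolded P_def]
  have rlim: "r \<longlonglongrightarrow> 0"
  proof -
    have "r = (\<lambda>n. (r0 / 2) * inverse (real (Suc n)))" by (simp only: r_def divide_inverse)
    then show ?thesis using tendsto_mult_right_zero[OF LIMSEQ_inverse_real_of_nat] by metis
  qed
  have "\<rho> \<longlonglongrightarrow> 0"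
    by (rule tendsto_sandwich[OF _ _ tendsto_const rlim]) (use T in \<open>auto intro!: always_eventually less_imp_le\<close>)
  moreover have "(\<lambda>n. dist (p n) p0) \<longlonglongrightarrow> 0"
    by (rule tendsto_sandwich[OF _ _ tendsto_const tendsto_mult_right_zero[OF rlim, of 2]])
      (use T in \<open>auto intro!: always_eventually simp: dist_commute\<close>)
  then have "p \<longlonglongrightarrow> p0" by (rule iffD2[OF tendsto_dist_iff])
  ultimately show thesis by (intro that[of p f \<rho>]) (use T in blast)+
qed

lemma Hol_iff: "f \<in> Hol \<Omega> M A \<longleftrightarrow> f \<in> extensional \<Omega> \<and> hol_on M A \<Omega> f"
  by (auto simp: Hol_def hol_on_def)

lemma brody_curve_iff: "brody_curve M A E h \<longleftrightarrow> hol_on M A UNIV h \<and> (\<exists>B. \<forall>z. hspeed A E h z \<le> B)"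
  by (simp add: brody_curve_def Hol_iff extensional_def hspeed_def hvel_def Let_def)

lemma hspeed_constant:
  assumes "hol_on M A D f" "open D" "z \<in> D" "f constant_on UNIV"
  shows "hspeed A E f z = 0"
proof -
  obtain y where y: "\<And>w. f w = y" using assms(4) by (auto simp: constant_on_def)
  have "hvel c f z = (\<lambda>i. 0)" for c by (auto simp: hvel_def y)
  moreover have "chart_at A (f z) \<in> A" "f z \<in> cdom (chart_at A (f z))"
    using chart_at[OF hol_on_in_topspace[OF assms(1,3)]] by auto
  ultimately show ?thesis by (simp add: hspeed_def tangent_length_zero)
qed

text \<open>Without divergence, the values at some moving points converge along an ultrafilter;
  \<open>converges_near\<close> yields convergence at a fixed point, and completeness yields it
  everywhere. In the limit the bound \<open>2\<close> on the speed gives a Brody curve, and the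
  value \<open>1\<close> at the origin makes it non-constant.\<close>

lemma convergence_of_rescaled:
  fixes g :: "nat \<Rightarrow> complex \<Rightarrow> 'm"
  assumes comp: "complete_metric M A E"
    and D: "\<And>j. open (D j)" "\<And>j. ball 0 (real (Suc j) / 2) \<subseteq> D j"
    and g: "\<And>j. hol_on M A (D j) (g j)"
    and speed: "\<And>j \<xi>. \<xi> \<in> ball 0 (real (Suc j) / 2) \<Longrightarrow> hspeed A E (g j) \<xi> \<le> 2"
    and speed0: "\<And>j. hspeed A E (g j) 0 = 1"
    and nd: "\<not> compactly_divergent M D g"
  obtains \<sigma> h where "strict_mono \<sigma>" "brody_curve M A E h" "\<not> h constant_on UNIV"
    "converges_uniformly_on_compacts M (\<lambda>j. D (\<sigma> j)) (\<lambda>j. g (\<sigma> j)) h"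
proof -
  have large: "eventually (\<lambda>j. ball z r \<subseteq> ball 0 (real (Suc j) / 2)) sequentially" for z :: complex and r
  proof -
    obtain N :: nat where N: "2 * (norm z + r) < real N" using reals_Archimedean2 by blast
    have "ball z r \<subseteq> ball 0 (real (Suc j) / 2)" if "j \<ge> N" for j
    proof
      fix w assume "w \<in> ball z r"
      then have "norm w \<le> norm z + r" using norm_triangle_ineq[of z "w - z"]
        by (simp add: dist_norm norm_minus_commute)
      then show "w \<in> ball 0 (real (Suc j) / 2)" using N that by simp
    qed
    then show ?thesis unfolding eventually_sequentially by blast
  qed
  have KD: "eventually (\<lambda>j. K \<subseteq> D j) sequentially" if K: "compact K" for K
  proof -
    obtain r where r: "K \<subseteq> ball 0 r" using compact_imp_bounded[OF K] bounded_subset_ballD by blast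
    show ?thesis using large[of 0 r] by eventually_elim (use r D(2) in blast)
  qed
  have bds: "locally_bounded_speed UNIV g sequentially"
    unfolding locally_bounded_speed_def
  proof
    fix z :: complex
    have "eventually (\<lambda>j. hol_on M A (ball z 1) (g j) \<and> (\<forall>w\<in>ball z 1. hspeed A E (g j) w \<le> 2)) sequentially"
      using large[of z 1]
    proof eventually_elim
      case (elim j)
      then show ?case using hol_on_subset[OF g order_trans[OF elim D(2)]] speed by blast
    qed
    then show "\<exists>\<delta>>0. \<exists>C\<ge>0. ball z \<delta> \<subseteq> UNIV \<and>
     eventually (\<lambda>j. hol_on M A (ball z \<delta>) (g j) \<and> (\<forall>w\<in>ball z \<delta>. hspeed A E (g j) w \<le> C)) sequentially"
      by (intro exI[of _ 1] conjI exI[of _ 2]) auto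
  qed
  obtain U \<xi> x y where U: "ultrafilter U" and Us: "U \<le> sequentially" and \<xi>: "(\<xi> \<longlongrightarrow> x) U"
    and y: "limitin M (\<lambda>j. g j (\<xi> j)) y U"
    by (rule not_compactly_divergentE[OF nd KD])
  have Ub: "U \<noteq> bot" by (rule ultrafilter_nontrivial[OF U])
  have bd: "locally_bounded_speed UNIV g U" by (rule locally_bounded_speed_mono[OF bds Us])
  obtain V \<delta> where V: "openin M V" "y \<in> V" and \<delta>: "\<delta> > 0"
    and L: "\<And>w. eventually (\<lambda>j. w j \<in> ball x \<delta> \<and> g j (w j) \<in> V) U \<Longrightarrow>
       \<exists>L. compactin M L \<and> eventually (\<lambda>j. \<forall>v\<in>ball x \<delta>. g j v \<in> L) U"
    by (rule converges_near[OF U bd UNIV_I limitin_topspace[OF y]]) blast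
  have "eventually (\<lambda>j. \<xi> j \<in> ball x \<delta>) U" using tendstoD[OF \<xi> \<delta>] by (simp add: dist_commute)
  then have "eventually (\<lambda>j. \<xi> j \<in> ball x \<delta> \<and> g j (\<xi> j) \<in> V) U"
    using limitinD[OF y V] by (rule eventually_conj)
  from L[OF this] obtain L where L: "compactin M L" "eventually (\<lambda>j. \<forall>v\<in>ball x \<delta>. g j v \<in> L) U"
    by blast
  have "eventually (\<lambda>j. g j x \<in> L) U" using L(2) by eventually_elim (use \<delta> in simp)
  then obtain y' where y': "limitin M (\<lambda>j. g j x) y' U"
    by (rule ultrafilter_limitin_compactin[OF U L(1)])
  have "\<forall>z. \<exists>y. limitin M (\<lambda>j. g j z) y U"
    using convergence_set_all[OF comp open_UNIV connected_UNIV U bd UNIV_I y' UNIV_I] by blast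
  then obtain h where h: "\<And>z. limitin M (\<lambda>j. g j z) (h z) U" by metis
  have hh: "hol_on M A UNIV h" by (rule limit_hol_on[OF Ub open_UNIV h bd])
  have hs: "((\<lambda>j. hspeed A E (g j) z) \<longlongrightarrow> hspeed A E h z) U" for z
    by (rule limit_hspeed[OF Ub open_UNIV h bd UNIV_I])
  have "hspeed A E h z \<le> 2" for z
  proof (rule tendsto_upperbound[OF hs _ Ub])
    show "eventually (\<lambda>j. hspeed A E (g j) z \<le> 2) U"
      using filter_leD[OF Us large[of z 1]] by eventually_elim (rule speed, erule subsetD, simp)
  qed
  then have brody: "brody_curve M A E h" unfolding brody_curve_iff using hh by blast
  have "hspeed A E h 0 = 1"
    using tendsto_unique[OF Ub hs[of 0], of 1] by (simp add: speed0)
  then have nc: "\<not> h constant_on UNIV" using hspeed_constant[OF hh open_UNIV UNIV_I] by force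
  obtain d0 where d0: "Metric_space (topspace M) d0" "Metric_space.mtopology (topspace M) d0 = M"
    by (rule metricE)
  have hc: "continuous_map euclidean M h" using hh by (simp add: hol_on_def)
  \<comment> \<open>Countably many conditions, each holding along \<open>U\<close>, of which
    \<open>ultrafilter_subseq\<close> meets the \<open>n\<close>-th at the \<open>n\<close>-th
    index. Growing discs and shrinking errors give convergence on every compact set.\<close>
  define P where "P = (\<lambda>n j. \<forall>z\<in>cball 0 (real n).
    g j z \<in> topspace M \<and> d0 (g j z) (h z) < 1 / real (Suc n))"
  have ev: "eventually (P n) U" for n
    unfolding P_def
  proof (rule Metric_space.uniform_on_compact[OF d0(1), unfolded d0(2)])
    show "continuous_map (top_of_set UNIV) M h" using hc by simp
    show "\<exists>\<delta>>0. eventually (\<lambda>j. \<forall>w\<in>ball z \<delta>. g j w \<in> V) U" if "openin M V" "h z \<in> V" for z V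
      by (rule limit_nbhd[OF Ub open_UNIV h bd UNIV_I that]) blast
  qed auto
  obtain \<sigma> where \<sigma>: "strict_mono \<sigma>" and \<sigma>P: "\<And>n. P n (\<sigma> n)"
    by (rule ultrafilter_subseq[where P = P, OF U Us ev], rule that)
  \<comment> \<open>The subsequence was chosen for the metric \<open>d0\<close>; the formulation by
    open sets frees it from that choice before an arbitrary metric \<open>d\<close> is
    considered.\<close>
  have near: "\<exists>\<delta>>0. eventually (\<lambda>n. \<forall>w\<in>ball z \<delta>. g (\<sigma> n) w \<in> V) sequentially"
    if V: "openin M V" "h z \<in> V" for z V
  proof (rule Metric_space.nbhd_of_uniform[OF d0(1), unfolded d0(2), OF hc _ V])
    fix \<epsilon> :: real assume \<epsilon>: "\<epsilon> > 0"
    obtain N1 :: nat where N1: "norm z + 1 < real N1" using reals_Archimedean2 by blast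
    obtain N2 :: nat where N2: "inverse (real (Suc N2)) < \<epsilon>" using reals_Archimedean[OF \<epsilon>] by blast
    have "\<forall>w\<in>ball z 1. g (\<sigma> n) w \<in> topspace M \<and> d0 (g (\<sigma> n) w) (h w) < \<epsilon>" if n: "n \<ge> max N1 N2" for n
    proof
      fix w assume "w \<in> ball z 1"
      then have "norm w \<le> norm z + 1" using norm_triangle_ineq[of z "w - z"]
        by (simp add: dist_norm norm_minus_commute)
      then have "w \<in> cball 0 (real n)" using N1 n by simp
      then have "g (\<sigma> n) w \<in> topspace M \<and> d0 (g (\<sigma> n) w) (h w) < 1 / real (Suc n)"
        using \<sigma>P[of n] unfolding P_def by blast
      moreover have "1 / real (Suc n) \<le> inverse (real (Suc N2))"
        using n by (simp add: inverse_eq_divide frac_le)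
      ultimately show "g (\<sigma> n) w \<in> topspace M \<and> d0 (g (\<sigma> n) w) (h w) < \<epsilon>" using N2 by linarith
    qed
    then show "eventually (\<lambda>n. \<forall>w\<in>ball z 1. g (\<sigma> n) w \<in> topspace M \<and> d0 (g (\<sigma> n) w) (h w) < \<epsilon>) sequentially"
      unfolding eventually_sequentially by blast
  qed
  have "converges_uniformly_on_compacts M (\<lambda>j. D (\<sigma> j)) (\<lambda>j. g (\<sigma> j)) h"
    unfolding converges_uniformly_on_compacts_def
  proof (intro allI impI)
    fix d and K :: "complex set" and \<epsilon> :: real
    assume d: "Metric_space (topspace M) d \<and> Metric_space.mtopology (topspace M) d = M"
      and K\<epsilon>: "compact K \<and> \<epsilon> > 0"
    have 1: "eventually (\<lambda>j. \<forall>z\<in>K. g (\<sigma> j) z \<in> topspace M \<and> d (g (\<sigma> j) z) (h z) < \<epsilon>) sequentially"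
    proof (rule Metric_space.uniform_on_compact[OF conjunct1[OF d], unfolded conjunct2[OF d]])
      show "continuous_map (top_of_set UNIV) M h" using hc by simp
      show "\<exists>\<delta>>0. eventually (\<lambda>j. \<forall>w\<in>ball z \<delta>. g (\<sigma> j) w \<in> V) sequentially"
        if "openin M V" "h z \<in> V" for z V by (rule near[OF that])
    qed (use K\<epsilon> in auto)
    have "eventually (\<lambda>j. K \<subseteq> D j) sequentially" using KD K\<epsilon> by blast
    from this have 2: "eventually (\<lambda>j. K \<subseteq> D (\<sigma> j)) sequentially"
      by (rule eventually_subseq[OF \<sigma>])
    from eventually_conj[OF 1 2]
    show "\<exists>j0. \<forall>j\<ge>j0. K \<subseteq> D (\<sigma> j) \<and> (\<forall>z\<in>K. d (g (\<sigma> j) z) (h z) < \<epsilon>)"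
      unfolding eventually_sequentially by blast
  qed
  then show thesis by (rule that[OF \<sigma> brody nc])
qed

subsection \<open>Normality\<close>

lemma topspace_compact_open: "topspace (compact_open_topology \<Omega> M A) = Hol \<Omega> M A"
proof -
  have "Hol \<Omega> M A \<in> {{f \<in> Hol \<Omega> M A. f ` K \<subseteq> U} | K U. compact K \<and> K \<subseteq> \<Omega> \<and> openin M U}"
    by (intro CollectI exI[of _ "{}"]) auto
  then show ?thesis
    unfolding compact_open_topology_def topology_generated_by_topspace by blast
qed

lemma openin_compact_open_basis:
  assumes "compact K" "K \<subseteq> \<Omega>" "openin M U"
  shows "openin (compact_open_topology \<Omega> M A) {f \<in> Hol \<Omega> M A. f ` K \<subseteq> U}"
  unfolding compact_open_topology_def by (rule topology_generated_by_Basis) (use assms in blast)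

text \<open>Finite intersections and unions preserve eventual membership, so it is enough to test
  the generating sets of the topology.\<close>

lemma compact_open_limitin:
  assumes f: "f \<in> Hol \<Omega> M A" and ev: "eventually (\<lambda>j. g j \<in> Hol \<Omega> M A) F"
    and co: "\<And>K U. \<lbrakk>compact K; K \<subseteq> \<Omega>; openin M U; f ` K \<subseteq> U\<rbrakk> \<Longrightarrow> eventually (\<lambda>j. g j ` K \<subseteq> U) F"
  shows "limitin (compact_open_topology \<Omega> M A) g f F"
  unfolding limitin_def
proof (intro conjI allI impI)
  show "f \<in> topspace (compact_open_topology \<Omega> M A)" by (simp add: topspace_compact_open f)
  fix W assume "openin (compact_open_topology \<Omega> M A) W \<and> f \<in> W"
  then have W: "generate_topology_on {{f \<in> Hol \<Omega> M A. f ` K \<subseteq> U} | K U. compact K \<and> K \<subseteq> \<Omega> \<and> openin M U} W"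
    and "f \<in> W"
    by (auto simp: compact_open_topology_def openin_topology_generated_by_iff)
  from this show "eventually (\<lambda>j. g j \<in> W) F"
  proof induction
    case (Int a b)
    then have "eventually (\<lambda>j. g j \<in> a) F" "eventually (\<lambda>j. g j \<in> b) F" by auto
    then show ?case by eventually_elim simp
  next
    case (UN \<K>)
    then obtain k where k: "k \<in> \<K>" "f \<in> k" by blast
    then have "eventually (\<lambda>j. g j \<in> k) F" using UN by blast
    then show ?case by eventually_elim (use k in blast)
  next
    case (Basis s)
    then obtain K U where s: "s = {f \<in> Hol \<Omega> M A. f ` K \<subseteq> U}" "compact K" "K \<subseteq> \<Omega>" "openin M U" by blast
    have "f ` K \<subseteq> U" using Basis s(1) by blast
    with s have "eventually (\<lambda>j. g j ` K \<subseteq> U) F" by (intro co) auto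
    with ev show ?case by eventually_elim (simp add: s(1))
  qed simp
qed

text \<open>The regularity that \<open>compactin_closure_of_ultrafilter\<close> asks of the space of
  maps. For a generating set, the compact image of \<open>K\<close> and the complement of
  \<open>U\<close> have disjoint neighbourhoods \<open>V\<close> and \<open>V'\<close> in
  \<open>M\<close>, and avoiding \<open>V'\<close> on \<open>K\<close> is a closed condition on
  maps.\<close>

lemma compact_open_regular:
  assumes "openin (compact_open_topology \<Omega> M A) W" "f \<in> W"
  shows "\<exists>V. openin (compact_open_topology \<Omega> M A) V \<and> f \<in> V \<and>
    compact_open_topology \<Omega> M A closure_of V \<subseteq> W"
proof -
  let ?T = "compact_open_topology \<Omega> M A"
  have "generate_topology_on {{f \<in> Hol \<Omega> M A. f ` K \<subseteq> U} | K U. compact K \<and> K \<subseteq> \<Omega> \<and> openin M U} W"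
    using assms(1) by (simp add: compact_open_topology_def openin_topology_generated_by_iff)
  from this assms(2) show ?thesis
  proof induction
    case (Int a b)
    then obtain V1 V2 where "openin ?T V1" "f \<in> V1" "?T closure_of V1 \<subseteq> a"
      "openin ?T V2" "f \<in> V2" "?T closure_of V2 \<subseteq> b" by auto
    moreover have "?T closure_of (V1 \<inter> V2) \<subseteq> ?T closure_of V1" "?T closure_of (V1 \<inter> V2) \<subseteq> ?T closure_of V2"
      by (rule closure_of_mono; blast)+
    ultimately show ?case by (intro exI[of _ "V1 \<inter> V2"]) auto
  next
    case (UN \<K>)
    then obtain k where k: "k \<in> \<K>" "f \<in> k" by blast
    then obtain V where "openin ?T V" "f \<in> V" "?T closure_of V \<subseteq> k" using UN by blast
    then show ?case using k by (intro exI[of _ V]) auto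
  next
    case (Basis s)
    then obtain K U where s: "s = {f \<in> Hol \<Omega> M A. f ` K \<subseteq> U}" "compact K" "K \<subseteq> \<Omega>" "openin M U" by blast
    have f: "f \<in> Hol \<Omega> M A" "f ` K \<subseteq> U" using Basis s(1) by auto
    have "continuous_map (top_of_set \<Omega>) M f" using f(1) by (simp add: Hol_def)
    moreover have "compactin (top_of_set \<Omega>) K" using s(2,3) by (simp add: compactin_subtopology)
    ultimately have fK: "compactin M (f ` K)" by (rule image_compactin[rotated])
    have "closedin M (topspace M - U)" using s(4) by blast
    moreover have "disjnt (f ` K) (topspace M - U)" using f(2) by (auto simp: disjnt_def)
    ultimately obtain V V' where V: "openin M V" "openin M V'" "f ` K \<subseteq> V" "topspace M - U \<subseteq> V'" "disjnt V V'"
      using regular_space_compact_closed_separation[OF regular fK] by metis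
    define N where "N = {h \<in> Hol \<Omega> M A. h ` K \<subseteq> V}"
    define C where "C = {h \<in> Hol \<Omega> M A. h ` K \<subseteq> topspace M - V'}"
    have op: "openin ?T N" unfolding N_def by (rule openin_compact_open_basis[OF s(2,3) V(1)])
    have tm: "h z \<in> topspace M" if "h \<in> Hol \<Omega> M A" "z \<in> K" for h z
      using that s(3) by (auto simp: Hol_iff intro: hol_on_in_topspace)
    \<comment> \<open>A map outside \<open>C\<close> has a value in \<open>V'\<close> at some point
      \<open>z\<close> of \<open>K\<close>, which is an open condition because \<open>{z}\<close> is
      compact.\<close>
    have "Hol \<Omega> M A - C = (\<Union>z\<in>K. {h \<in> Hol \<Omega> M A. h ` {z} \<subseteq> V'})"
      by (auto simp: C_def image_subset_iff dest: tm)
    also have "openin ?T \<dots>"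
      using s(3) V(2) by (intro openin_Union ballI) (auto intro!: openin_compact_open_basis[of "{_}", simplified])
    finally have "closedin ?T C" by (auto simp: closedin_def topspace_compact_open C_def)
    moreover have "N \<subseteq> C"
      using V(1,5) openin_subset[OF V(1)] by (auto simp: N_def C_def disjnt_iff)
    ultimately have "?T closure_of N \<subseteq> C" by (simp add: closure_of_minimal)
    also have "C \<subseteq> s" using V(4) by (auto simp: C_def s(1))
    finally show ?case using op f(1) V(3) by (intro exI[of _ N]) (auto simp: N_def)
  qed simp
qed

text \<open>The ultrafilter lives on the family, each map being its own index. It converges
  pointwise by \<open>pt\<close>; the bound on the speed makes the limit holomorphic and the
  convergence locally uniform, hence compact-open.\<close>

lemma normal_family_criterion:
  assumes \<Omega>: "open \<Omega>" and \<F>: "\<F> \<subseteq> Hol \<Omega> M A"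
    and speed: "\<And>z. z \<in> \<Omega> \<Longrightarrow> \<exists>\<delta>>0. \<exists>C. \<forall>f\<in>\<F>. \<forall>w\<in>\<Omega> \<inter> ball z \<delta>. hspeed A E f w \<le> C"
    and pt: "\<And>z. z \<in> \<Omega> \<Longrightarrow> \<exists>L. compactin M L \<and> (\<forall>f\<in>\<F>. f z \<in> L)"
  shows "normal_family \<Omega> M A \<F>"
  unfolding normal_family_def
proof (rule compactin_closure_of_ultrafilter)
  show "\<F> \<subseteq> topspace (compact_open_topology \<Omega> M A)" using \<F> by (simp add: topspace_compact_open)
  show "\<exists>V. openin (compact_open_topology \<Omega> M A) V \<and> f \<in> V \<and> compact_open_topology \<Omega> M A closure_of V \<subseteq> W"
    if "openin (compact_open_topology \<Omega> M A) W" "f \<in> W" for W f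
    using that by (rule compact_open_regular)
  fix U :: "(complex \<Rightarrow> 'm) filter"
  assume U: "ultrafilter U" and ev: "eventually (\<lambda>f. f \<in> \<F>) U"
  have Ub: "U \<noteq> bot" by (rule ultrafilter_nontrivial[OF U])
  have "\<exists>y. limitin M (\<lambda>f. f z) y U" if z: "z \<in> \<Omega>" for z
  proof -
    obtain L where L: "compactin M L" "\<forall>f\<in>\<F>. f z \<in> L" using pt[OF z] by blast
    have "eventually (\<lambda>f. f z \<in> L) U" using ev by eventually_elim (use L in blast)
    then show ?thesis by (rule ultrafilter_limitin_compactin[OF U L(1)]) blast
  qed
  then have "\<forall>z\<in>\<Omega>. \<exists>y. limitin M (\<lambda>f. f z) y U" by blast
  from bchoice[OF this] obtain h0 where h0: "\<forall>z\<in>\<Omega>. limitin M (\<lambda>f. f z) (h0 z) U" by blast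
  \<comment> \<open>Elements of \<open>Hol\<close> are \<open>undefined\<close> off
    \<open>\<Omega>\<close>, so the limit is cut down accordingly.\<close>
  define h where "h = restrict h0 \<Omega>"
  have h: "limitin M (\<lambda>f. f z) (h z) U" if "z \<in> \<Omega>" for z using h0 that by (simp add: h_def)
  have bd: "locally_bounded_speed \<Omega> (\<lambda>f. f) U"
    unfolding locally_bounded_speed_def
  proof
    fix z assume z: "z \<in> \<Omega>"
    obtain \<delta> C where \<delta>: "\<delta> > 0" "\<forall>f\<in>\<F>. \<forall>w\<in>\<Omega> \<inter> ball z \<delta>. hspeed A E f w \<le> C"
      using speed[OF z] by blast
    obtain e where e: "e > 0" "ball z e \<subseteq> \<Omega>" using \<Omega> z open_contains_ball by blast
    define r where "r = min \<delta> e"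
    have r: "r > 0" "ball z r \<subseteq> \<Omega>" "ball z r \<subseteq> ball z \<delta>"
      using \<delta> e subset_ball[of r e z] subset_ball[of r \<delta> z] by (auto simp: r_def)
    \<comment> \<open>\<open>locally_bounded_speed\<close> asks for a nonnegative constant, and
      \<open>C\<close> is not known to be one.\<close>
    have ev': "eventually (\<lambda>f. hol_on M A (ball z r) f \<and> (\<forall>w\<in>ball z r. hspeed A E f w \<le> max C 0)) U"
      using ev
    proof eventually_elim
      case (elim f)
      have "hol_on M A \<Omega> f" using elim \<F> by (auto simp: Hol_iff)
      moreover have "hspeed A E f w \<le> max C 0" if "w \<in> ball z r" for w
      proof -
        have "hspeed A E f w \<le> C" using \<delta>(2) elim that r by blast
        then show ?thesis by simp
      qed
      ultimately show ?case using hol_on_subset r(2) by blast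
    qed
    show "\<exists>\<delta>>0. \<exists>C\<ge>0. ball z \<delta> \<subseteq> \<Omega> \<and>
       eventually (\<lambda>f. hol_on M A (ball z \<delta>) f \<and> (\<forall>w\<in>ball z \<delta>. hspeed A E f w \<le> C)) U"
      using r ev' by (intro exI[of _ r] conjI exI[of _ "max C 0"]) auto
  qed
  have hH: "h \<in> Hol \<Omega> M A"
  proof -
    have "hol_on M A \<Omega> h" by (rule limit_hol_on[OF Ub \<Omega> h bd])
    moreover have "h \<in> extensional \<Omega>" by (simp add: h_def)
    ultimately show ?thesis by (simp add: Hol_iff)
  qed
  have "limitin (compact_open_topology \<Omega> M A) (\<lambda>f. f) h U"
  proof (rule compact_open_limitin[OF hH])
    show "eventually (\<lambda>f. f \<in> Hol \<Omega> M A) U" using ev by eventually_elim (use \<F> in blast)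
    show "eventually (\<lambda>f. f ` K \<subseteq> V) U" if "compact K" "K \<subseteq> \<Omega>" "openin M V" "h ` K \<subseteq> V" for K V
      by (rule limit_compact_open[OF Ub \<Omega> h bd that])
  qed
  then show "\<exists>h. limitin (compact_open_topology \<Omega> M A) (\<lambda>f. f) h U" by blast
qed

text \<open>If the rescaled maps did not diverge, moving points tending to \<open>z\<close> would
  have images converging in \<open>M\<close> along an ultrafilter. Then
  \<open>converges_near\<close> would hold \<open>f j z\<close> in one compact set, against
  \<open>f j z \<notin> L j\<close> for an exhaustion \<open>L\<close>. The argument uses only that
  \<open>\<rho>\<close> tends to \<open>0\<close>, so the reciprocals of \<open>j + 1\<close>
  serve.\<close>

lemma pointwise_unbounded_imp_divergent:
  assumes \<Omega>: "open \<Omega>" and \<F>: "\<And>f. f \<in> \<F> \<Longrightarrow> hol_on M A \<Omega> f" and z: "z \<in> \<Omega>"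
    and speed: "\<delta> > 0" "\<forall>f\<in>\<F>. \<forall>w\<in>\<Omega> \<inter> ball z \<delta>. hspeed A E f w \<le> C"
    and unb: "\<And>L. compactin M L \<Longrightarrow> \<exists>f\<in>\<F>. f z \<notin> L"
  obtains f :: "nat \<Rightarrow> complex \<Rightarrow> 'm" where "range f \<subseteq> \<F>"
    "compactly_divergent M (\<lambda>j. {\<xi>. z + of_real (inverse (real (Suc j))) * \<xi> \<in> \<Omega>})
       (\<lambda>j \<xi>. f j (z + of_real (inverse (real (Suc j))) * \<xi>))"
proof -
  obtain L :: "nat \<Rightarrow> 'm set" where L: "\<And>n. compactin M (L n)"
    "\<And>K. compactin M K \<Longrightarrow> eventually (\<lambda>n. K \<subseteq> L n) sequentially"
    by (rule compact_exhaustion, rule that)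
  have "\<forall>n. \<exists>f. f \<in> \<F> \<and> f z \<notin> L n" using unb[OF L(1)] by blast
  from choice[OF this] obtain f where f: "\<And>n. f n \<in> \<F> \<and> f n z \<notin> L n" by blast
  define \<rho> where "\<rho> = (\<lambda>j. inverse (real (Suc j)))"
  have \<rho>: "\<rho> \<longlonglongrightarrow> 0" unfolding \<rho>_def by (rule LIMSEQ_inverse_real_of_nat)
  obtain e where e: "e > 0" "ball z e \<subseteq> \<Omega>" using \<Omega> z open_contains_ball by blast
  define r where "r = min \<delta> e"
  have r: "r > 0" "ball z r \<subseteq> \<Omega>" "ball z r \<subseteq> ball z \<delta>"
    using speed(1) e subset_ball[of r e z] subset_ball[of r \<delta> z] by (auto simp: r_def)
  have bds: "locally_bounded_speed (ball z r) f sequentially"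
    unfolding locally_bounded_speed_def
  proof
    fix w assume "w \<in> ball z r"
    then obtain s where s: "s > 0" "ball w s \<subseteq> ball z r" by (meson open_ball open_contains_ball)
    have "eventually (\<lambda>j. hol_on M A (ball w s) (f j) \<and> (\<forall>v\<in>ball w s. hspeed A E (f j) v \<le> max C 0)) sequentially"
    proof (intro always_eventually allI conjI ballI)
      show "hol_on M A (ball w s) (f j)" for j
        using hol_on_subset[OF \<F>] f s r by (meson order_trans)
      fix j v assume "v \<in> ball w s"
      then have "v \<in> \<Omega> \<inter> ball z \<delta>" using s r by blast
      then have "hspeed A E (f j) v \<le> C" using speed(2) f by blast
      then show "hspeed A E (f j) v \<le> max C 0" by simp
    qed
    then show "\<exists>\<delta>>0. \<exists>C\<ge>0. ball w \<delta> \<subseteq> ball z r \<and>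
       eventually (\<lambda>j. hol_on M A (ball w \<delta>) (f j) \<and> (\<forall>w\<in>ball w \<delta>. hspeed A E (f j) w \<le> C)) sequentially"
      using s by (intro exI[of _ s] conjI exI[of _ "max C 0"]) auto
  qed
  have "compactly_divergent M (\<lambda>j. {\<xi>. z + of_real (\<rho> j) * \<xi> \<in> \<Omega>}) (\<lambda>j \<xi>. f j (z + of_real (\<rho> j) * \<xi>))"
    (is "compactly_divergent M ?D ?g")
  proof (rule ccontr)
    assume nd: "\<not> ?thesis"
    have KD: "eventually (\<lambda>j. K \<subseteq> ?D j) sequentially" if K: "compact K" for K
    proof -
      obtain b where b: "b > 0" "\<And>\<xi>. \<xi> \<in> K \<Longrightarrow> norm \<xi> \<le> b"
        using compact_imp_bounded[OF K] unfolding bounded_pos by blast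
      have "eventually (\<lambda>j. dist (\<rho> j) 0 < e / b) sequentially"
        using tendstoD[OF \<rho>, of "e / b"] e b by simp
      then show ?thesis
      proof eventually_elim
        case (elim j)
        have "z + of_real (\<rho> j) * \<xi> \<in> ball z e" if "\<xi> \<in> K" for \<xi>
        proof -
          have "dist z (z + of_real (\<rho> j) * \<xi>) = \<bar>\<rho> j\<bar> * norm \<xi>" by (simp add: dist_norm norm_mult)
          also have "\<dots> \<le> \<bar>\<rho> j\<bar> * b" using b that by (intro mult_left_mono) auto
          also have "\<dots> < e" using elim b by (simp add: field_simps)
          finally show ?thesis by simp
        qed
        then show ?case using e by blast
      qed
    qed
    obtain U \<xi> x y where U: "ultrafilter U" and Us: "U \<le> sequentially" and \<xi>: "(\<xi> \<longlongrightarrow> x) U"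
      and y: "limitin M (\<lambda>j. ?g j (\<xi> j)) y U"
      by (rule not_compactly_divergentE[OF nd KD])
    have bd: "locally_bounded_speed (ball z r) f U" by (rule locally_bounded_speed_mono[OF bds Us])
    have zr: "z \<in> ball z r" using r by simp
    obtain V \<eta> where V: "openin M V" "y \<in> V" and \<eta>: "\<eta> > 0"
      and LL: "\<And>w. eventually (\<lambda>j. w j \<in> ball z \<eta> \<and> f j (w j) \<in> V) U \<Longrightarrow>
         \<exists>L. compactin M L \<and> eventually (\<lambda>j. \<forall>v\<in>ball z \<eta>. f j v \<in> L) U"
      by (rule converges_near[OF U bd zr limitin_topspace[OF y]]) blast
    have "(\<rho> \<longlongrightarrow> 0) U" using \<rho> Us by (rule tendsto_mono[rotated])
    then have "((\<lambda>j. z + of_real (\<rho> j) * \<xi> j) \<longlongrightarrow> z + of_real 0 * x) U"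
      by (intro tendsto_intros \<xi>)
    then have "eventually (\<lambda>j. z + of_real (\<rho> j) * \<xi> j \<in> ball z \<eta>) U"
      using tendstoD[of "\<lambda>j. z + of_real (\<rho> j) * \<xi> j" z U \<eta>] \<eta> by (simp add: dist_commute)
    then have "eventually (\<lambda>j. z + of_real (\<rho> j) * \<xi> j \<in> ball z \<eta> \<and> f j (z + of_real (\<rho> j) * \<xi> j) \<in> V) U"
      using limitinD[OF y V] by (rule eventually_conj)
    from LL[OF this] obtain K where K: "compactin M K" "eventually (\<lambda>j. \<forall>v\<in>ball z \<eta>. f j v \<in> K) U" by blast
    have zK: "z \<in> ball z \<eta>" using \<eta> by simp
    have "eventually (\<lambda>j. False) U"
      using filter_leD[OF Us L(2)[OF K(1)]] K(2)
    proof eventually_elim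
      case (elim j)
      then have "f j z \<in> L j" using zK by blast
      then show ?case using f[of j] by blast
    qed
    then show False using ultrafilter_nontrivial[OF U] by (simp add: trivial_limit_def)
  qed
  then show thesis using f unfolding \<rho>_def by (intro that[of f]) auto
qed

text \<open>Compactness of the closure gives a limit \<open>h\<close> of \<open>f\<close> along an
  ultrafilter. As \<open>p j + \<rho> j * \<xi>\<close> tends to \<open>p0\<close> for every
  \<open>\<xi>\<close>, convergence on a disc about \<open>p0\<close> sends all of them to the same
  \<open>y\<close>, namely \<open>h p0\<close>.\<close>

lemma normal_family_limit:
  assumes \<Omega>: "open \<Omega>" and \<F>: "\<F> \<subseteq> Hol \<Omega> M A" and nf: "normal_family \<Omega> M A \<F>"
    and f: "range f \<subseteq> \<F>" and p: "p0 \<in> \<Omega>" "p \<longlonglongrightarrow> p0" and \<rho>: "\<rho> \<longlonglongrightarrow> 0"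
  obtains U y where "ultrafilter U" "U \<le> sequentially"
    "\<And>\<xi>. limitin M (\<lambda>j. f j (p j + of_real (\<rho> j) * \<xi>)) y U"
proof -
  let ?T = "compact_open_topology \<Omega> M A"
  obtain U :: "nat filter" where U: "ultrafilter U" "U \<le> sequentially"
    by (rule ultrafilter_below[OF sequentially_bot])
  have "\<F> \<subseteq> ?T closure_of \<F>" using \<F> by (intro closure_of_subset) (simp add: topspace_compact_open)
  then have "eventually (\<lambda>j. f j \<in> ?T closure_of \<F>) U" using f by (intro always_eventually) blast
  then obtain h where h: "limitin ?T f h U"
    by (rule ultrafilter_limitin_compactin[OF U(1) nf[unfolded normal_family_def]])
  have hH: "h \<in> Hol \<Omega> M A" using limitin_topspace[OF h] by (simp add: topspace_compact_open)
  then have hh: "hol_on M A \<Omega> h" by (simp add: Hol_iff)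
  have "limitin M (\<lambda>j. f j (p j + of_real (\<rho> j) * \<xi>)) (h p0) U" for \<xi>
    unfolding limitin_def
  proof (intro conjI allI impI)
    show "h p0 \<in> topspace M" by (rule hol_on_in_topspace[OF hh p(1)])
    fix V assume V: "openin M V \<and> h p0 \<in> V"
    then have "open {z\<in>\<Omega>. h z \<in> V}" using hol_on_open_preimage[OF hh \<Omega>] by blast
    then obtain r where r: "r > 0" "cball p0 r \<subseteq> {z\<in>\<Omega>. h z \<in> V}"
      using p(1) V open_contains_cball by blast
    have "openin ?T {f \<in> Hol \<Omega> M A. f ` cball p0 r \<subseteq> V}"
      using r V by (intro openin_compact_open_basis) auto
    moreover have "h \<in> {f \<in> Hol \<Omega> M A. f ` cball p0 r \<subseteq> V}" using hH r(2) by blast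
    ultimately have 1: "eventually (\<lambda>j. f j \<in> {f \<in> Hol \<Omega> M A. f ` cball p0 r \<subseteq> V}) U"
      by (rule limitinD[OF h])
    have "(\<lambda>j. p j + of_real (\<rho> j) * \<xi>) \<longlonglongrightarrow> p0 + of_real 0 * \<xi>"
      by (intro tendsto_intros p(2) \<rho>)
    then have "eventually (\<lambda>j. dist (p j + of_real (\<rho> j) * \<xi>) p0 < r) sequentially"
      using tendstoD[OF _ r(1)] by fastforce
    from filter_leD[OF U(2) this] 1 show "eventually (\<lambda>j. f j (p j + of_real (\<rho> j) * \<xi>) \<in> V) U"
      by eventually_elim (auto simp: image_subset_iff dist_commute less_imp_le)
  qed
  then show thesis by (rule that[OF U])
qed

end

section \<open>Non-normality as divergence or a Brody limit of rescalings\<close>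

theorem theorem1p8:
  fixes \<Omega> :: "complex set" and M :: "'m topology" and A :: "'m chart set"
    and E :: "'m metric_data" and \<F> :: "(complex \<Rightarrow> 'm) set"
  assumes "open \<Omega>" and "connected \<Omega>" and "\<Omega> \<noteq> {}"
    and "complete_hermitian_space M A E"
    and "\<F> \<subseteq> Hol \<Omega> M A"
  shows "\<not> normal_family \<Omega> M A \<F> \<longleftrightarrow>
    (\<exists>(p :: nat \<Rightarrow> complex) p0 (f :: nat \<Rightarrow> complex \<Rightarrow> 'm) (\<rho> :: nat \<Rightarrow> real).
       range p \<subseteq> \<Omega> \<and> p0 \<in> \<Omega> \<and> p \<longlonglongrightarrow> p0 \<and>
       range f \<subseteq> \<F> \<and>
       (\<forall>j. \<rho> j > 0) \<and> \<rho> \<longlonglongrightarrow> 0 \<and>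
       (let D = (\<lambda>j. {\<xi>. p j + of_real (\<rho> j) * \<xi> \<in> \<Omega>});
            g = (\<lambda>j \<xi>. f j (p j + of_real (\<rho> j) * \<xi>))
        in compactly_divergent M D g \<or>
           (\<exists>h. converges_uniformly_on_compacts M D g h \<and> brody_curve M A E h \<and>
                \<not> h constant_on UNIV)))"
    (is "_ \<longleftrightarrow> ?R")
proof -
  interpret hermitian_space M A E
    by unfold_locales (use assms(4) in \<open>simp_all add: complete_hermitian_space_def\<close>)
  have comp: "complete_metric M A E" using assms(4) by (simp add: complete_hermitian_space_def)
  have hol: "hol_on M A \<Omega> f" if "f \<in> \<F>" for f using assms(5) that by (auto simp: Hol_iff)
  show ?thesis
  proof
    assume nn: "\<not> normal_family \<Omega> M A \<F>"
    show ?R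
    proof (cases "\<forall>z\<in>\<Omega>. \<exists>\<delta>>0. \<exists>C. \<forall>f\<in>\<F>. \<forall>w\<in>\<Omega> \<inter> ball z \<delta>. hspeed A E f w \<le> C")
      \<comment> \<open>With locally bounded speeds, normality can fail only by escape at a point
        \<open>z\<close>, and all centres are taken there.\<close>
      case True
      then have "\<not> (\<forall>z\<in>\<Omega>. \<exists>L. compactin M L \<and> (\<forall>f\<in>\<F>. f z \<in> L))"
        using normal_family_criterion[OF assms(1,5)] nn by blast
      then obtain z where z: "z \<in> \<Omega>" "\<And>L. compactin M L \<Longrightarrow> \<exists>f\<in>\<F>. f z \<notin> L" by blast
      obtain \<delta> C where \<delta>: "\<delta> > 0" "\<forall>f\<in>\<F>. \<forall>w\<in>\<Omega> \<inter> ball z \<delta>. hspeed A E f w \<le> C"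
        using True z(1) by blast
      obtain f :: "nat \<Rightarrow> complex \<Rightarrow> 'm" where f: "range f \<subseteq> \<F>"
        "compactly_divergent M (\<lambda>j. {\<xi>. z + of_real (inverse (real (Suc j))) * \<xi> \<in> \<Omega>})
           (\<lambda>j \<xi>. f j (z + of_real (inverse (real (Suc j))) * \<xi>))"
        by (rule pointwise_unbounded_imp_divergent[OF assms(1) hol z(1) \<delta> z(2)])
      have "(\<lambda>j. inverse (real (Suc j))) \<longlonglongrightarrow> 0" by (rule LIMSEQ_inverse_real_of_nat)
      then show ?R using f z(1)
        by (intro exI[of _ "\<lambda>_. z"] exI[of _ z] exI[of _ f] exI[of _ "\<lambda>j. inverse (real (Suc j))"])
          (simp add: image_subset_iff del: of_nat_Suc)
    next
      case False
      then obtain p0 where p0: "p0 \<in> \<Omega>"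
        and "\<not> (\<exists>\<delta>>0. \<exists>C. \<forall>f\<in>\<F>. \<forall>w\<in>\<Omega> \<inter> ball p0 \<delta>. hspeed A E f w \<le> C)" by blast
      then have nb: "\<exists>f\<in>\<F>. \<exists>q\<in>ball p0 \<delta>. C < hspeed A E f q" if "\<delta> > 0" for \<delta> C
        using that by (meson IntD2 not_le)
      obtain p :: "nat \<Rightarrow> complex" and f \<rho> where p: "range p \<subseteq> \<Omega>" "p \<longlonglongrightarrow> p0" and f: "range f \<subseteq> \<F>"
        and \<rho>: "\<And>n. \<rho> n > 0" "\<rho> \<longlonglongrightarrow> 0" and s0: "\<And>n. \<rho> n * hspeed A E (f n) (p n) = 1"
        and s: "\<And>n \<xi>. cmod \<xi> \<le> real (Suc n) / 2 \<Longrightarrow>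
          p n + of_real (\<rho> n) * \<xi> \<in> \<Omega> \<and> \<rho> n * hspeed A E (f n) (p n + of_real (\<rho> n) * \<xi>) \<le> 2"
        by (rule zalcman_rescaling[OF assms(1) hol p0 nb]; (assumption | rule that)+)
      define D where "D = (\<lambda>j. {\<xi>. p j + of_real (\<rho> j) * \<xi> \<in> \<Omega>})"
      define g where "g = (\<lambda>j \<xi>. f j (p j + of_real (\<rho> j) * \<xi>))"
      show ?R
      proof (cases "compactly_divergent M D g")
        case True
        then show ?R using p p0 f \<rho> unfolding D_def g_def Let_def by blast
      next
        case nd: False
        have fj: "hol_on M A \<Omega> (f j)" for j using f hol by blast
        have oD: "open (D j)" and hg: "hol_on M A (D j) (g j)" for j
          using hol_rescale(1,2)[OF fj[of j] assms(1), of "D j" "p j" "\<rho> j" "g j"] \<rho>(1)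
          by (simp_all add: D_def g_def)
        have sg: "hspeed A E (g j) \<xi> = \<rho> j * hspeed A E (f j) (p j + of_real (\<rho> j) * \<xi>)"
          if "\<xi> \<in> D j" for j \<xi>
          using hol_rescale(3)[OF fj[of j] assms(1), of "D j" "p j" "\<rho> j" "g j" \<xi>] \<rho>(1) that
          by (simp add: D_def g_def)
        have bD: "ball 0 (real (Suc j) / 2) \<subseteq> D j" for j using s[of _ j] by (auto simp: D_def)
        have sp: "hspeed A E (g j) \<xi> \<le> 2" if "\<xi> \<in> ball 0 (real (Suc j) / 2)" for j \<xi>
          using sg[of \<xi> j] s[of \<xi> j] bD[of j] that by auto
        have "0 \<in> D j" for j using p(1) by (auto simp: D_def)
        then have sp0: "hspeed A E (g j) 0 = 1" for j using sg[of 0 j] s0[of j] by simp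
        obtain \<sigma> h where \<sigma>: "strict_mono \<sigma>" and h: "brody_curve M A E h" "\<not> h constant_on UNIV"
          "converges_uniformly_on_compacts M (\<lambda>j. D (\<sigma> j)) (\<lambda>j. g (\<sigma> j)) h"
          by (rule convergence_of_rescaled[OF comp oD bD hg sp sp0 nd])
        show ?R
        \<comment> \<open>The subsequence is absorbed into \<open>p\<close>, \<open>f\<close> and
          \<open>\<rho>\<close>, since convergence is asked of the full rescaled sequence.\<close>
        proof (intro exI[of _ "p \<circ> \<sigma>"] exI[of _ p0] exI[of _ "f \<circ> \<sigma>"] exI[of _ "\<rho> \<circ> \<sigma>"] conjI)
          show "range (p \<circ> \<sigma>) \<subseteq> \<Omega>" "range (f \<circ> \<sigma>) \<subseteq> \<F>" "\<forall>j. 0 < (\<rho> \<circ> \<sigma>) j" using p f \<rho> by auto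
          show "(p \<circ> \<sigma>) \<longlonglongrightarrow> p0" "(\<rho> \<circ> \<sigma>) \<longlonglongrightarrow> 0"
            by (rule LIMSEQ_subseq_LIMSEQ[OF _ \<sigma>], fact)+
          show "let D = \<lambda>j. {\<xi>. (p \<circ> \<sigma>) j + of_real ((\<rho> \<circ> \<sigma>) j) * \<xi> \<in> \<Omega>};
              g = \<lambda>j \<xi>. (f \<circ> \<sigma>) j ((p \<circ> \<sigma>) j + of_real ((\<rho> \<circ> \<sigma>) j) * \<xi>)
            in compactly_divergent M D g \<or>
              (\<exists>h. converges_uniformly_on_compacts M D g h \<and> brody_curve M A E h \<and> \<not> h constant_on UNIV)"
            using h unfolding Let_def D_def g_def by auto
        qed (rule p0)
      qed
    qed
  next
    assume ?R
    then obtain p p0 f \<rho> where p: "p0 \<in> \<Omega>" "p \<longlonglongrightarrow> p0" and f: "range f \<subseteq> \<F>" and \<rho>: "\<rho> \<longlonglongrightarrow> 0"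
      and alt: "compactly_divergent M (\<lambda>j. {\<xi>. p j + of_real (\<rho> j) * \<xi> \<in> \<Omega>}) (\<lambda>j \<xi>. f j (p j + of_real (\<rho> j) * \<xi>)) \<or>
        (\<exists>h. converges_uniformly_on_compacts M (\<lambda>j. {\<xi>. p j + of_real (\<rho> j) * \<xi> \<in> \<Omega>})
            (\<lambda>j \<xi>. f j (p j + of_real (\<rho> j) * \<xi>)) h \<and> brody_curve M A E h \<and> \<not> h constant_on UNIV)"
      unfolding Let_def by blast
    define D where "D = (\<lambda>j. {\<xi>. p j + of_real (\<rho> j) * \<xi> \<in> \<Omega>})"
    define g where "g = (\<lambda>j \<xi>. f j (p j + of_real (\<rho> j) * \<xi>))"
    show "\<not> normal_family \<Omega> M A \<F>"
    proof
      assume nf: "normal_family \<Omega> M A \<F>"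
      obtain U y where U: "ultrafilter U" and Us: "U \<le> sequentially"
        and y0: "\<And>\<xi>. limitin M (\<lambda>j. f j (p j + of_real (\<rho> j) * \<xi>)) y U"
        by (rule normal_family_limit[OF assms(1,5) nf f p \<rho>], rule that)
      have y: "limitin M (\<lambda>j. g j \<xi>) y U" for \<xi> using y0 by (simp add: g_def)
      have Ub: "U \<noteq> bot" by (rule ultrafilter_nontrivial[OF U])
      from alt[folded D_def g_def] show False
      proof
        assume div: "compactly_divergent M D g"
        \<comment> \<open>A compact neighbourhood of \<open>y\<close> contains \<open>g j 0\<close>
          for almost all \<open>j\<close> along \<open>U\<close>, so the single point
          \<open>0\<close> refutes divergence.\<close>
        obtain V L where VL: "openin M V" "compactin M L" "y \<in> V" "V \<subseteq> L"
          using locally_compact limitin_topspace[OF y] unfolding locally_compact_space_def by blast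
        have "\<exists>j0. \<forall>j\<ge>j0. {0} \<subseteq> D j \<and> g j ` {0} \<inter> L = {}"
          by (rule div[unfolded compactly_divergent_def, rule_format]) (use VL(2) in simp)
        then have "eventually (\<lambda>j. g j 0 \<notin> L) sequentially"
          unfolding eventually_sequentially by auto
        from filter_leD[OF Us this] limitinD[OF y VL(1,3)] have "eventually (\<lambda>j. False) U"
          by eventually_elim (use VL(4) in blast)
        then show False using Ub by (simp add: trivial_limit_def)
      next
        assume "\<exists>h. converges_uniformly_on_compacts M D g h \<and> brody_curve M A E h \<and> \<not> h constant_on UNIV"
        then obtain h where h: "converges_uniformly_on_compacts M D g h" "brody_curve M A E h"
          "\<not> h constant_on UNIV" by blast
        \<comment> \<open>Uniform convergence speaks about all metrics of the topology; one exists,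
          and for it \<open>h \<xi>\<close> is the limit of \<open>g j \<xi>\<close> along
          \<open>U\<close>, which is \<open>y\<close> for every \<open>\<xi>\<close>.\<close>
        obtain d where d: "Metric_space (topspace M) d" "Metric_space.mtopology (topspace M) d = M"
          by (rule metricE)
        have "h \<xi> = y" for \<xi>
        proof (rule limitin_Hausdorff_unique[OF _ y Ub Hausdorff])
          have "h \<xi> \<in> topspace M"
            using h(2) hol_on_in_topspace[of UNIV h \<xi>] by (auto simp: brody_curve_iff)
          moreover have "eventually (\<lambda>j. g j \<xi> \<in> topspace M \<and> d (g j \<xi>) (h \<xi>) < \<epsilon>) U" if "\<epsilon> > 0" for \<epsilon>
          proof -
            have "\<exists>j0. \<forall>j\<ge>j0. {\<xi>} \<subseteq> D j \<and> (\<forall>z\<in>{\<xi>}. d (g j z) (h z) < \<epsilon>)"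
              by (rule h(1)[unfolded converges_uniformly_on_compacts_def, rule_format, of d])
                (use d that in simp_all)
            then have "eventually (\<lambda>j. \<xi> \<in> D j \<and> d (g j \<xi>) (h \<xi>) < \<epsilon>) sequentially"
              unfolding eventually_sequentially by auto
            from filter_leD[OF Us this] show ?thesis
            proof eventually_elim
              case (elim j)
              have "hol_on M A \<Omega> (f j)" using f hol by blast
              then have "g j \<xi> \<in> topspace M"
                using elim hol_on_in_topspace by (auto simp: D_def g_def)
              then show ?case using elim by simp
            qed
          qed
          ultimately show "limitin M (\<lambda>j. g j \<xi>) (h \<xi>) U"
            using Metric_space.limitin_metric[OF d(1), unfolded d(2)] by blast
        qed
        then show False using h(3) by (auto simp: constant_on_def)
      qed
    qed
  qed
qed

end
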